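(* Let $1<p<\infty$. There is a constant $c_0\in(0,1/2]$, depending only on $p$ and the space $X$, such that the following holds. Let $\Omega\subset X$ be an open set with $\Omega\ne X$ and let $\mathcal{W}_c(\Omega)$ be a Whitney cover of $\Omega$ with $0<c\le c_0$. Assume further that the complement $X\setminus\Omega$ is uniformly $p$-fat. Then the capacity $\operatorname{cap}_p(\cdot,\Omega)$ is quasiadditive with respect to $\mathcal{W}_c(\Omega)$.
   Context: Space: $X=(X,d,\mu)$ is a complete metric measure space, where $\mu$ is a Borel measure supported on $X$ with $0<\mu(B)<\infty$ for every open ball $B$, and $\mu$ is doubling: there is $C>0$ with $\mu(B(x,2r))\le C\mu(B(x,r))$ for all $x\in X$, $r>0$. Each ball $B$ has a fixed center $x_B$ and radius $\operatorname{rad}(B)$, and $tB=B(x_B,t\operatorname{rad}(B))$ for $t>0$. Upper gradients and Newtonian spaces: a Borel function $g\ge 0$ is an upper gradient of a measurable $f:X\to[-\infty,\infty]$ if $|f(y)-f(x)|\le\int_\gamma g\,ds$ for every compact rectifiable curve $\gamma$ with endpoints $x,y$ (with $\int_\gamma g\,ds=\infty$ required if $|f(x)|$ or $|f(y)|$ is infinite). $N^{1,p}(X)$ is the space of functions with $\|f\|_{N^{1,p}(X)}=(\int_X|f|^p\,d\mu+\inf_g\int_Xg^p\,d\mu)^{1/p}<\infty$, the infimum being over upper gradients $g$ of $f$, modulo $u\sim v$ iff $\|u-v\|_{N^{1,p}(X)}=0$. Poincaré inequality: $X$ supports a $(1,p)$-Poincaré inequality, i.e. there are $C>0$, $\lambda\ge1$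 such that $\frac1{\mu(B)}\int_B|f-f_B|\,d\mu\le Cr\big(\frac1{\mu(\lambda B)}\int_{\lambda B}g^p\,d\mu\big)^{1/p}$ for every ball $B=B(x,r)$, every measurable $f$ and every upper gradient $g$ of $f$, with $f_B=\frac1{\mu(B)}\int_Bf\,d\mu$. Relative capacity: for an open set $\Omega$ and measurable $E\subset\Omega$, $\operatorname{cap}_p(E,\Omega)=\inf_u\inf_{g_u}\int_Xg_u^p\,d\mu$ over all $u\in N^{1,p}(X)$ with $u=0$ on $X\setminus\Omega$, $u=1$ on $E$, $0\le u\le1$, and all upper gradients $g_u$ of $u$; it is $\infty$ if no such $u$ exists. Sets $E\subset\Omega$ are understood to be measurable, as in this definition. Uniform fatness: a closed set $E\subset X$ is uniformly $p$-fat if there is $C>0$ such that $\operatorname{cap}_p(E\cap B,2B)\ge C\operatorname{cap}_p(B,2B)$ for all balls $B$ centered at $E$. Whitney covers: $d_\Omega(x)=\operatorname{dist}(x,X\setminus\Omega)$. For $0<c\le1/2$, a Whitney cover $\mathcal{W}_c(\Omega)=\{B_i\}_{i\in\mathbb{N}}$ is a countable cover of $\Omega$ by balls $B_i=B(x_i,c\,d_\Omega(x_i))$, $x_i\in\Omega$, with uniformly bounded overlap $\sum_i\chi_{B_i}\le C<\infty$ (some $B_i$ may be empty). Quasiadditivity: $\operatorname{cap}_p(\cdot,\Omega)$ is quasiadditive with respect to a cover $\mathcal{W}$ of $\Omega$ if there is $A>0$ such that $\sum_{Q\in\mathcal{W}}\operatorname{cap}_p(E\cap Q,\Omega)\le A\operatorname{cap}_p(E,\Omega)$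 for every $E\subset\Omega$. *)

theory Defs
  imports "HOL-Analysis.Analysis"
begin

text \<open>
  The space X is a type of class \<open>complete_space\<close>. A measure \<open>M\<close> with
  \<open>sets M = sets borel\<close> is the Borel measure; ``measurable'', without further
  qualification, refers to its completion.
\<close>

definition ennreal_pow :: "ennreal \<Rightarrow> real \<Rightarrow> ennreal" where
  "ennreal_pow x a = (if x = \<infinity> then \<infinity> else ennreal (enn2real x powr a))"
  \<comment> \<open>only used with \<open>a > 0\<close>\<close>


subsection \<open>Rectifiable curves and upper gradients\<close>

definition curve_length :: "(real \<Rightarrow> 'a::metric_space) \<Rightarrow> real \<Rightarrow> real \<Rightarrow> ennreal" where
  "curve_length \<gamma> a b =
     (SUP ts\<in>{ts. sorted ts \<and> set ts \<subseteq> {a..b}}.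
        \<Sum>i<length ts - 1. ennreal (dist (\<gamma> (ts ! i)) (\<gamma> (ts ! Suc i))))"

text \<open>
  As usual for upper gradients, curves are nonconstant: for a constant curve the line
  integral is 0, so the clause for infinite values in \<open>upper_gradient\<close> could never hold.
\<close>

definition rectifiable_curve :: "(real \<Rightarrow> 'a::metric_space) \<Rightarrow> bool" where
  "rectifiable_curve \<gamma> \<longleftrightarrow> path \<gamma> \<and> 0 < curve_length \<gamma> 0 1 \<and> curve_length \<gamma> 0 1 < \<infinity>"

text \<open>
  The point at arc length \<open>s\<close> from the start; it does not depend on the choice of \<open>t\<close>,
  since \<open>\<gamma>\<close> is constant wherever its length function is.
\<close>

definition arclength_param :: "(real \<Rightarrow> 'a::metric_space) \<Rightarrow> real \<Rightarrow> 'a" where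
  "arclength_param \<gamma> s = \<gamma> (SOME t. t \<in> {0..1} \<and> curve_length \<gamma> 0 t = ennreal s)"

definition line_integral :: "('a::metric_space \<Rightarrow> ennreal) \<Rightarrow> (real \<Rightarrow> 'a) \<Rightarrow> ennreal" where
  "line_integral g \<gamma> =
     (\<integral>\<^sup>+s\<in>{0..enn2real (curve_length \<gamma> 0 1)}. g (arclength_param \<gamma> s) \<partial>lborel)"

definition upper_gradient :: "('a::metric_space \<Rightarrow> ereal) \<Rightarrow> ('a \<Rightarrow> ennreal) \<Rightarrow> bool" where
  "upper_gradient f g \<longleftrightarrow>
     g \<in> borel_measurable borel \<and>
     (\<forall>\<gamma>. rectifiable_curve \<gamma> \<longrightarrow>
        (if \<bar>f (pathstart \<gamma>)\<bar> = \<infinity> \<or> \<bar>f (pathfinish \<gamma>)\<bar> = \<infinity>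
         then line_integral g \<gamma> = \<infinity>
         else e2ennreal \<bar>f (pathfinish \<gamma>) - f (pathstart \<gamma>)\<bar> \<le> line_integral g \<gamma>))"


subsection \<open>Newtonian functions and relative capacity\<close>

definition newtonian_norm :: "'a::metric_space measure \<Rightarrow> real \<Rightarrow> ('a \<Rightarrow> ereal) \<Rightarrow> ennreal" where
  "newtonian_norm M p f =
     ennreal_pow
       ((\<integral>\<^sup>+x. ennreal_pow (e2ennreal \<bar>f x\<bar>) p \<partial>completion M) +
        (INF g\<in>{g. upper_gradient f g}. \<integral>\<^sup>+x. ennreal_pow (g x) p \<partial>M))
       (1 / p)"

text \<open>
  These are the functions representing the classes of \<open>N\<^sup>1\<^sup>,\<^sup>p(X)\<close>. The quotient by
  \<open>\<parallel>u - v\<parallel> = 0\<close> is not formed, because the capacity below prescribes pointwise values.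
\<close>

definition newtonian :: "'a::metric_space measure \<Rightarrow> real \<Rightarrow> ('a \<Rightarrow> ereal) set" where
  "newtonian M p =
     {f. f \<in> borel_measurable (completion M) \<and> newtonian_norm M p f < \<infinity>}"

definition cap_admissible ::
    "'a::metric_space measure \<Rightarrow> real \<Rightarrow> 'a set \<Rightarrow> 'a set \<Rightarrow> ('a \<Rightarrow> ereal) set" where
  "cap_admissible M p E \<Omega> =
     {u \<in> newtonian M p. (\<forall>x. x \<notin> \<Omega> \<longrightarrow> u x = 0) \<and> (\<forall>x\<in>E. u x = 1) \<and>
                         (\<forall>x. 0 \<le> u x \<and> u x \<le> 1)}"

definition rel_cap :: "'a::metric_space measure \<Rightarrow> real \<Rightarrow> 'a set \<Rightarrow> 'a set \<Rightarrow> ennreal" where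
  "rel_cap M p E \<Omega> =
     (INF u\<in>cap_admissible M p E \<Omega>. INF g\<in>{g. upper_gradient u g}.
        \<integral>\<^sup>+x. ennreal_pow (g x) p \<partial>M)"


subsection \<open>Standing assumptions on the space\<close>

definition doubling :: "'a::metric_space measure \<Rightarrow> bool" where
  "doubling M \<longleftrightarrow>
     (\<exists>C::real. C > 0 \<and>
       (\<forall>x r. r > 0 \<longrightarrow> emeasure M (ball x (2 * r)) \<le> ennreal C * emeasure M (ball x r)))"

definition ball_average :: "'a::metric_space measure \<Rightarrow> ('a \<Rightarrow> ereal) \<Rightarrow> 'a \<Rightarrow> real \<Rightarrow> real" where
  "ball_average M f x r =
     (LINT y:ball x r|completion M. real_of_ereal (f y)) / measure M (ball x r)"

text \<open>
  The inequality is required for those measurable \<open>f\<close> that are integrable on the ball, so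
  that \<open>f\<^sub>B\<close> is defined as a real number.
\<close>

definition poincare_inequality :: "'a::metric_space measure \<Rightarrow> real \<Rightarrow> bool" where
  "poincare_inequality M p \<longleftrightarrow>
     (\<exists>C L::real. C > 0 \<and> L \<ge> 1 \<and>
       (\<forall>x r f g. r > 0 \<and> f \<in> borel_measurable (completion M) \<and> upper_gradient f g \<and>
          (\<integral>\<^sup>+y\<in>ball x r. e2ennreal \<bar>f y\<bar> \<partial>completion M) < \<infinity> \<longrightarrow>
          (\<integral>\<^sup>+y\<in>ball x r. e2ennreal \<bar>f y - ereal (ball_average M f x r)\<bar> \<partial>completion M)
            / emeasure M (ball x r)
          \<le> ennreal (C * r) *
            ennreal_pow ((\<integral>\<^sup>+y\<in>ball x (L * r). ennreal_pow (g y) p \<partial>M)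
                           / emeasure M (ball x (L * r))) (1 / p)))"


subsection \<open>Fatness, Whitney covers, quasiadditivity\<close>

definition uniformly_fat :: "'a::metric_space measure \<Rightarrow> real \<Rightarrow> 'a set \<Rightarrow> bool" where
  "uniformly_fat M p E \<longleftrightarrow>
     closed E \<and>
     (\<exists>C::real. C > 0 \<and>
       (\<forall>x\<in>E. \<forall>r>0. rel_cap M p (E \<inter> ball x r) (ball x (2 * r))
                     \<ge> ennreal C * rel_cap M p (ball x r) (ball x (2 * r))))"

text \<open>
  A cover is a sequence of sets; members may be empty, which accounts for finite covers.
  The distance \<open>d\<^sub>\<Omega>\<close> is \<open>infdist\<close> to the complement and is meaningful for \<open>\<Omega> \<noteq> UNIV\<close>.
\<close>

definition whitney_cover :: "'a::metric_space set \<Rightarrow> real \<Rightarrow> (nat \<Rightarrow> 'a set) \<Rightarrow> bool" where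
  "whitney_cover \<Omega> c B \<longleftrightarrow>
     0 < c \<and> c \<le> 1 / 2 \<and>
     (\<forall>i. B i = {} \<or> (\<exists>x\<in>\<Omega>. B i = ball x (c * infdist x (- \<Omega>)))) \<and>
     \<Omega> \<subseteq> (\<Union>i. B i) \<and>
     (\<exists>C::real. \<forall>y. (\<Sum>i. indicator (B i) y) \<le> ennreal C)"

definition quasiadditive ::
    "'a::metric_space measure \<Rightarrow> real \<Rightarrow> 'a set \<Rightarrow> (nat \<Rightarrow> 'a set) \<Rightarrow> bool" where
  "quasiadditive M p \<Omega> W \<longleftrightarrow>
     (\<exists>A::real. A > 0 \<and>
       (\<forall>E. E \<subseteq> \<Omega> \<and> E \<in> sets (completion M) \<longrightarrow>
          (\<Sum>i. rel_cap M p (E \<inter> W i) \<Omega>) \<le> ennreal A * rel_cap M p E \<Omega>))"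

end

theory Submission
  imports Defs
begin

text \<open>
  Let \<open>u\<close> be a test function for the capacity of \<open>E\<close>, with upper gradient \<open>g\<close>. Multiplying \<open>u\<close> by a
  Lipschitz cutoff \<open>\<eta>\<^sub>i\<close> adapted to the Whitney ball \<open>B\<^sub>i = B(x\<^sub>i, c d\<^sub>i)\<close>, where \<open>d\<^sub>i\<close> is the distance
  of \<open>x\<^sub>i\<close> to the complement, gives a test function for \<open>E \<inter> B\<^sub>i\<close> whose energy is at most a constant
  times the integral of \<open>g\<^sup>p + u\<^sup>p / d\<^sub>i\<^sup>p\<close> over \<open>3B\<^sub>i\<close>. The enlarged balls overlap boundedly, so the
  theorem follows from the Hardy inequality: the sum of \<open>d\<^sub>i\<^sup>-\<^sup>p \<integral> u\<^sup>p\<close> over the balls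
  \<open>B(x\<^sub>i, d\<^sub>i / 2)\<close> is at most \<open>C \<integral> g\<^sup>p\<close>. These contain the balls
  \<open>3B\<^sub>i\<close> if \<open>c \<le> c\<^sub>0 = 1 / 8\<close>.

  The Hardy inequality comes from fatness by way of three estimates.

  \<^item> The Poincare inequality with exponents \<open>(1, p)\<close> implies the one with exponents \<open>(p, p)\<close>
    (\<open>poincare_equal_exponents\<close>): a ball is covered by much smaller balls of bounded overlap, the
    oscillation on each of them gains a power of the radius, and this gain allows an induction on
    scales.

  \<^item> On a ball \<open>B\<close> centred on the complement let \<open>a\<close> be its constant in the Poincare inequality. The function
    \<open>(1 - u / a)\<^sub>+\<close> times a cutoff is a test function for the part of the complement in \<open>B\<close>, so
    fatness bounds \<open>a\<close> from above by the energy of \<open>u\<close>. Hence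
    \<open>\<integral> u\<^sup>p \<le> C d(x)\<^sup>p \<integral> g\<^sup>p\<close>, with the ball \<open>B(x, d(x) / 2)\<close> on the left and a larger concentric
    ball \<open>B(x, \<Lambda> d(x))\<close> on the right (\<open>boundary_poincare_of_fat\<close>).

  \<^item> These local estimates overlap too much near the complement to be added directly. Following
    Wannebo, they are applied to \<open>u d\<^sup>\<beta>\<^sup>/\<^sup>p\<close> and added with weights \<open>d\<^sub>i\<^sup>-\<^sup>p\<^sup>-\<^sup>\<beta>\<close>. The weights turn the
    overlap into a geometric series of sum \<open>O(1 / \<beta>)\<close>, while the derivative of \<open>d\<^sup>\<beta>\<^sup>/\<^sup>p\<close> contributes
    only \<open>\<beta>\<^sup>p\<close> times the Hardy integral itself. As \<open>p > 1\<close>, the total factor \<open>\<beta>\<^sup>p\<^sup>-\<^sup>1\<close> is small for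
    small \<open>\<beta>\<close> and this term is absorbed (\<open>hardy\<close>). To absorb a finite quantity, the weight is
    truncated at distance of order \<open>\<delta>\<close>, and the resulting estimate does not depend on \<open>\<delta>\<close>.

  Both product estimates, for cutoffs and for powers of the distance, need that an upper gradient
  controls a function along subcurves, in the arc length parametrization of the whole curve.
\<close>

section \<open>Arc length\<close>

text \<open>
  The sums in \<open>curve_length\<close>, in a form suited to induction on lists.
\<close>

fun polygon_length :: "(real \<Rightarrow> 'a::metric_space) \<Rightarrow> real list \<Rightarrow> real" where
  "polygon_length \<gamma> [] = 0"
| "polygon_length \<gamma> [x] = 0"
| "polygon_length \<gamma> (x # y # zs) = dist (\<gamma> x) (\<gamma> y) + polygon_length \<gamma> (y # zs)"

lemma polygon_length_nonneg [simp]: "0 \<le> polygon_length \<gamma> ts"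
  by (induction \<gamma> ts rule: polygon_length.induct) auto

lemma polygon_length_eq:
  "(\<Sum>i<length ts - 1. ennreal (dist (\<gamma> (ts ! i)) (\<gamma> (ts ! Suc i)))) = ennreal (polygon_length \<gamma> ts)"
proof (induction \<gamma> ts rule: polygon_length.induct)
  case (3 \<gamma> x y zs)
  have "(\<Sum>i<length (x # y # zs) - 1. ennreal (dist (\<gamma> ((x # y # zs) ! i)) (\<gamma> ((x # y # zs) ! Suc i))))
    = ennreal (dist (\<gamma> x) (\<gamma> y)) +
      (\<Sum>i<length (y # zs) - 1. ennreal (dist (\<gamma> ((y # zs) ! i)) (\<gamma> ((y # zs) ! Suc i))))"
    by (simp add: sum.lessThan_Suc_shift del: sum.lessThan_Suc)
  also have "\<dots> = ennreal (polygon_length \<gamma> (x # y # zs))"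
    by (simp only: 3) (simp add: ennreal_plus)
  finally show ?case .
qed auto

lemma curve_length_polygon:
  "curve_length \<gamma> a b = (SUP ts\<in>{ts. sorted ts \<and> set ts \<subseteq> {a..b}}. ennreal (polygon_length \<gamma> ts))"
  unfolding curve_length_def polygon_length_eq ..

lemma polygon_length_le_curve_length:
  assumes "sorted ts" "set ts \<subseteq> {a..b}"
  shows "ennreal (polygon_length \<gamma> ts) \<le> curve_length \<gamma> a b"
  unfolding curve_length_polygon by (rule SUP_upper) (use assms in auto)

lemma polygon_length_append_ge:
  "polygon_length \<gamma> us + polygon_length \<gamma> vs \<le> polygon_length \<gamma> (us @ vs)"
proof (induction \<gamma> us rule: polygon_length.induct)
  case (2 \<gamma> x)
  then show ?case by (cases vs) auto
qed auto

text \<open>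
  Cutting a polygon open between two vertices and inserting a chord from \<open>\<gamma> x\<close> to \<open>\<gamma> y\<close> only
  lengthens it. With \<open>x = y\<close> this gives additivity of length; with \<open>x < y\<close> it gives continuity.
\<close>

lemma polygon_length_split:
  "polygon_length \<gamma> (us @ vs)
    \<le> polygon_length \<gamma> (us @ [x]) + dist (\<gamma> x) (\<gamma> y) + polygon_length \<gamma> (y # vs)"
proof (induction \<gamma> us rule: polygon_length.induct)
  case (1 \<gamma>)
  then show ?case by (cases vs) auto
next
  case (2 \<gamma> z)
  show ?case
  proof (cases vs)
    case (Cons v vs')
    have "dist (\<gamma> z) (\<gamma> v) \<le> dist (\<gamma> z) (\<gamma> x) + dist (\<gamma> x) (\<gamma> y) + dist (\<gamma> y) (\<gamma> v)"
      by (meson dist_triangle_le order_refl add_mono dist_triangle order_trans add_right_mono)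
    then show ?thesis by (simp add: Cons)
  qed auto
qed auto

lemma sorted_split:
  assumes "sorted (ts :: real list)"
  shows "ts = filter (\<lambda>x. x \<le> s) ts @ filter (\<lambda>x. x > s) ts"
  using assms(1)
proof (induction ts)
  case (Cons a ts)
  then have "a > s \<Longrightarrow> filter (\<lambda>x. x \<le> s) ts = []" by (auto simp: filter_empty_conv)
  with Cons show ?case by auto
qed auto

lemma polygon_length_le_gap:
  assumes ts: "sorted ts" "set ts \<subseteq> {a..b}" and gap: "set ts \<inter> {s<..<t} = {}"
    and st: "a \<le> s" "s \<le> t" "t \<le> b"
  shows "ennreal (polygon_length \<gamma> ts)
    \<le> curve_length \<gamma> a s + ennreal (dist (\<gamma> s) (\<gamma> t)) + curve_length \<gamma> t b"
proof -
  define us where "us = filter (\<lambda>x. x \<le> s) ts"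
  define vs where "vs = filter (\<lambda>x. x > s) ts"
  have "polygon_length \<gamma> ts
      \<le> polygon_length \<gamma> (us @ [s]) + dist (\<gamma> s) (\<gamma> t) + polygon_length \<gamma> (t # vs)"
    using sorted_split[OF ts(1), of s] polygon_length_split[of \<gamma> us vs s t]
    unfolding us_def vs_def by simp
  then have "ennreal (polygon_length \<gamma> ts)
      \<le> ennreal (polygon_length \<gamma> (us @ [s])) + ennreal (dist (\<gamma> s) (\<gamma> t))
        + ennreal (polygon_length \<gamma> (t # vs))"
    by (simp flip: ennreal_plus)
  also have "\<dots> \<le> curve_length \<gamma> a s + ennreal (dist (\<gamma> s) (\<gamma> t)) + curve_length \<gamma> t b"
  proof (intro add_mono polygon_length_le_curve_length order_refl)
    show "sorted (us @ [s])" "set (us @ [s]) \<subseteq> {a..s}"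
      using ts st unfolding us_def by (auto simp: sorted_append sorted_wrt_filter)
    show "sorted (t # vs)" "set (t # vs) \<subseteq> {t..b}"
      using ts st gap unfolding vs_def by (force simp: sorted_wrt_filter)+
  qed
  finally show ?thesis .
qed

lemma curve_length_add:
  assumes "a \<le> b" "b \<le> c"
  shows "curve_length \<gamma> a c = curve_length \<gamma> a b + curve_length \<gamma> b c"
proof (rule antisym)
  show "curve_length \<gamma> a c \<le> curve_length \<gamma> a b + curve_length \<gamma> b c"
    unfolding curve_length_polygon[of \<gamma> a c]
    using polygon_length_le_gap[of _ a c b b \<gamma>] assms by (intro SUP_least) auto
  have *: "ennreal (polygon_length \<gamma> us) + ennreal (polygon_length \<gamma> vs) \<le> curve_length \<gamma> a c"
    if "sorted us" "set us \<subseteq> {a..b}" "sorted vs" "set vs \<subseteq> {b..c}" for us vs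
  proof -
    have "ennreal (polygon_length \<gamma> us) + ennreal (polygon_length \<gamma> vs)
        \<le> ennreal (polygon_length \<gamma> (us @ vs))"
      using polygon_length_append_ge[of \<gamma> us vs] by (simp flip: ennreal_plus)
    also have "\<dots> \<le> curve_length \<gamma> a c"
      by (rule polygon_length_le_curve_length) (use that assms in \<open>force simp: sorted_append\<close>)+
    finally show ?thesis .
  qed
  have ne: "{ts. sorted ts \<and> set ts \<subseteq> {x..y}} \<noteq> {}" for x y :: real
    by (auto intro!: exI[of _ "[]"])
  have "curve_length \<gamma> a b + ennreal (polygon_length \<gamma> vs) \<le> curve_length \<gamma> a c"
    if "sorted vs" "set vs \<subseteq> {b..c}" for vs
    unfolding curve_length_polygon[of \<gamma> a b]
    by (subst ennreal_SUP_add_left[symmetric])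
      (use ne that * in \<open>auto intro!: SUP_least\<close>)
  then show "curve_length \<gamma> a b + curve_length \<gamma> b c \<le> curve_length \<gamma> a c"
    by (subst curve_length_polygon[of \<gamma> b c], subst ennreal_SUP_add_right)
      (use ne in \<open>auto intro!: SUP_least\<close>)
qed

lemma dist_le_curve_length:
  assumes "a \<le> b"
  shows "ennreal (dist (\<gamma> a) (\<gamma> b)) \<le> curve_length \<gamma> a b"
  using polygon_length_le_curve_length[of "[a, b]" a b \<gamma>] assms by simp

lemma curve_length_affine:
  assumes "k > 0"
  shows "curve_length (\<lambda>t. \<gamma> (m + t * k)) a b = curve_length \<gamma> (m + a * k) (m + b * k)"
proof -
  have pl: "polygon_length (\<lambda>t. \<gamma> (m + t * k)) ts = polygon_length \<gamma> (map (\<lambda>t. m + t * k) ts)" for ts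
    by (induction "\<lambda>t. \<gamma> (m + t * k)" ts rule: polygon_length.induct) auto
  have srt: "sorted (map (\<lambda>t. m' + t * k') ts)" if "sorted ts" "k' > 0" for m' k' :: real and ts
    unfolding sorted_map
    by (rule sorted_wrt_mono_rel[OF _ that(1)]) (use that(2) in \<open>simp\<close>)
  have "(\<lambda>ts. ennreal (polygon_length (\<lambda>t. \<gamma> (m + t * k)) ts)) ` {ts. sorted ts \<and> set ts \<subseteq> {a..b}}
      = (\<lambda>ts. ennreal (polygon_length \<gamma> ts)) ` {ts. sorted ts \<and> set ts \<subseteq> {m + a * k..m + b * k}}"
    (is "?A = ?B")
  proof
    show "?A \<subseteq> ?B"
    proof safe
      fix ts :: "real list" assume "sorted ts" "set ts \<subseteq> {a..b}"
      moreover from this have "sorted (map (\<lambda>t. m + t * k) ts)"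
        using assms by (intro srt)
      moreover have "set (map (\<lambda>t. m + t * k) ts) \<subseteq> {m + a * k..m + b * k}"
        unfolding set_map image_subset_iff atLeastAtMost_iff
        using \<open>set ts \<subseteq> {a..b}\<close> assms
        by (meson add_left_mono atLeastAtMost_iff less_imp_le mult_right_mono subsetD)
      ultimately show "ennreal (polygon_length (\<lambda>t. \<gamma> (m + t * k)) ts) \<in> ?B"
        by (intro image_eqI[where x="map (\<lambda>t. m + t * k) ts"] CollectI conjI) (simp only: pl)
    qed
    show "?B \<subseteq> ?A"
    proof safe
      fix ts :: "real list" assume ts: "sorted ts" "set ts \<subseteq> {m + a * k..m + b * k}"
      define us where "us = map (\<lambda>t. - m / k + t * (1 / k)) ts"
      have "map (\<lambda>t. m + t * k) us = ts"
        using assms unfolding us_def by (auto simp: o_def field_simps intro!: map_idI)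
      moreover have "sorted us" unfolding us_def using ts assms by (intro srt) auto
      moreover have "set us \<subseteq> {a..b}" using ts(2) assms unfolding us_def by (auto simp: field_simps)
      ultimately show "ennreal (polygon_length \<gamma> ts) \<in> ?A"
        by (intro image_eqI[where x=us] CollectI conjI) (simp only: pl)
    qed
  qed
  then show ?thesis unfolding curve_length_polygon by simp
qed

text \<open>
  Take a polygon whose length is within \<open>e\<close> of that of the curve. On a parameter interval without
  vertices in its interior the polygon gains at most the chord of the interval, so there the curve is
  longer than the chord by at most \<open>e\<close>.
\<close>

lemma curve_length_le_gap:
  assumes fin: "curve_length \<gamma> a b < \<infinity>" and e: "e > 0" and ab: "a \<le> b"
  shows "\<exists>T. finite T \<and> (\<forall>s t. a \<le> s \<and> s \<le> t \<and> t \<le> b \<and> T \<inter> {s<..<t} = {} \<longrightarrow>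
           curve_length \<gamma> s t \<le> ennreal (e + dist (\<gamma> s) (\<gamma> t)))"
proof -
  define l where "l = enn2real (curve_length \<gamma> a b)"
  have l: "curve_length \<gamma> a b = ennreal l" using fin unfolding l_def by simp
  \<comment> \<open>A polygon of almost full length; its vertices are the set \<open>T\<close>.\<close>
  have "\<exists>ts\<in>{ts. sorted (ts :: real list) \<and> set ts
      \<subseteq> {a..b}}. ennreal l < ennreal (polygon_length \<gamma> ts) + ennreal e"
  proof (rule SUP_approx_ennreal)
    show "{ts. sorted ts \<and> set ts \<subseteq> {a..b}} \<noteq> {}" by (auto intro!: exI[of _ "[]"])
  qed (use e l in \<open>auto simp: curve_length_polygon\<close>)
  then obtain ts where ts: "sorted ts" "set ts \<subseteq> {a..b}"
      and big: "ennreal l < ennreal (polygon_length \<gamma> ts) + ennreal e"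
    by auto
  show ?thesis
  proof (intro exI conjI allI impI)
    show "finite (set ts)" by simp
    fix s t assume *: "a \<le> s \<and> s \<le> t \<and> t \<le> b \<and> set ts \<inter> {s<..<t} = {}"
    have sum: "curve_length \<gamma> a b = curve_length \<gamma> a s + curve_length \<gamma> s t + curve_length \<gamma> t b"
      using curve_length_add[of a s b \<gamma>] curve_length_add[of s t b \<gamma>] * by (simp add: add.assoc)
    have lt: "curve_length \<gamma> a s < top" "curve_length \<gamma> s t < top" "curve_length \<gamma> t b < top"
      using sum fin by (auto simp: less_top)
    have "curve_length \<gamma> a b \<le> ennreal (polygon_length \<gamma> ts) + ennreal e" using l big by simp
    also have "\<dots> \<le> curve_length \<gamma> a s + ennreal (dist (\<gamma> s) (\<gamma> t)) + curve_length \<gamma> t b + ennreal e"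
      by (intro add_right_mono polygon_length_le_gap) (use ts * in auto)
    finally show "curve_length \<gamma> s t \<le> ennreal (e + dist (\<gamma> s) (\<gamma> t))"
      using lt unfolding sum using e
      by (cases "curve_length \<gamma> a s"; cases "curve_length \<gamma> s t"; cases "curve_length \<gamma> t b")
        (auto simp flip: ennreal_plus)
  qed
qed

lemma continuous_on_curve_length:
  fixes \<gamma> :: "real \<Rightarrow> 'a::metric_space"
  assumes cont: "continuous_on {a..b} \<gamma>" and fin: "curve_length \<gamma> a b < \<infinity>" and ab: "a \<le> b"
  shows "continuous_on {a..b} (\<lambda>t. enn2real (curve_length \<gamma> a t))"
  unfolding continuous_on_iff
proof (intro ballI allI impI)
  fix t0 e :: real assume t0: "t0 \<in> {a..b}" and e: "e > 0"
  obtain T where T: "finite T" "\<And>s t. \<lbrakk>a \<le> s; s \<le> t; t \<le> b; T \<inter> {s<..<t} = {}\<rbrakk>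
      \<Longrightarrow> curve_length \<gamma> s t \<le> ennreal (e / 2 + dist (\<gamma> s) (\<gamma> t))"
    using curve_length_le_gap[OF fin _ ab, of "e / 2"] e by auto
  obtain d1 where d1: "d1 > 0" "\<And>t. \<lbrakk>t \<in> {a..b}; dist t t0 < d1\<rbrakk> \<Longrightarrow> dist (\<gamma> t) (\<gamma> t0) < e / 2"
    using cont t0 e unfolding continuous_on_iff by (meson half_gt_zero)
  obtain d2 where d2: "d2 > 0" "\<And>t. \<lbrakk>t \<in> T; t \<noteq> t0\<rbrakk> \<Longrightarrow> d2 \<le> dist t0 t"
    using finite_set_avoid[OF T(1), of t0] by auto
  have step: "\<bar>enn2real (curve_length \<gamma> a t) - enn2real (curve_length \<gamma> a s)\<bar> < e"
    if st: "a \<le> s" "s \<le> t" "t \<le> b" "T \<inter> {s<..<t} = {}" "dist (\<gamma> s) (\<gamma> t) < e / 2" for s t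
  proof -
    have sum: "curve_length \<gamma> a b = curve_length \<gamma> a s + curve_length \<gamma> s t + curve_length \<gamma> t b"
      using curve_length_add[of a s b \<gamma>] curve_length_add[of s t b \<gamma>] st by (simp add: add.assoc)
    have lt: "curve_length \<gamma> a s < top" "curve_length \<gamma> s t < top"
      using sum fin by (auto simp: less_top)
    have eq: "enn2real (curve_length \<gamma> a t) = enn2real (curve_length \<gamma> a s) + enn2real (curve_length \<gamma> s t)"
      using curve_length_add[of a s t \<gamma>] st lt by (simp add: enn2real_plus)
    have "enn2real (curve_length \<gamma> s t) \<le> e / 2 + dist (\<gamma> s) (\<gamma> t)"
      using T(2)[OF st(1-4)] e by (simp add: enn2real_leI)
    with st(5) eq show ?thesis by simp
  qed
  show "\<exists>d>0. \<forall>t\<in>{a..b}. dist t t0 < d \<longrightarrow>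
      dist (enn2real (curve_length \<gamma> a t)) (enn2real (curve_length \<gamma> a t0)) < e"
  proof (intro exI[of _ "min d1 d2"] conjI ballI impI)
    show "min d1 d2 > 0" using d1 d2 by simp
    fix t assume t: "t \<in> {a..b}" "dist t t0 < min d1 d2"
    have gap: "T \<inter> {t<..<t0} = {}" "T \<inter> {t0<..<t} = {}"
      using d2(2) t(2) by (fastforce simp: dist_real_def)+
    have d: "dist (\<gamma> t) (\<gamma> t0) < e / 2" using d1 t by simp
    show "dist (enn2real (curve_length \<gamma> a t)) (enn2real (curve_length \<gamma> a t0)) < e"
      using step[of t t0] step[of t0 t] t t0 gap d
      by (cases "t \<le> t0") (auto simp: dist_real_def dist_commute abs_minus_commute)
  qed
qed

text \<open>
  Length is continuous, so every arc length between \<open>0\<close> and the total length is attained and the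
  choice in \<open>arclength_param\<close> is harmless. Outside that range \<open>\<sigma>\<close> is extended by constants to keep it
  Lipschitz on the line. The last clause is what makes upper gradients usable: every
  piece of \<open>\<sigma>\<close> is again a rectifiable curve, and its line integrals are those of \<open>\<sigma>\<close>.
\<close>

lemma arclength_parametrization:
  fixes \<gamma> :: "real \<Rightarrow> 'a::metric_space"
  assumes "rectifiable_curve \<gamma>"
  obtains l \<sigma> where "l > 0" "\<And>s t. dist (\<sigma> s) (\<sigma> t) \<le> \<bar>s - t\<bar>"
    "\<sigma> 0 = pathstart \<gamma>" "\<sigma> l = pathfinish \<gamma>"
    "\<And>h. line_integral h \<gamma> = (\<integral>\<^sup>+s\<in>{0..l}. h (\<sigma> s) \<partial>lborel)"
    "\<And>a b. \<lbrakk>0 \<le> a; a < b; b \<le> l\<rbrakk> \<Longrightarrow>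
      \<exists>\<gamma>'. rectifiable_curve \<gamma>' \<and> pathstart \<gamma>' = \<sigma> a \<and> pathfinish \<gamma>' = \<sigma> b \<and>
           (\<forall>h\<in>borel_measurable borel. line_integral h \<gamma>' = (\<integral>\<^sup>+s\<in>{a..b}. h (\<sigma> s) \<partial>lborel))"
proof -
  have cont: "continuous_on {0..1} \<gamma>" and fin: "curve_length \<gamma> 0 1 < \<infinity>" and pos: "0 < curve_length \<gamma> 0 1"
    using assms by (auto simp: rectifiable_curve_def path_def)
  define \<Lambda> where "\<Lambda> t = enn2real (curve_length \<gamma> 0 t)" for t
  define l where "l = \<Lambda> 1"
  have lpos: "l > 0" using pos fin unfolding l_def \<Lambda>_def by (auto simp: enn2real_positive_iff)
  have \<Lambda>cont: "continuous_on {0..1} \<Lambda>"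
    unfolding \<Lambda>_def by (rule continuous_on_curve_length) (use cont fin in auto)
  have fin': "curve_length \<gamma> s t < top" if "0 \<le> s" "s \<le> t" "t \<le> 1" for s t
  proof -
    have "curve_length \<gamma> 0 1 = curve_length \<gamma> 0 s + (curve_length \<gamma> s t + curve_length \<gamma> t 1)"
      using curve_length_add[of 0 s 1 \<gamma>] curve_length_add[of s t 1 \<gamma>] that by simp
    then show ?thesis using fin by (auto simp: less_top)
  qed
  have \<Lambda>: "curve_length \<gamma> 0 t = ennreal (\<Lambda> t)" if "0 \<le> t" "t \<le> 1" for t
    using fin'[of 0 t] that unfolding \<Lambda>_def by simp
  have \<Lambda>nn: "0 \<le> \<Lambda> t" for t unfolding \<Lambda>_def by simp
  have \<Lambda>diff: "curve_length \<gamma> s t = ennreal (\<Lambda> t - \<Lambda> s)" "\<Lambda> s \<le> \<Lambda> t" if "0 \<le> s" "s \<le> t" "t \<le> 1" for s t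
  proof -
    have "ennreal (\<Lambda> t) = ennreal (\<Lambda> s) + curve_length \<gamma> s t"
      using curve_length_add[of 0 s t \<gamma>] \<Lambda>[of s] \<Lambda>[of t] that by simp
    then show "curve_length \<gamma> s t = ennreal (\<Lambda> t - \<Lambda> s)" "\<Lambda> s \<le> \<Lambda> t"
      using \<Lambda>nn[of s] \<Lambda>nn[of t] by (cases "curve_length \<gamma> s t"; auto simp flip: ennreal_plus)+
  qed
  have \<Lambda>0: "\<Lambda> 0 = 0"
    using \<Lambda>diff(1)[of 0 0] \<Lambda>[of 0] \<Lambda>nn[of 0] by (metis diff_self ennreal_0 ennreal_eq_0_iff
        order_antisym order_refl zero_le_one)
  have dist\<Lambda>: "dist (\<gamma> s) (\<gamma> t) \<le> \<bar>\<Lambda> s - \<Lambda> t\<bar>" if "s \<in> {0..1}" "t \<in> {0..1}" for s t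
  proof -
    have *: "dist (\<gamma> s) (\<gamma> t) \<le> \<Lambda> t - \<Lambda> s" if "0 \<le> s" "s \<le> t" "t \<le> 1" for s t
      using dist_le_curve_length[OF that(2), of \<gamma>] \<Lambda>diff[OF that] by (simp add: ennreal_le_iff)
    from *[of s t] *[of t s] show ?thesis
      using that by (cases "s \<le> t") (auto simp: dist_commute)
  qed
  have ivt: "\<exists>t. s \<le> t \<and> t \<le> s' \<and> \<Lambda> t = y" if "0 \<le> s" "s \<le> s'" "s' \<le> 1" "\<Lambda> s \<le> y" "y \<le> \<Lambda> s'" for s s' y
    by (rule IVT'[OF that(4,5,2)]) (rule continuous_on_subset[OF \<Lambda>cont], use that in auto)
  define \<sigma>0 where "\<sigma>0 = arclength_param \<gamma>"
  have \<sigma>0: "\<sigma>0 (\<Lambda> t) = \<gamma> t" if t: "t \<in> {0..1}" for t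
  proof -
    have "\<exists>t'. t' \<in> {0..1} \<and> curve_length \<gamma> 0 t' = ennreal (\<Lambda> t)" using \<Lambda> t by auto
    from someI_ex[OF this] obtain t' where t': "t' \<in> {0..1}" "curve_length \<gamma> 0 t' = ennreal (\<Lambda> t)"
      "\<sigma>0 (\<Lambda> t) = \<gamma> t'" unfolding \<sigma>0_def arclength_param_def by blast
    then have "\<Lambda> t' = \<Lambda> t" using \<Lambda>nn unfolding \<Lambda>_def[of t'] by simp
    then have "dist (\<gamma> t') (\<gamma> t) = 0" using dist\<Lambda>[OF t'(1) t] by simp
    with t' show ?thesis by simp
  qed
  define \<sigma> where "\<sigma> s = \<sigma>0 (max 0 (min l s))" for s
  have \<sigma>eq: "\<sigma> s = \<sigma>0 s" if "0 \<le> s" "s \<le> l" for s using that by (simp add: \<sigma>_def)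
  have par: "\<exists>t\<in>{0..1}. max 0 (min l s) = \<Lambda> t" for s
  proof -
    obtain t where "0 \<le> t" "t \<le> 1" "\<Lambda> t = max 0 (min l s)"
      using ivt[of 0 1 "max 0 (min l s)"] lpos \<Lambda>0 unfolding l_def by auto
    then show ?thesis by (intro bexI[of _ t]) auto
  qed
  have lip: "dist (\<sigma> s) (\<sigma> t) \<le> \<bar>s - t\<bar>" for s t
  proof -
    obtain s' t' where *: "s' \<in> {0..1}" "t' \<in> {0..1}" "max 0 (min l s) = \<Lambda> s'" "max 0 (min l t) = \<Lambda> t'"
      using par[of s] par[of t] by blast
    then have "dist (\<sigma> s) (\<sigma> t) \<le> \<bar>max 0 (min l s) - max 0 (min l t)\<bar>"
      unfolding \<sigma>_def using \<sigma>0 dist\<Lambda> by auto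
    also have "\<dots> \<le> \<bar>s - t\<bar>" by (auto simp: max_def min_def)
    finally show ?thesis .
  qed
  have \<sigma>cont: "continuous_on UNIV \<sigma>"
    unfolding continuous_on_iff using lip by (metis dist_commute dist_real_def le_less_trans)
  have [measurable]: "\<sigma> \<in> borel_measurable borel"
    by (rule borel_measurable_continuous_onI[OF \<sigma>cont])
  show thesis
  proof (rule that[of l \<sigma>])
    show "l > 0" by fact
    show "dist (\<sigma> s) (\<sigma> t) \<le> \<bar>s - t\<bar>" for s t by (rule lip)
    show "\<sigma> 0 = pathstart \<gamma>" "\<sigma> l = pathfinish \<gamma>"
      using \<sigma>0[of 0] \<sigma>0[of 1] lpos \<Lambda>0 by (auto simp: \<sigma>_def l_def pathstart_def pathfinish_def)
    show "line_integral h \<gamma> = (\<integral>\<^sup>+s\<in>{0..l}. h (\<sigma> s) \<partial>lborel)" for h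
      unfolding line_integral_def \<Lambda>_def[symmetric] l_def[symmetric] \<sigma>0_def[symmetric]
      by (intro nn_integral_cong) (auto simp: \<sigma>eq indicator_def)
    fix a b assume ab: "0 \<le> a" "a < b" "b \<le> l"
    obtain t1 t2 where t1: "0 \<le> t1" "t1 \<le> 1" "\<Lambda> t1 = a" and t2: "0 \<le> t2" "t2 \<le> 1" "\<Lambda> t2 = b"
      using ivt[of 0 1 a] ivt[of 0 1 b] ab \<Lambda>0 unfolding l_def by auto
    have t12: "t1 < t2" using \<Lambda>diff(2)[of t2 t1] t1 t2 ab by fastforce
    define h where "h t = t1 + t * (t2 - t1)" for t
    have h01: "h t \<in> {t1..t2}" if "t \<in> {0..1}" for t
    proof -
      have "0 \<le> t * (t2 - t1)" "t * (t2 - t1) \<le> t2 - t1"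
        using mult_left_le_one_le[of "t2 - t1" t] that t12 by auto
      then show ?thesis unfolding h_def atLeastAtMost_iff by linarith
    qed
    define \<gamma>' where "\<gamma>' t = \<gamma> (h t)" for t
    have len: "curve_length \<gamma>' 0 t = ennreal (\<Lambda> (h t) - a)" if "t \<in> {0..1}" for t
      unfolding \<gamma>'_def h_def using curve_length_affine[of "t2 - t1" \<gamma> t1 0 t] t12 \<Lambda>diff(1)[of t1
          "h t"] t1 t2 h01[OF that]
      by (simp add: h_def)
    have len1: "curve_length \<gamma>' 0 1 = ennreal (b - a)" using len[of 1] t2 by (simp add: h_def)
    have "path \<gamma>'" unfolding path_def \<gamma>'_def
      by (rule continuous_on_compose2[OF cont]) (use h01 t1 t2 in \<open>fastforce simp: h_def intro!:
          continuous_intros\<close>)+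
    then have rect: "rectifiable_curve \<gamma>'" unfolding rectifiable_curve_def len1 using ab by simp
    have arc: "arclength_param \<gamma>' s = \<sigma> (a + s)" if s: "s \<in> {0..b - a}" for s
    proof -
      obtain t' where t': "t1 \<le> t'" "t' \<le> t2" "\<Lambda> t' = a + s"
        using ivt[of t1 t2 "a + s"] t1 t2 t12 s by auto
      define t where "t = (t' - t1) / (t2 - t1)"
      have ht: "h t = t'" "t \<in> {0..1}" using t12 t' unfolding t_def h_def by auto
      then have "\<exists>t. t \<in> {0..1} \<and> curve_length \<gamma>' 0 t = ennreal s" using len[of t] t' by auto
      from someI_ex[OF this] obtain u where u: "u \<in> {0..1}" "curve_length \<gamma>' 0 u = ennreal s"
        "arclength_param \<gamma>' s = \<gamma>' u" unfolding arclength_param_def by blast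
      have "\<Lambda> (h u) \<ge> a" using \<Lambda>diff(2)[of t1 "h u"] h01[OF u(1)] t1 t2 by auto
      then have "\<Lambda> (h u) = a + s" using u len[of u] s by simp
      then have "\<gamma> (h u) = \<sigma>0 (a + s)" using \<sigma>0[of "h u"] h01[OF u(1)] t1 t2 by auto
      then show ?thesis using u \<sigma>eq[of "a + s"] s ab by (simp add: \<gamma>'_def)
    qed
    show "\<exists>\<gamma>'. rectifiable_curve \<gamma>' \<and> pathstart \<gamma>' = \<sigma> a \<and> pathfinish \<gamma>' = \<sigma> b \<and>
           (\<forall>h\<in>borel_measurable borel. line_integral h \<gamma>' = (\<integral>\<^sup>+s\<in>{a..b}. h (\<sigma> s) \<partial>lborel))"
    proof (intro exI[of _ \<gamma>'] conjI ballI)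
      show "rectifiable_curve \<gamma>'" by fact
      show "pathstart \<gamma>' = \<sigma> a" "pathfinish \<gamma>' = \<sigma> b"
        using \<sigma>0[of t1] \<sigma>0[of t2] t1 t2 \<sigma>eq[of a] \<sigma>eq[of b] ab
        by (auto simp: pathstart_def pathfinish_def \<gamma>'_def h_def)
      fix f :: "'a \<Rightarrow> ennreal" assume [measurable]: "f \<in> borel_measurable borel"
      have "line_integral f \<gamma>' = (\<integral>\<^sup>+s\<in>{0..b - a}. f (\<sigma> (a + s)) \<partial>lborel)"
        unfolding line_integral_def len1 using ab
        by (intro nn_integral_cong) (auto simp: arc indicator_def)
      also have "\<dots> = (\<integral>\<^sup>+s. f (\<sigma> (a + 1 * s)) * indicator {a..b} (a + 1 * s) \<partial>lborel)"
        by (intro nn_integral_cong) (auto simp: indicator_def)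
      also have "\<dots> = (\<integral>\<^sup>+s\<in>{a..b}. f (\<sigma> s) \<partial>lborel)"
        by (subst nn_integral_real_affine[where c = 1 and t = a]) auto
      finally show "line_integral f \<gamma>' = (\<integral>\<^sup>+s\<in>{a..b}. f (\<sigma> s) \<partial>lborel)" .
    qed
  qed
qed

section \<open>Calculus of upper gradients\<close>

lemma upper_gradient_real:
  "upper_gradient (\<lambda>x. ereal (f x)) g \<longleftrightarrow> g \<in> borel_measurable borel \<and>
    (\<forall>\<gamma>. rectifiable_curve \<gamma> \<longrightarrow>
      ennreal \<bar>f (pathfinish \<gamma>) - f (pathstart \<gamma>)\<bar> \<le> line_integral g \<gamma>)"
  by (simp add: upper_gradient_def)

lemma lipschitz_param_measurable:
  fixes \<sigma> :: "real \<Rightarrow> 'a::metric_space"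
  assumes "\<And>s t. dist (\<sigma> s) (\<sigma> t) \<le> \<bar>s - t\<bar>"
  shows "\<sigma> \<in> borel_measurable borel"
proof (rule borel_measurable_continuous_onI)
  show "continuous_on UNIV \<sigma>"
    unfolding continuous_on_iff using assms by (metis dist_commute dist_real_def le_less_trans)
qed

lemma upper_gradient_lipschitz_compose:
  assumes ug: "upper_gradient (\<lambda>x. ereal (f x)) g" and c: "c \<ge> 0"
    and lip: "\<And>x y. \<bar>\<psi> (f x) - \<psi> (f y)\<bar> \<le> c * \<bar>f x - f y\<bar>"
  shows "upper_gradient (\<lambda>x. ereal (\<psi> (f x))) (\<lambda>x. ennreal c * g x)"
  unfolding upper_gradient_real
proof (intro conjI allI impI)
  have [measurable]: "g \<in> borel_measurable borel" using ug by (simp add: upper_gradient_real)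
  show "(\<lambda>x. ennreal c * g x) \<in> borel_measurable borel" by measurable
  fix \<gamma> :: "real \<Rightarrow> 'a" assume rect: "rectifiable_curve \<gamma>"
  obtain l \<sigma> where "l > 0" and lip\<sigma>: "\<And>s t. dist (\<sigma> s) (\<sigma> t) \<le> \<bar>s - t\<bar>"
    and int: "\<And>h. line_integral h \<gamma> = (\<integral>\<^sup>+s\<in>{0..l}. h (\<sigma> s) \<partial>lborel)"
    using arclength_parametrization[OF rect] by metis
  have [measurable]: "\<sigma> \<in> borel_measurable borel" by (rule lipschitz_param_measurable[OF lip\<sigma>])
  have "ennreal \<bar>\<psi> (f (pathfinish \<gamma>)) - \<psi> (f (pathstart \<gamma>))\<bar>
      \<le> ennreal (c * \<bar>f (pathfinish \<gamma>) - f (pathstart \<gamma>)\<bar>)"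
    by (rule ennreal_leI[OF lip])
  also have "\<dots> \<le> ennreal c * line_integral g \<gamma>"
    unfolding ennreal_mult[OF c abs_ge_zero]
    by (rule mult_left_mono) (use ug rect in \<open>auto simp: upper_gradient_real\<close>)
  also have "\<dots> = line_integral (\<lambda>x. ennreal c * g x) \<gamma>"
    unfolding int by (subst nn_integral_cmult[symmetric]) (auto simp: mult.assoc)
  finally show "ennreal \<bar>\<psi> (f (pathfinish \<gamma>)) - \<psi> (f (pathstart \<gamma>))\<bar>
      \<le> line_integral (\<lambda>x. ennreal c * g x) \<gamma>" .
qed

lemma nn_integral_interval_split:
  fixes h :: "real \<Rightarrow> ennreal"
  assumes [measurable]: "h \<in> borel_measurable borel" and "a \<le> b" "b \<le> c"
  shows "(\<integral>\<^sup>+s\<in>{a..c}. h s \<partial>lborel) = (\<integral>\<^sup>+s\<in>{a..b}. h s \<partial>lborel) + (\<integral>\<^sup>+s\<in>{b..c}. h s \<partial>lborel)"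
proof -
  have "AE s in lborel. h s * indicator {a..c} s = h s * indicator {a..b} s + h s * indicator {b..c} s"
    using AE_lborel_singleton[of b] by eventually_elim (use assms in \<open>auto simp: indicator_def\<close>)
  then have "(\<integral>\<^sup>+s\<in>{a..c}. h s \<partial>lborel) = (\<integral>\<^sup>+s. h s * indicator {a..b} s + h s
      * indicator {b..c} s \<partial>lborel)"
    by (rule nn_integral_cong_AE)
  also have "\<dots> = (\<integral>\<^sup>+s\<in>{a..b}. h s \<partial>lborel) + (\<integral>\<^sup>+s\<in>{b..c}. h s \<partial>lborel)"
    by (rule nn_integral_add) auto
  finally show ?thesis .
qed

lemma le_nn_integral_interval:
  fixes h :: "real \<Rightarrow> ennreal"
  assumes ab: "a < b" and "c \<ge> 0" and le: "\<And>s. s \<in> {a..b} \<Longrightarrow> ennreal c \<le> ennreal (b - a) * h s"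
  shows "ennreal c \<le> (\<integral>\<^sup>+s\<in>{a..b}. h s \<partial>lborel)"
proof -
  have "ennreal c = ennreal (c / (b - a)) * ennreal (b - a)"
    using ab \<open>c \<ge> 0\<close> by (simp flip: ennreal_mult)
  also have "\<dots> = (\<integral>\<^sup>+s\<in>{a..b}. ennreal (c / (b - a)) \<partial>lborel)"
    using ab by (simp add: nn_integral_cmult_indicator)
  also have "\<dots> \<le> (\<integral>\<^sup>+s\<in>{a..b}. h s \<partial>lborel)"
  proof (rule nn_integral_mono)
    fix s
    show "ennreal (c / (b - a)) * indicator {a..b} s \<le> h s * indicator {a..b} s"
    proof (cases "s \<in> {a..b}")
      case True
      have "ennreal (c / (b - a)) \<le> h s"
      proof (cases "h s")
        case (real r)
        then have "c \<le> (b - a) * r"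
          using le[OF True] ab by (simp add: ennreal_le_iff flip: ennreal_mult)
        then show ?thesis using real ab by (simp add: divide_le_eq mult.commute)
      qed auto
      then show ?thesis using True by simp
    qed auto
  qed
  finally show ?thesis .
qed

text \<open>
  The product rule. The function \<open>K\<close> bounds \<open>\<phi>\<close> and \<open>k\<close> its slope, uniformly on balls of radius \<open>r0\<close>;
  this slack lets both be evaluated at any point of a short piece of the curve. The values of \<open>f\<close>
  along the curve need not be measurable, hence the Borel majorant \<open>U\<close>. On a short piece, \<open>f\<close> varies
  by at most the integral \<open>P\<close> of \<open>g\<close>, and replacing \<open>f\<close> at an endpoint by its value at a running point
  costs \<open>k P\<close> times the length of the piece; for pieces of length at most \<open>\<kappa> / kmax\<close> this is
  absorbed in a second copy of \<open>K g\<close>, which is where the factor \<open>2\<close> comes from. Pieces on which \<open>\<phi>\<close>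
  vanishes at both ends are trivial, and on the others \<open>K \<ge> \<kappa>\<close>.
\<close>

lemma upper_gradient_mult:
  fixes f \<phi> K k :: "'a::metric_space \<Rightarrow> real"
  assumes ug: "upper_gradient (\<lambda>x. ereal (f x)) g"
    and U: "U \<in> borel_measurable borel" "\<And>x. ennreal (f x) \<le> U x" and f0: "\<And>x. 0 \<le> f x"
    and Kk: "K \<in> borel_measurable borel" "k \<in> borel_measurable borel"
    and kmax: "\<And>x. 0 \<le> k x" "\<And>x. k x \<le> kmax" and pos: "r0 > 0" "\<kappa> > 0"
    and loc: "\<And>x y z. \<lbrakk>dist x y \<le> r0; dist x z \<le> r0; dist y z \<le> r0\<rbrakk> \<Longrightarrow>
      \<bar>\<phi> x\<bar> \<le> K z \<and> \<bar>\<phi> x - \<phi> y\<bar> \<le> k z * dist x y \<and> (\<phi> x \<noteq> 0 \<longrightarrow> \<kappa> \<le> K z)"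
  shows "upper_gradient (\<lambda>x. ereal (f x * \<phi> x)) (\<lambda>x. ennreal (2 * K x) * g x + ennreal (k x) * U x)"
  unfolding upper_gradient_real
proof (intro conjI allI impI)
  have gm: "g \<in> borel_measurable borel" using ug by (simp add: upper_gradient_real)
  note [measurable] = gm U(1) Kk
  let ?h = "\<lambda>x. ennreal (2 * K x) * g x + ennreal (k x) * U x"
  show hm[measurable]: "?h \<in> borel_measurable borel" by measurable
  have K0: "0 \<le> K x" for x using loc[of x x x] pos by force
  fix \<gamma> :: "real \<Rightarrow> 'a" assume rect: "rectifiable_curve \<gamma>"
  obtain l \<sigma> where l: "l > 0" and lip\<sigma>: "\<And>s t. dist (\<sigma> s) (\<sigma> t) \<le> \<bar>s - t\<bar>"
    and ends: "\<sigma> 0 = pathstart \<gamma>" "\<sigma> l = pathfinish \<gamma>"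
    and int: "\<And>h. line_integral h \<gamma> = (\<integral>\<^sup>+s\<in>{0..l}. h (\<sigma> s) \<partial>lborel)"
    and sub: "\<And>a b. \<lbrakk>0 \<le> a; a < b; b \<le> l\<rbrakk> \<Longrightarrow>
      \<exists>\<gamma>'. rectifiable_curve \<gamma>' \<and> pathstart \<gamma>' = \<sigma> a \<and> pathfinish \<gamma>' = \<sigma> b \<and>
           (\<forall>h\<in>borel_measurable borel. line_integral h \<gamma>' = (\<integral>\<^sup>+s\<in>{a..b}. h (\<sigma> s) \<partial>lborel))"
    by (rule arclength_parametrization[OF rect]) blast
  have [measurable]: "\<sigma> \<in> borel_measurable borel" by (rule lipschitz_param_measurable[OF lip\<sigma>])
  have fsub: "ennreal \<bar>f (\<sigma> b) - f (\<sigma> a)\<bar> \<le> (\<integral>\<^sup>+s\<in>{a..b}. g (\<sigma> s) \<partial>lborel)"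
    if ab: "0 \<le> a" "a \<le> b" "b \<le> l" for a b
  proof (cases "a = b")
    case False
    then obtain \<gamma>' where c: "rectifiable_curve \<gamma>'" "pathstart \<gamma>' = \<sigma> a" "pathfinish \<gamma>' = \<sigma> b"
      "line_integral g \<gamma>' = (\<integral>\<^sup>+s\<in>{a..b}. g (\<sigma> s) \<partial>lborel)"
      using sub[of a b] ab gm by auto
    have "ennreal \<bar>f (pathfinish \<gamma>') - f (pathstart \<gamma>')\<bar> \<le> line_integral g \<gamma>'"
      using ug c(1) unfolding upper_gradient_real by blast
    then show ?thesis unfolding c(2-4) .
  qed auto
  have piece: "ennreal \<bar>f (\<sigma> b) * \<phi> (\<sigma> b) - f (\<sigma> a) * \<phi> (\<sigma> a)\<bar> \<le> (\<integral>\<^sup>+s\<in>{a..b}. ?h (\<sigma> s) \<partial>lborel)"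
    if ab: "0 \<le> a" "a < b" "b \<le> l" "b - a \<le> r0" "kmax * (b - a) \<le> \<kappa>" for a b
  proof (cases "\<phi> (\<sigma> a) = 0 \<and> \<phi> (\<sigma> b) = 0")
    case False
    define P where "P = (\<integral>\<^sup>+s\<in>{a..b}. g (\<sigma> s) \<partial>lborel)"
    define Q where "Q = (\<integral>\<^sup>+s\<in>{a..b}. ennreal (K (\<sigma> s)) * g (\<sigma> s) \<partial>lborel)"
    define R where "R = (\<integral>\<^sup>+s\<in>{a..b}. ennreal (k (\<sigma> s)) * U (\<sigma> s) \<partial>lborel)"
    have near: "dist (\<sigma> s) (\<sigma> t) \<le> r0" if "s \<in> {a..b}" "t \<in> {a..b}" for s t
      by (rule order_trans[OF lip\<sigma>]) (use that ab in auto)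
    have \<phi>a: "\<bar>\<phi> (\<sigma> a)\<bar> \<le> K (\<sigma> s)" and \<kappa>K: "\<kappa> \<le> K (\<sigma> s)"
      and \<phi>ab: "\<bar>\<phi> (\<sigma> b) - \<phi> (\<sigma> a)\<bar> \<le> (b - a) * k (\<sigma> s)" if s: "s \<in> {a..b}" for s
    proof -
      have mem: "a \<in> {a..b}" "b \<in> {a..b}" using ab by auto
      note 1 = loc[OF near[OF mem] near[OF mem(1) s] near[OF mem(2) s]]
        and 2 = loc[OF near[OF mem(2,1)] near[OF mem(2) s] near[OF mem(1) s]]
      show "\<bar>\<phi> (\<sigma> a)\<bar> \<le> K (\<sigma> s)" "\<kappa> \<le> K (\<sigma> s)" using 1 2 False by blast+
      have "k (\<sigma> s) * dist (\<sigma> b) (\<sigma> a) \<le> k (\<sigma> s) * (b - a)"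
        using lip\<sigma>[of b a] ab kmax(1) by (intro mult_left_mono) auto
      then show "\<bar>\<phi> (\<sigma> b) - \<phi> (\<sigma> a)\<bar> \<le> (b - a) * k (\<sigma> s)" using 2 unfolding mult.commute[of "b - a"]
          by linarith
    qed
    have total: "(\<integral>\<^sup>+s\<in>{a..b}. ?h (\<sigma> s) \<partial>lborel) = 2 * Q + R"
    proof -
      have "(\<integral>\<^sup>+s\<in>{a..b}. ?h (\<sigma> s) \<partial>lborel)
          = (\<integral>\<^sup>+s. 2 * (ennreal (K (\<sigma> s)) * g (\<sigma> s) * indicator {a..b} s)
                + ennreal (k (\<sigma> s)) * U (\<sigma> s) * indicator {a..b} s \<partial>lborel)"
        using K0 by (intro nn_integral_cong) (auto simp: distrib_right ennreal_mult mult.assoc)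
      also have "\<dots> = 2 * Q + R" unfolding Q_def R_def
        by (subst nn_integral_add) (auto simp: nn_integral_cmult)
      finally show ?thesis .
    qed
    have \<kappa>P: "ennreal \<kappa> * P \<le> Q" unfolding P_def Q_def
      by (subst nn_integral_cmult[symmetric])
        (auto intro!: nn_integral_mono mult_right_mono ennreal_leI \<kappa>K simp: indicator_def)
    show ?thesis
    proof (cases "P = \<infinity>")
      case True
      then have "Q = \<infinity>" using \<kappa>P pos by (simp add: ennreal_mult_eq_top_iff top_unique)
      then show ?thesis unfolding total by simp
    next
      case Pfin: False
      define q where "q = enn2real P"
      have q: "P = ennreal q" "q \<ge> 0" using Pfin unfolding q_def by (auto simp: less_top)
      have fb: "f (\<sigma> b) \<le> f (\<sigma> s) + q" if s: "s \<in> {a..b}" for s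
      proof -
        have "ennreal \<bar>f (\<sigma> b) - f (\<sigma> s)\<bar> \<le> (\<integral>\<^sup>+s\<in>{s..b}. g (\<sigma> s) \<partial>lborel)"
          using fsub[of s b] s ab by auto
        also have "\<dots> \<le> P" unfolding P_def using s by (intro nn_integral_mono) (auto simp: indicator_def)
        finally show ?thesis using q by (simp add: ennreal_le_iff)
      qed
      have "\<bar>f (\<sigma> b) - f (\<sigma> a)\<bar> \<le> q" using fsub[of a b] ab q unfolding P_def[symmetric]
        by (simp add: ennreal_le_iff)
      then have "ennreal \<bar>\<phi> (\<sigma> a) * (f (\<sigma> b) - f (\<sigma> a))\<bar> \<le> ennreal \<bar>\<phi> (\<sigma> a)\<bar> * P"
        unfolding q(1) by (simp add: abs_mult mult_left_mono flip: ennreal_mult)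
      also have "\<dots> \<le> Q" unfolding P_def Q_def
        by (subst nn_integral_cmult[symmetric])
          (auto intro!: nn_integral_mono mult_right_mono ennreal_leI \<phi>a simp: indicator_def)
      finally have first: "ennreal \<bar>\<phi> (\<sigma> a) * (f (\<sigma> b) - f (\<sigma> a))\<bar> \<le> Q" .
      have "ennreal \<bar>f (\<sigma> b) * (\<phi> (\<sigma> b) - \<phi> (\<sigma> a))\<bar>
          \<le> (\<integral>\<^sup>+s\<in>{a..b}. (ennreal (k (\<sigma> s)) * U (\<sigma> s) + ennreal (kmax * q)) \<partial>lborel)"
      proof (rule le_nn_integral_interval)
        fix s assume s: "s \<in> {a..b}"
        have "\<bar>f (\<sigma> b) * (\<phi> (\<sigma> b) - \<phi> (\<sigma> a))\<bar> \<le> f (\<sigma> b) * ((b - a) * k (\<sigma> s))"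
          using \<phi>ab[OF s] f0[of "\<sigma> b"] by (simp add: abs_mult mult_left_mono)
        also have "\<dots> \<le> (f (\<sigma> s) + q) * ((b - a) * k (\<sigma> s))"
          using fb[OF s] kmax(1)[of "\<sigma> s"] ab by (intro mult_right_mono) auto
        also have "\<dots> = (b - a) * (k (\<sigma> s) * f (\<sigma> s) + k (\<sigma> s) * q)" by (simp add: algebra_simps)
        also have "\<dots> \<le> (b - a) * (k (\<sigma> s) * f (\<sigma> s) + kmax * q)"
          using kmax[of "\<sigma> s"] q ab by (intro mult_left_mono add_left_mono mult_right_mono) auto
        finally have "ennreal \<bar>f (\<sigma> b) * (\<phi> (\<sigma> b) - \<phi> (\<sigma> a))\<bar>
            \<le> ennreal ((b - a) * (k (\<sigma> s) * f (\<sigma> s) + kmax * q))" by (rule ennreal_leI)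
        also have "\<dots> = ennreal (b - a) * (ennreal (k (\<sigma> s)) * ennreal (f (\<sigma> s)) + ennreal (kmax * q))"
          using ab kmax(1)[of "\<sigma> s"] kmax(2)[of "\<sigma> s"] f0[of "\<sigma> s"] q by (simp add: ennreal_mult)
        also have "\<dots> \<le> ennreal (b - a) * (ennreal (k (\<sigma> s)) * U (\<sigma> s) + ennreal (kmax * q))"
          by (intro mult_left_mono add_right_mono U) auto
        finally show "ennreal \<bar>f (\<sigma> b) * (\<phi> (\<sigma> b) - \<phi> (\<sigma> a))\<bar>
          \<le> ennreal (b - a) * (ennreal (k (\<sigma> s)) * U (\<sigma> s) + ennreal (kmax * q))" .
      qed (use ab in auto)
      also have "\<dots> = (\<integral>\<^sup>+s. ennreal (k (\<sigma> s)) * U (\<sigma> s) * indicator {a..b} s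
          + ennreal (kmax * q) * indicator {a..b} s \<partial>lborel)"
        by (simp add: distrib_right)
      also have "\<dots> = R + ennreal (kmax * q) * ennreal (b - a)" unfolding R_def using ab
        by (subst nn_integral_add) (auto simp: nn_integral_cmult_indicator)
      also have "ennreal (kmax * q) * ennreal (b - a) \<le> ennreal \<kappa> * P"
      proof -
        have "kmax * q * (b - a) \<le> \<kappa> * q" using ab q mult_right_mono[of "kmax * (b - a)" \<kappa> q]
            by (simp add: mult_ac)
        moreover have "0 \<le> kmax" using kmax order_trans by blast
        ultimately show ?thesis unfolding q using q ab pos by (simp flip: ennreal_mult)
      qed
      also note \<kappa>P
      finally have second: "ennreal \<bar>f (\<sigma> b) * (\<phi> (\<sigma> b) - \<phi> (\<sigma> a))\<bar> \<le> R + Q" by (simp add: add_left_mono)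
      have "f (\<sigma> b) * \<phi> (\<sigma> b) - f (\<sigma> a) * \<phi> (\<sigma> a)
          = \<phi> (\<sigma> a) * (f (\<sigma> b) - f (\<sigma> a)) + f (\<sigma> b) * (\<phi> (\<sigma> b) - \<phi> (\<sigma> a))"
        by (simp add: algebra_simps)
      then have "ennreal \<bar>f (\<sigma> b) * \<phi> (\<sigma> b) - f (\<sigma> a) * \<phi> (\<sigma> a)\<bar>
          \<le> ennreal \<bar>\<phi> (\<sigma> a) * (f (\<sigma> b) - f (\<sigma> a))\<bar> + ennreal \<bar>f (\<sigma> b) * (\<phi> (\<sigma> b) - \<phi> (\<sigma> a))\<bar>"
        by (simp flip: ennreal_plus)
      also have "\<dots> \<le> Q + (R + Q)" by (intro add_mono first second)
      finally show ?thesis unfolding total by (simp add: mult_2 add_ac)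
    qed
  qed auto
  \<comment> \<open>Pieces shorter than both \<open>r0\<close> and \<open>\<kappa> / kmax\<close>.\<close>
  obtain N :: nat where N: "N > 0" "l / r0 \<le> real N" "kmax * l / \<kappa> \<le> real N"
  proof
    define N where "N = nat \<lceil>max (l / r0) (kmax * l / \<kappa>)\<rceil> + 1"
    have "max (l / r0) (kmax * l / \<kappa>) \<le> real N" unfolding N_def by linarith
    then show "l / r0 \<le> real N" "kmax * l / \<kappa> \<le> real N" by auto
    show "N > 0" by (simp add: N_def)
  qed
  define \<delta> where "\<delta> = l / real N"
  have \<delta>: "\<delta> > 0" "\<delta> \<le> r0" "kmax * \<delta> \<le> \<kappa>" "real N * \<delta> = l"
    using N l pos unfolding \<delta>_def by (auto simp: field_simps)
  have "ennreal \<bar>f (\<sigma> (real n * \<delta>)) * \<phi> (\<sigma> (real n * \<delta>)) - f (\<sigma> 0) * \<phi> (\<sigma> 0)\<bar>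
      \<le> (\<integral>\<^sup>+s\<in>{0..real n * \<delta>}. ?h (\<sigma> s) \<partial>lborel)" if "n \<le> N" for n
    using that
  proof (induction n)
    case (Suc n)
    define a where "a = real n * \<delta>"
    define b where "b = real (Suc n) * \<delta>"
    have ba: "b = a + \<delta>" by (simp add: a_def b_def algebra_simps)
    have "b \<le> real N * \<delta>" unfolding b_def using Suc.prems \<delta> by (intro mult_right_mono) auto
    then have "b \<le> l" using \<delta> by simp
    have "0 \<le> a" using \<delta> by (simp add: a_def)
    have "ennreal \<bar>f (\<sigma> b) * \<phi> (\<sigma> b) - f (\<sigma> 0) * \<phi> (\<sigma> 0)\<bar>
       \<le> ennreal \<bar>f (\<sigma> a) * \<phi> (\<sigma> a) - f (\<sigma> 0) * \<phi> (\<sigma> 0)\<bar> + ennreal \<bar>f (\<sigma> b) * \<phi> (\<sigma> b) - f (\<sigma> a) * \<phi> (\<sigma> a)\<bar>"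
      by (simp flip: ennreal_plus)
    also have "\<dots> \<le> (\<integral>\<^sup>+s\<in>{0..a}. ?h (\<sigma> s) \<partial>lborel) + (\<integral>\<^sup>+s\<in>{a..b}. ?h (\<sigma> s) \<partial>lborel)"
    proof (rule add_mono)
      show "ennreal \<bar>f (\<sigma> a) * \<phi> (\<sigma> a) - f (\<sigma> 0) * \<phi> (\<sigma> 0)\<bar> \<le> (\<integral>\<^sup>+s\<in>{0..a}. ?h (\<sigma> s) \<partial>lborel)"
        using Suc.IH Suc.prems by (simp add: a_def)
    qed (rule piece, use \<open>b \<le> l\<close> \<open>0 \<le> a\<close> \<delta> ba in auto)
    also have "\<dots> = (\<integral>\<^sup>+s\<in>{0..b}. ?h (\<sigma> s) \<partial>lborel)"
      by (rule nn_integral_interval_split[symmetric]) (use \<open>0 \<le> a\<close> ba \<delta> in auto)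
    finally show ?case unfolding b_def .
  qed auto
  from this[of N] show "ennreal \<bar>f (pathfinish \<gamma>) * \<phi> (pathfinish \<gamma>) - f (pathstart \<gamma>) * \<phi> (pathstart \<gamma>)\<bar>
      \<le> line_integral ?h \<gamma>"
    unfolding int \<delta>(4) using ends by simp
qed

definition cutoff :: "'a::metric_space \<Rightarrow> real \<Rightarrow> 'a \<Rightarrow> real" where
  "cutoff x \<rho> y = max 0 (min 1 (2 - dist x y / \<rho>))"

lemma cutoff_bounds [simp]: "0 \<le> cutoff x \<rho> y" "cutoff x \<rho> y \<le> 1"
  by (auto simp: cutoff_def)

lemma cutoff_eq_1: "\<lbrakk>\<rho> > 0; y \<in> ball x \<rho>\<rbrakk> \<Longrightarrow> cutoff x \<rho> y = 1"
  by (auto simp: cutoff_def field_simps max_def min_def)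

lemma cutoff_eq_0: "\<lbrakk>\<rho> > 0; y \<notin> ball x (2 * \<rho>)\<rbrakk> \<Longrightarrow> cutoff x \<rho> y = 0"
  by (auto simp: cutoff_def field_simps max_def min_def)

lemma cutoff_lipschitz:
  assumes "\<rho> > 0"
  shows "\<bar>cutoff x \<rho> y - cutoff x \<rho> z\<bar> \<le> 1 / \<rho> * dist y z"
proof -
  have "\<bar>dist x y - dist x z\<bar> \<le> dist y z"
    by (metis abs_dist_diff_le dist_commute)
  then have "\<bar>dist x y / \<rho> - dist x z / \<rho>\<bar> \<le> dist y z / \<rho>"
    using assms by (simp add: abs_divide divide_right_mono flip: diff_divide_distrib)
  then show ?thesis unfolding cutoff_def by (auto simp: max_def min_def)
qed

lemma continuous_on_cutoff [continuous_intros]: "\<rho> > 0 \<Longrightarrow> continuous_on A (cutoff x \<rho>)"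
  unfolding cutoff_def by (intro continuous_intros) auto

text \<open>
  The gradient is supported in the ball of radius \<open>3 \<rho>\<close> instead of the support of the cutoff, so that a
  short piece of a curve that meets the support stays inside.
\<close>

lemma upper_gradient_mult_cutoff:
  fixes f :: "'a::metric_space \<Rightarrow> real"
  assumes "upper_gradient (\<lambda>x. ereal (f x)) g"
    and "U \<in> borel_measurable borel" "\<And>x. ennreal (f x) \<le> U x" and "\<And>x. 0 \<le> f x"
    and \<rho>: "\<rho> > 0"
  shows "upper_gradient (\<lambda>y. ereal (f y * cutoff x \<rho> y))
    (\<lambda>y. ennreal (2 * indicator (ball x (3 * \<rho>)) y) * g y
          + ennreal (indicator (ball x (3 * \<rho>)) y / \<rho>) * U y)"
proof (rule upper_gradient_mult[where \<kappa> = 1 and kmax = "1 / \<rho>" and ?r0.0 = "\<rho> / 2"])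
  have [measurable]: "ball x (3 * \<rho>) \<in> sets borel" by simp
  show "indicator (ball x (3 * \<rho>)) \<in> borel_measurable borel"
    "(\<lambda>y. indicator (ball x (3 * \<rho>)) y / \<rho>) \<in> borel_measurable borel" by measurable
  show "0 \<le> indicator (ball x (3 * \<rho>)) y / \<rho>" "indicator (ball x (3 * \<rho>)) y / \<rho> \<le> 1 / \<rho>" for y
    using \<rho> by (auto simp: indicator_def)
  fix y z w :: 'a assume d: "dist y z \<le> \<rho> / 2" "dist y w \<le> \<rho> / 2" "dist z w \<le> \<rho> / 2"
  have in3: "w \<in> ball x (3 * \<rho>)" if "v \<in> ball x (2 * \<rho>)" "dist v w \<le> \<rho> / 2" for v
    using that dist_triangle[of x w v] \<rho> by auto
  have ne: "w \<in> ball x (3 * \<rho>)" if "cutoff x \<rho> y \<noteq> 0 \<or> cutoff x \<rho> z \<noteq> 0"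
    using that in3[of y] in3[of z] d cutoff_eq_0[OF \<rho>] by blast
  show "\<bar>cutoff x \<rho> y\<bar> \<le> indicator (ball x (3 * \<rho>)) w \<and>
      \<bar>cutoff x \<rho> y - cutoff x \<rho> z\<bar> \<le> indicator (ball x (3 * \<rho>)) w / \<rho> * dist y z \<and>
      (cutoff x \<rho> y \<noteq> 0 \<longrightarrow> (1::real) \<le> indicator (ball x (3 * \<rho>)) w)"
  proof (cases "cutoff x \<rho> y \<noteq> 0 \<or> cutoff x \<rho> z \<noteq> 0")
    case True
    then show ?thesis using ne cutoff_lipschitz[OF \<rho>, of x y z] by auto
  qed (use \<rho> in auto)
qed (use assms in auto)

lemma powr_diff_bound:
  fixes s t b a :: real
  assumes a: "0 < a" "a \<le> 1" and "b > 0" "b \<le> s" "b \<le> t"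
  shows "\<bar>s powr a - t powr a\<bar> \<le> a * b powr (a - 1) * \<bar>s - t\<bar>"
proof -
  have *: "t powr a - s powr a \<le> a * b powr (a - 1) * (t - s)" if st: "b \<le> s" "s < t" for s t
  proof -
    have "\<exists>z. s < z \<and> z < t \<and> t powr a - s powr a = (t - s) * (a * z powr (a - 1))"
      by (rule MVT2[OF st(2)]) (use st \<open>b > 0\<close> in \<open>auto intro!: derivative_eq_intros\<close>)
    then obtain z where z: "s < z" "t powr a - s powr a = (t - s) * (a * z powr (a - 1))" by auto
    have "z powr (a - 1) \<le> b powr (a - 1)" using z st \<open>b > 0\<close> a by (intro powr_mono2') auto
    then have "(t - s) * (a * z powr (a - 1)) \<le> (t - s) * (a * b powr (a - 1))"
      using st a by (intro mult_left_mono) auto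
    then show ?thesis using z by (simp add: mult_ac)
  qed
  have mono: "s powr a \<le> t powr a" if "b \<le> s" "s \<le> t" for s t
    using that \<open>b > 0\<close> a by (intro powr_mono2) auto
  show ?thesis
    using *[of s t] *[of t s] mono[of s t] mono[of t s] assms
    by (cases s t rule: linorder_cases) auto
qed

text \<open>
  The weight is constant where the distance to \<open>S\<close> is below \<open>2 \<delta>\<close>. As above, its slope is allowed to
  live on the slightly larger set where the distance exceeds \<open>\<delta>\<close>.
\<close>

lemma upper_gradient_mult_distance_powr:
  fixes f :: "'a::metric_space \<Rightarrow> real" and S :: "'a set"
  assumes "upper_gradient (\<lambda>x. ereal (f x)) g"
    and "U \<in> borel_measurable borel" "\<And>x. ennreal (f x) \<le> U x" and "\<And>x. 0 \<le> f x"
    and \<delta>: "\<delta> > 0" and a: "0 < a" "a \<le> 1"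
  defines "m \<equiv> \<lambda>x. max (infdist x S) (2 * \<delta>)"
  shows "upper_gradient (\<lambda>x. ereal (f x * m x powr a))
    (\<lambda>x. ennreal (2 * (2 * m x powr a)) * g x
          + ennreal (2 * a * m x powr (a - 1) * indicator {x. \<delta> < infdist x S} x) * U x)"
proof (rule upper_gradient_mult[where \<kappa> = "2 * (2 * \<delta>) powr a" and kmax = "2 * a * (2 * \<delta>) powr (a - 1)"
      and ?r0.0 = "\<delta> / 2"])
  have [measurable]: "(\<lambda>x. infdist x S) \<in> borel_measurable borel"
    by (intro borel_measurable_continuous_onI continuous_intros)
  have [measurable]: "m \<in> borel_measurable borel" unfolding m_def by measurable
  have [measurable]: "{x. \<delta> < infdist x S} \<in> sets borel" by measurable
  show "(\<lambda>x. 2 * m x powr a) \<in> borel_measurable borel"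
    "(\<lambda>x. 2 * a * m x powr (a - 1) * indicator {x. \<delta> < infdist x S} x) \<in> borel_measurable borel"
    by measurable
  have m\<delta>: "2 * \<delta> \<le> m x" for x by (simp add: m_def)
  show "0 \<le> 2 * a * m x powr (a - 1) * indicator {x. \<delta> < infdist x S} x" for x
    using a by (simp add: indicator_def)
  have "m x powr (a - 1) \<le> (2 * \<delta>) powr (a - 1)" for x
    using m\<delta> \<delta> a by (intro powr_mono2') auto
  then show "2 * a * m x powr (a - 1) * indicator {x. \<delta> < infdist x S} x
      \<le> 2 * a * (2 * \<delta>) powr (a - 1)" for x
    using a by (auto simp: indicator_def)
  fix x y z :: 'a assume d: "dist x y \<le> \<delta> / 2" "dist x z \<le> \<delta> / 2" "dist y z \<le> \<delta> / 2"
  have mlip: "\<bar>m x - m y\<bar> \<le> dist x y" for x y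
    unfolding m_def using infdist_triangle_abs[of x S y] by (auto simp: max_def)
  have mx: "m x \<le> 2 * m z" "m z / 2 \<le> m x" "m z / 2 \<le> m y"
    using mlip[of x z] mlip[of y z] d m\<delta>[of z] by linarith+
  have two: "2 powr a \<le> (2::real)" using powr_mono[of a 1 2] a by simp
  have "m x powr a \<le> (2 * m z) powr a" using mx m\<delta>[of x] \<delta> a by (intro powr_mono2) auto
  also have "\<dots> \<le> 2 * m z powr a" using two m\<delta>[of z] \<delta> by (simp add: powr_mult mult_right_mono)
  finally have 1: "m x powr a \<le> 2 * m z powr a" .
  have 3: "2 * (2 * \<delta>) powr a \<le> 2 * m z powr a" using m\<delta>[of z] \<delta> a by (auto intro!: powr_mono2)
  have 2: "\<bar>m x powr a - m y powr a\<bar> \<le> 2 * a * m z powr (a - 1) * indicator {x. \<delta> < infdist x S} z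
      * dist x y"
  proof (cases "infdist x S < 2 * \<delta> \<and> infdist y S < 2 * \<delta>")
    case True
    then have "m x = m y" by (simp add: m_def)
    then show ?thesis using a by simp
  next
    case False
    then have z: "\<delta> < infdist z S"
      using infdist_triangle_abs[of x S z] infdist_triangle_abs[of y S z] d \<delta> by linarith
    have pos: "m z > 0" using m\<delta>[of z] \<delta> by linarith
    have "\<bar>m x powr a - m y powr a\<bar> \<le> a * (m z / 2) powr (a - 1) * \<bar>m x - m y\<bar>"
      using mx pos a by (intro powr_diff_bound) auto
    also have "\<dots> \<le> a * (m z / 2) powr (a - 1) * dist x y"
      using mlip a by (intro mult_left_mono) auto
    also have "(m z / 2) powr (a - 1) = m z powr (a - 1) * 2 powr (1 - a)"
      using pos by (simp add: powr_divide powr_diff field_simps)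
    also have "a * (m z powr (a - 1) * 2 powr (1 - a)) * dist x y \<le> a * (m z powr (a - 1) * 2) * dist x y"
      using powr_mono[of "1 - a" 1 "2::real"] a by (intro mult_right_mono mult_left_mono) auto
    finally show ?thesis using z by (simp add: mult_ac)
  qed
  show "\<bar>m x powr a\<bar> \<le> 2 * m z powr a \<and>
      \<bar>m x powr a - m y powr a\<bar> \<le> 2 * a * m z powr (a - 1) * indicator {x. \<delta> < infdist x S} z * dist x y \<and>
      (m x powr a \<noteq> 0 \<longrightarrow> 2 * (2 * \<delta>) powr a \<le> 2 * m z powr a)"
    using 1 2 3 by auto
qed (use assms in auto)

section \<open>Powers in the extended half-line\<close>

lemma ennreal_pow_ennreal: "t \<ge> 0 \<Longrightarrow> ennreal_pow (ennreal t) p = ennreal (t powr p)"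
  by (simp add: ennreal_pow_def)

lemma ennreal_pow_measurable [measurable]:
  assumes [measurable]: "h \<in> borel_measurable N"
  shows "(\<lambda>x. ennreal_pow (h x) p) \<in> borel_measurable N"
  unfolding ennreal_pow_def by measurable

lemma ennreal_pow_cmult:
  assumes "c \<ge> 0" "p > 0"
  shows "ennreal_pow (ennreal c * x) p = ennreal (c powr p) * ennreal_pow x p"
proof (cases "c = 0")
  case True
  then show ?thesis by (simp add: ennreal_pow_def)
next
  case False
  then show ?thesis using assms
    by (cases x) (auto simp: ennreal_pow_def powr_mult ennreal_mult_top ennreal_mult simp flip:
        ennreal_mult)
qed

lemma powr_add_le:
  fixes a b p :: real
  assumes "a \<ge> 0" "b \<ge> 0" "p \<ge> 0"
  shows "(a + b) powr p \<le> 2 powr p * (a powr p + b powr p)"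
proof -
  have "(a + b) powr p \<le> (2 * max a b) powr p" using assms by (intro powr_mono2) auto
  also have "\<dots> = 2 powr p * max a b powr p" using assms by (simp add: powr_mult)
  also have "max a b powr p \<le> a powr p + b powr p" by (simp add: max_def)
  finally show ?thesis by simp
qed

lemma ennreal_pow_add_le:
  assumes "p > 0"
  shows "ennreal_pow (x + y) p \<le> ennreal (2 powr p) * (ennreal_pow x p + ennreal_pow y p)"
proof (cases "x = \<infinity> \<or> y = \<infinity>")
  case True
  then show ?thesis by (auto simp: ennreal_pow_def ennreal_mult_top)
next
  case False
  then obtain a b where *: "x = ennreal a" "a \<ge> 0" "y = ennreal b" "b \<ge> 0"
    by (metis ennreal_cases infinity_ennreal_def)
  show ?thesis using powr_add_le[of a b p] * assms
    by (simp add: ennreal_pow_ennreal flip: ennreal_plus ennreal_mult)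
qed

text \<open>
  The estimates with a free parameter \<open>\<tau>\<close> linearize \<open>A\<^sup>1\<^sup>/\<^sup>p B\<^sup>1\<^sup>-\<^sup>1\<^sup>/\<^sup>p\<close> in the sense of Young. The choice
  \<open>\<tau> = t / (2 D)\<close> absorbs half of the left-hand side.
\<close>

lemma powr_absorb:
  fixes t m D G p :: real
  assumes "t \<ge> 0" "D > 0" "G \<ge> 0" and *: "\<And>\<tau>. \<tau> > 0 \<Longrightarrow> t * m \<le> D * (\<tau> * m + \<tau> powr (1 - p) * G)"
  shows "t powr p * m \<le> (2 * D) powr p * G"
proof (cases "t = 0")
  case False
  define \<tau> where "\<tau> = t / (2 * D)"
  have \<tau>: "\<tau> > 0" "t = 2 * D * \<tau>" using assms False by (auto simp: \<tau>_def)
  have "D * \<tau> * m \<le> D * (\<tau> powr (1 - p) * G)" using *[OF \<tau>(1)] \<tau>(2) by (simp add: algebra_simps)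
  then have "\<tau> * m \<le> \<tau> powr (1 - p) * G" using assms by simp
  then have "\<tau> powr (p - 1) * (\<tau> * m) \<le> \<tau> powr (p - 1) * (\<tau> powr (1 - p) * G)"
    by (intro mult_left_mono) auto
  also have "\<tau> powr (p - 1) * (\<tau> powr (1 - p) * G) = G"
    using \<tau> by (simp add: mult.assoc[symmetric] flip: powr_add)
  also have "\<tau> powr (p - 1) * (\<tau> * m) = \<tau> powr p * m"
    using \<tau> by (simp add: powr_diff field_simps)
  finally have "(2 * D) powr p * (\<tau> powr p * m) \<le> (2 * D) powr p * G"
    by (intro mult_left_mono) auto
  then show ?thesis using \<tau> assms by (simp add: powr_mult mult_ac)
qed (use assms in simp)

section \<open>Doubling measures\<close>

lemma sum_nn_integral_overlap:
  fixes h :: "'b \<Rightarrow> ennreal"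
  assumes h: "h \<in> borel_measurable N" and F: "finite F" and A: "\<And>i. i \<in> F \<Longrightarrow> A i \<in> sets N"
    and B: "B \<in> sets N" and sub: "\<And>i. i \<in> F \<Longrightarrow> A i \<subseteq> B"
    and card: "\<And>y. y \<in> B \<Longrightarrow> real (card {i \<in> F. y \<in> A i}) \<le> c"
  shows "(\<Sum>i\<in>F. \<integral>\<^sup>+y\<in>A i. h y \<partial>N) \<le> ennreal c * (\<integral>\<^sup>+y\<in>B. h y \<partial>N)"
proof -
  have "(\<Sum>i\<in>F. \<integral>\<^sup>+y\<in>A i. h y \<partial>N) = (\<integral>\<^sup>+y. (\<Sum>i\<in>F. h y * indicator (A i) y) \<partial>N)"
    using h A by (intro nn_integral_sum[symmetric]) auto
  also have "\<dots> \<le> (\<integral>\<^sup>+y. ennreal c * (h y * indicator B y) \<partial>N)"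
  proof (rule nn_integral_mono)
    fix y
    have "(\<Sum>i\<in>F. h y * indicator (A i) y) = h y * of_nat (card {i \<in> F. y \<in> A i})"
      using F by (simp add: sum_distrib_left[symmetric] indicator_def sum.If_cases Int_def)
    also have "\<dots> \<le> ennreal c * (h y * indicator B y)"
    proof (cases "y \<in> B")
      case True
      have "(of_nat (card {i \<in> F. y \<in> A i}) :: ennreal) = ennreal (real (card {i \<in> F. y \<in> A i}))"
        by (simp add: ennreal_of_nat_eq_real_of_nat)
      also have "\<dots> \<le> ennreal c" by (rule ennreal_leI[OF card[OF True]])
      finally have "h y * of_nat (card {i \<in> F. y \<in> A i}) \<le> h y * ennreal c" by (rule mult_left_mono) simp
      then show ?thesis using True by (simp add: mult.commute)
    next
      case False
      then have e: "{i \<in> F. y \<in> A i} = {}" using sub by auto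
      show ?thesis unfolding e by simp
    qed
    finally show "(\<Sum>i\<in>F. h y * indicator (A i) y) \<le> ennreal c * (h y * indicator B y)" .
  qed
  also have "\<dots> \<le> ennreal c * (\<integral>\<^sup>+y\<in>B. h y \<partial>N)"
    using h B by (subst nn_integral_cmult) auto
  finally show ?thesis .
qed

text \<open>
  Functions are measurable with respect to the completion \<open>\<mu>\<close>, and all integrals are taken there;
  an integral over \<open>M\<close> has the same value.
\<close>

locale doubling_space =
  fixes M :: "'a::metric_space measure" and CD :: real
  assumes sets_M: "sets M = sets borel"
    and ball_pos: "r > 0 \<Longrightarrow> 0 < emeasure M (ball x r)"
    and ball_finite: "r > 0 \<Longrightarrow> emeasure M (ball x r) < \<infinity>"
    and CD: "1 \<le> CD"
    and doubling: "r > 0 \<Longrightarrow> measure M (ball x (2 * r)) \<le> CD * measure M (ball x r)"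
begin

abbreviation "vol x r \<equiv> measure M (ball x r)"
abbreviation "\<mu> \<equiv> completion M"

lemma space_M [simp]: "space M = UNIV"
  using sets_eq_imp_space_eq[OF sets_M] by simp

lemma borel_sets: "A \<in> sets borel \<Longrightarrow> A \<in> sets M"
  by (simp add: sets_M)

lemma borel_sets_\<mu>: "A \<in> sets borel \<Longrightarrow> A \<in> sets \<mu>"
  by (simp add: sets_M)

lemma borel_fun_M: "h \<in> borel_measurable borel \<Longrightarrow> h \<in> borel_measurable M"
  using measurable_cong_sets[OF sets_M refl] by blast

lemma borel_fun_\<mu>: "h \<in> borel_measurable borel \<Longrightarrow> h \<in> borel_measurable \<mu>"
  by (intro measurable_completion borel_fun_M)

lemma ball_sets_\<mu> [measurable]: "ball x r \<in> sets \<mu>"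
  by (simp add: borel_sets_\<mu>)

lemma emeasure_ball: "r > 0 \<Longrightarrow> emeasure \<mu> (ball x r) = ennreal (vol x r)"
  using ball_finite[of r x] by (simp add: borel_sets emeasure_eq_ennreal_measure less_top)

lemma vol_pos: "r > 0 \<Longrightarrow> 0 < vol x r"
  using ball_pos[of r x] ball_finite[of r x] by (simp add: measure_def enn2real_positive_iff)

lemma ball_subset: "dist x y + s \<le> r \<Longrightarrow> ball y s \<subseteq> ball x r"
  by (smt (verit) dist_triangle mem_ball subsetI)

lemma vol_mono: "\<lbrakk>ball y s \<subseteq> ball x r; r > 0\<rbrakk> \<Longrightarrow> vol y s \<le> vol x r"
  using ball_finite[of r x] by (intro measure_mono_fmeasurable) (auto simp: borel_sets fmeasurable_def)

lemma vol_doubling_pow: "r > 0 \<Longrightarrow> vol x (2 ^ n * r) \<le> CD ^ n * vol x r"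
proof (induction n)
  case (Suc n)
  have "vol x (2 ^ Suc n * r) \<le> CD * vol x (2 ^ n * r)" using doubling[of "2 ^ n * r" x] Suc.prems
      by (simp add: mult_ac)
  also have "\<dots> \<le> CD * (CD ^ n * vol x r)" using Suc CD by (intro mult_left_mono) auto
  finally show ?case by (simp add: mult_ac)
qed simp

lemma vol_compare:
  assumes "r > 0" "dist x y + s \<le> 2 ^ n * r"
  shows "vol y s \<le> CD ^ n * vol x r"
proof -
  have "vol y s \<le> vol x (2 ^ n * r)" using assms by (intro vol_mono ball_subset) auto
  also have "\<dots> \<le> CD ^ n * vol x r" by (rule vol_doubling_pow[OF assms(1)])
  finally show ?thesis .
qed

text \<open>
  Each ball has at least a fixed fraction of the measure of the big one, and their total measure is at
  most \<open>c\<close> times that of the big one.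
\<close>

lemma card_packing:
  fixes z :: "'i \<Rightarrow> 'a"
  assumes F: "finite F" and s: "\<And>i. i \<in> F \<Longrightarrow> s i > 0" and R: "R > 0"
    and sub: "\<And>i. i \<in> F \<Longrightarrow> ball (z i) (s i) \<subseteq> ball y R"
    and big: "\<And>i. i \<in> F \<Longrightarrow> dist (z i) y + R \<le> 2 ^ n * s i"
    and overlap: "\<And>w. real (card {i \<in> F. w \<in> ball (z i) (s i)}) \<le> c"
  shows "real (card F) \<le> c * CD ^ n"
proof -
  have c: "c \<ge> 0" using overlap[of undefined] by linarith
  have "(\<Sum>i\<in>F. \<integral>\<^sup>+w\<in>ball (z i) (s i). 1 \<partial>\<mu>) \<le> ennreal c * (\<integral>\<^sup>+w\<in>ball y R. 1 \<partial>\<mu>)"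
    by (rule sum_nn_integral_overlap) (use F sub overlap in auto)
  then have "(\<Sum>i\<in>F. ennreal (vol (z i) (s i))) \<le> ennreal c * ennreal (vol y R)"
    using s R by (simp add: emeasure_ball del: emeasure_completion)
  then have 1: "(\<Sum>i\<in>F. vol (z i) (s i)) \<le> c * vol y R"
    using c by (simp add: sum_ennreal ennreal_le_iff flip: ennreal_mult)
  have "real (card F) * vol y R = (\<Sum>i\<in>F. vol y R)" by simp
  also have "\<dots> \<le> (\<Sum>i\<in>F. CD ^ n * vol (z i) (s i))"
    by (intro sum_mono vol_compare s big)
  also have "\<dots> \<le> CD ^ n * (c * vol y R)"
    using 1 CD by (simp add: sum_distrib_left[symmetric] mult_left_mono)
  finally show ?thesis using vol_pos[OF R, of y] by (simp add: mult_ac)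
qed

lemma card_separated:
  fixes y :: 'a
  assumes Z: "finite Z" "Z \<subseteq> ball y R" and \<rho>: "\<rho> > 0"
    and sep: "\<And>z z'. \<lbrakk>z \<in> Z; z' \<in> Z; z \<noteq> z'\<rbrakk> \<Longrightarrow> \<rho> \<le> dist z z'"
    and n: "4 * R + \<rho> \<le> 2 ^ n * \<rho>"
  shows "real (card Z) \<le> CD ^ n"
proof (cases "R > 0")
  case True
  have "real (card Z) \<le> 1 * CD ^ n"
  proof (rule card_packing[where z = "\<lambda>z. z" and s = "\<lambda>_. \<rho> / 2" and y = y and R = "R + \<rho> / 2"])
    fix z assume "z \<in> Z"
    then have d: "dist y z < R" using Z by auto
    then show "ball z (\<rho> / 2) \<subseteq> ball y (R + \<rho> / 2)" by (intro ball_subset) auto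
    show "dist z y + (R + \<rho> / 2) \<le> 2 ^ n * (\<rho> / 2)" using d n by (simp add: dist_commute)
  next
    fix w
    have "z = z'" if "z \<in> Z" "w \<in> ball z (\<rho> / 2)" "z' \<in> Z" "w \<in> ball z' (\<rho> / 2)" for z z'
      using that sep[of z z'] dist_triangle2[of z z' w] by (force simp: dist_commute)
    then have "card {i \<in> Z. w \<in> ball i (\<rho> / 2)} \<le> 1"
      by (intro card_le_Suc0_iff_eq[THEN iffD2, unfolded One_nat_def[symmetric]]) (use Z in auto)
    then show "real (card {i \<in> Z. w \<in> ball i (\<rho> / 2)}) \<le> 1" by simp
  qed (use Z \<rho> True in auto)
  then show ?thesis by simp
next
  case False
  then have "Z = {}" using Z by (metis ball_empty not_less subset_empty)
  then show ?thesis using CD by simp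
qed

text \<open>
  A separated subset of largest cardinality; it exists by \<open>card_separated\<close>.
\<close>

lemma finite_net:
  fixes x :: 'a
  assumes "r > 0" "\<rho> > 0"
  obtains Z where "finite Z" "Z \<subseteq> ball x r" "ball x r \<subseteq> (\<Union>z\<in>Z. ball z \<rho>)"
    "\<And>z z'. \<lbrakk>z \<in> Z; z' \<in> Z; z \<noteq> z'\<rbrakk> \<Longrightarrow> \<rho> \<le> dist z z'"
proof -
  define good where "good Z \<longleftrightarrow> finite Z \<and> Z \<subseteq> ball x r \<and> (\<forall>z\<in>Z. \<forall>z'\<in>Z. z \<noteq> z' \<longrightarrow> \<rho> \<le> dist z z')" for Z
  obtain n where n: "(4 * r + \<rho>) / \<rho> \<le> 2 ^ n"
    using real_arch_pow[of 2 "(4 * r + \<rho>) / \<rho>"] by (auto intro: less_imp_le)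
  then have n: "4 * r + \<rho> \<le> 2 ^ n * \<rho>" using assms by (simp add: field_simps)
  have bound: "card Z < nat \<lceil>CD ^ n\<rceil> + 1" if "good Z" for Z
  proof -
    have "real (card Z) \<le> CD ^ n"
      using card_separated[of Z x r \<rho> n] that assms n unfolding good_def by blast
    then show ?thesis by linarith
  qed
  have "good {}" by (simp add: good_def)
  then obtain Z where Z: "good Z" "\<And>Z'. good Z' \<Longrightarrow> card Z' \<le> card Z"
    using ex_has_greatest_nat[of good "{}" card "nat \<lceil>CD ^ n\<rceil> + 1"] bound by blast
  show thesis
  proof (rule that[of Z])
    show "ball x r \<subseteq> (\<Union>z\<in>Z. ball z \<rho>)"
    proof (rule ccontr)
      assume "\<not> ?thesis"
      then obtain y where y: "y \<in> ball x r" "\<And>z. z \<in> Z \<Longrightarrow> \<rho> \<le> dist z y" by force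
      then have "y \<notin> Z" using \<open>\<rho> > 0\<close> by force
      then have "card (insert y Z) = Suc (card Z)" using Z(1) unfolding good_def by simp
      moreover have "good (insert y Z)"
        using y Z(1) unfolding good_def by (auto simp: dist_commute)
      ultimately show False using Z(2)[of "insert y Z"] by simp
    qed
  qed (use Z in \<open>auto simp: good_def\<close>)
qed

end

section \<open>The Poincare inequality with equal exponents\<close>

text \<open>
  The Poincare inequality in linearized form: the \<open>p\<close>-th root is replaced by a free parameter \<open>\<tau>\<close>
  (Young's inequality) and the mean value by some constant \<open>a\<close>, the same for all \<open>\<tau>\<close>. In this form
  only sums of integrals occur, and no roots of extended reals.
\<close>

locale poincare_space = doubling_space M CD
  for M :: "'a::metric_space measure" and CD :: real +
  fixes p CP L :: real
  assumes p: "1 < p" and L: "1 \<le> L" and CP: "0 < CP"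
    and poincare: "\<lbrakk>f \<in> borel_measurable (completion M); upper_gradient (\<lambda>y. ereal (f y)) g;
        \<And>y. \<bar>f y\<bar> \<le> F; r > 0\<rbrakk> \<Longrightarrow>
      \<exists>a. \<forall>\<tau>>0. (\<integral>\<^sup>+y\<in>ball x r. ennreal \<bar>f y - a\<bar> \<partial>completion M)
        \<le> ennreal (CP * r) * (ennreal (\<tau> * measure M (ball x r)) +
            ennreal (\<tau> powr (1 - p)) * (\<integral>\<^sup>+y\<in>ball x (L * r). ennreal_pow (g y) p \<partial>completion M))"
begin

abbreviation mass :: "('a \<Rightarrow> ennreal) \<Rightarrow> 'a set \<Rightarrow> ennreal" where
  "mass h A \<equiv> \<integral>\<^sup>+y\<in>A. h y \<partial>\<mu>"

abbreviation pmass :: "('a \<Rightarrow> real) \<Rightarrow> 'a set \<Rightarrow> ennreal" where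
  "pmass f A \<equiv> \<integral>\<^sup>+y\<in>A. ennreal (f y powr p) \<partial>\<mu>"

abbreviation osc :: "('a \<Rightarrow> real) \<Rightarrow> real \<Rightarrow> 'a set \<Rightarrow> ennreal" where
  "osc f a A \<equiv> \<integral>\<^sup>+y\<in>A. ennreal \<bar>f y - a\<bar> \<partial>\<mu>"

abbreviation posc :: "('a \<Rightarrow> real) \<Rightarrow> real \<Rightarrow> 'a set \<Rightarrow> ennreal" where
  "posc f a A \<equiv> \<integral>\<^sup>+y\<in>A. ennreal (\<bar>f y - a\<bar> powr p) \<partial>\<mu>"

definition energy :: "('a \<Rightarrow> ennreal) \<Rightarrow> 'a set \<Rightarrow> ennreal" where
  "energy g A = (\<integral>\<^sup>+y\<in>A. ennreal_pow (g y) p \<partial>\<mu>)"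

lemma energy_mono: "A \<subseteq> B \<Longrightarrow> energy g A \<le> energy g B"
  unfolding energy_def by (intro nn_integral_mono) (auto simp: indicator_def)

lemma upper_gradient_measurable:
  "upper_gradient (\<lambda>y. ereal (f y)) g \<Longrightarrow> g \<in> borel_measurable \<mu>"
  by (intro borel_fun_\<mu>) (simp add: upper_gradient_real)

lemma poincare_bounded:
  assumes "f \<in> borel_measurable \<mu>" "upper_gradient (\<lambda>y. ereal (f y)) g" and F: "\<And>y. \<bar>f y\<bar> \<le> F"
    and "r > 0"
  shows "\<exists>a. \<bar>a\<bar> \<le> F \<and> (\<forall>\<tau>>0. osc f a (ball x r)
        \<le> ennreal (CP * r) * (ennreal (\<tau> * vol x r) + ennreal (\<tau> powr (1 - p)) * energy g (ball x (L
          * r))))"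
proof -
  obtain a where a: "\<And>\<tau>. \<tau> > 0 \<Longrightarrow> osc f a (ball x r)
        \<le> ennreal (CP * r) * (ennreal (\<tau> * vol x r) + ennreal (\<tau> powr (1 - p)) * energy g (ball x (L * r)))"
    using poincare[OF assms(1,2) F assms(4), of x] unfolding energy_def by blast
  \<comment> \<open>Clamping \<open>a\<close> to the range of \<open>f\<close> does not increase the oscillation.\<close>
  define a' where "a' = max (- F) (min F a)"
  have le: "\<bar>f y - a'\<bar> \<le> \<bar>f y - a\<bar>" for y
    using F[of y] unfolding a'_def by (auto simp: max_def min_def)
  have "\<bar>a'\<bar> \<le> F" using F[of x] unfolding a'_def by (auto simp: max_def min_def)
  moreover have "osc f a' (ball x r) \<le> osc f a (ball x r)"
    by (intro nn_integral_mono mult_right_mono ennreal_leI le) auto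
  ultimately show ?thesis using a order_trans by (intro exI[of _ a']) blast
qed

lemma nn_integral_union_le:
  fixes h :: "'b \<Rightarrow> ennreal"
  assumes "h \<in> borel_measurable N" "finite F" "\<And>i. i \<in> F \<Longrightarrow> A i \<in> sets N" "B \<subseteq> (\<Union>i\<in>F. A i)"
  shows "(\<integral>\<^sup>+y\<in>B. h y \<partial>N) \<le> (\<Sum>i\<in>F. \<integral>\<^sup>+y\<in>A i. h y \<partial>N)"
proof -
  have "(\<integral>\<^sup>+y\<in>B. h y \<partial>N) \<le> (\<integral>\<^sup>+y. (\<Sum>i\<in>F. h y * indicator (A i) y) \<partial>N)"
  proof (rule nn_integral_mono)
    fix y show "h y * indicator B y \<le> (\<Sum>i\<in>F. h y * indicator (A i) y)"
    proof (cases "y \<in> B")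
      case True
      then obtain i where "i \<in> F" "y \<in> A i" using assms(4) by auto
      then show ?thesis using True member_le_sum[of i F "\<lambda>i. h y * indicator (A i) y"] assms(2)
        by auto
    qed auto
  qed
  also have "\<dots> = (\<Sum>i\<in>F. \<integral>\<^sup>+y\<in>A i. h y \<partial>N)"
    using assms by (intro nn_integral_sum) auto
  finally show ?thesis .
qed

lemma nn_integral_powr_add_le:
  assumes [measurable]: "f \<in> borel_measurable \<mu>" and "r > 0"
  shows "posc f b (ball z r)
    \<le> ennreal (2 powr p) * (posc f a (ball z r)
        + ennreal (\<bar>a - b\<bar> powr p * vol z r))"
proof -
  have "posc f b (ball z r)
    \<le> (\<integral>\<^sup>+y. ennreal (2 powr p) * (ennreal (\<bar>f y - a\<bar> powr p) * indicator (ball z r) y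
          + ennreal (\<bar>a - b\<bar> powr p) * indicator (ball z r) y) \<partial>\<mu>)"
  proof (rule nn_integral_mono)
    fix y
    have "\<bar>f y - b\<bar> powr p \<le> (\<bar>f y - a\<bar> + \<bar>a - b\<bar>) powr p" using p by (intro powr_mono2) auto
    also have "\<dots> \<le> 2 powr p * (\<bar>f y - a\<bar> powr p + \<bar>a - b\<bar> powr p)" using p by (intro powr_add_le) auto
    finally have "ennreal (\<bar>f y - b\<bar> powr p) \<le> ennreal (2 powr p) * (ennreal (\<bar>f y - a\<bar> powr p)
        + ennreal (\<bar>a - b\<bar> powr p))"
      by (simp flip: ennreal_plus ennreal_mult)
    then show "ennreal (\<bar>f y - b\<bar> powr p) * indicator (ball z r) y
      \<le> ennreal (2 powr p) * (ennreal (\<bar>f y - a\<bar> powr p) * indicator (ball z r) y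
          + ennreal (\<bar>a - b\<bar> powr p) * indicator (ball z r) y)"
      by (auto simp: indicator_def)
  qed
  also have "\<dots> = ennreal (2 powr p) * (posc f a (ball z r)
        + ennreal (\<bar>a - b\<bar> powr p) * emeasure \<mu> (ball z r))"
  proof -
    have "(\<integral>\<^sup>+y. ennreal (\<bar>a - b\<bar> powr p) * indicator (ball z r) y \<partial>\<mu>)
        = ennreal (\<bar>a - b\<bar> powr p) * emeasure \<mu> (ball z r)"
      by (rule nn_integral_cmult_indicator) measurable
    moreover have "(\<integral>\<^sup>+y. ennreal (\<bar>f y - a\<bar> powr p) * indicator (ball z r) y
          + ennreal (\<bar>a - b\<bar> powr p) * indicator (ball z r) y \<partial>\<mu>)
        = posc f a (ball z r)
          + (\<integral>\<^sup>+y. ennreal (\<bar>a - b\<bar> powr p) * indicator (ball z r) y \<partial>\<mu>)"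
      by (rule nn_integral_add) measurable
    moreover have "(\<integral>\<^sup>+y. ennreal (2 powr p) * (ennreal (\<bar>f y - a\<bar> powr p) * indicator (ball z r) y
          + ennreal (\<bar>a - b\<bar> powr p) * indicator (ball z r) y) \<partial>\<mu>)
        = ennreal (2 powr p) * (\<integral>\<^sup>+y. ennreal (\<bar>f y - a\<bar> powr p) * indicator (ball z r) y
          + ennreal (\<bar>a - b\<bar> powr p) * indicator (ball z r) y \<partial>\<mu>)"
      by (rule nn_integral_cmult) measurable
    ultimately show ?thesis by metis
  qed
  also have "ennreal (\<bar>a - b\<bar> powr p) * emeasure \<mu> (ball z r) = ennreal (\<bar>a - b\<bar> powr p * vol z r)"
    using assms by (simp add: emeasure_ball ennreal_mult del: emeasure_completion)
  finally show ?thesis .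
qed

text \<open>
  If a small ball is contained in two balls of comparable measure, the Poincare constants of the latter
  differ by no more than the energy allows: integrate \<open>\<bar>a - b\<bar> \<le> \<bar>f - a\<bar> + \<bar>f - b\<bar>\<close> over the small ball.
\<close>

lemma difference_of_constants:
  assumes f[measurable]: "f \<in> borel_measurable \<mu>" and r: "0 < r" "0 < s" "s \<le> R" and c: "c \<ge> 1"
    and sub: "ball z r \<subseteq> ball z' s" "ball z r \<subseteq> ball x R"
    and vol: "vol z' s \<le> c * vol z r" "vol x R \<le> c * vol z r"
    and en: "energy g (ball z' (L * s)) \<le> ennreal G" "energy g (ball x (L * R)) \<le> ennreal G" "G \<ge> 0"
    and a: "\<And>\<tau>. \<tau> > 0 \<Longrightarrow> osc f a (ball z' s)
        \<le> ennreal (CP * s) * (ennreal (\<tau> * vol z' s) + ennreal (\<tau> powr (1 - p)) * energy g (ball z' (L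
          * s)))"
    and b: "\<And>\<tau>. \<tau> > 0 \<Longrightarrow> osc f b (ball x R)
        \<le> ennreal (CP * R) * (ennreal (\<tau> * vol x R) + ennreal (\<tau> powr (1 - p)) * energy g (ball x (L * R)))"
  shows "\<bar>a - b\<bar> powr p * vol z r \<le> (4 * CP * c * R) powr p * G"
proof -
  have "\<bar>a - b\<bar> powr p * vol z r \<le> (2 * (2 * CP * c * R)) powr p * G"
  proof (rule powr_absorb)
    fix \<tau> :: real assume \<tau>: "\<tau> > 0"
    have vp: "vol z r > 0" using vol_pos r by simp
    define B where "B = CP * R * (\<tau> * (c * vol z r) + \<tau> powr (1 - p) * G)"
    have bound: "ennreal (CP * s') * (ennreal (\<tau> * vol w s') + ennreal (\<tau> powr (1 - p))
        * energy g (ball w (L * s')))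
      \<le> ennreal B" if "vol w s' \<le> c * vol z r" "energy g (ball w (L * s')) \<le> ennreal G" "0 \<le> s'" "s'
        \<le> R" for w s'
    proof -
      have "ennreal (CP * s') * (ennreal (\<tau> * vol w s') + ennreal (\<tau> powr (1 - p)) * energy g (ball w (L
          * s')))
        \<le> ennreal (CP * R) * (ennreal (\<tau> * (c * vol z r)) + ennreal (\<tau> powr (1 - p)) * ennreal G)"
        using that CP \<tau> by (intro mult_mono add_mono ennreal_leI) auto
      also have "\<dots> = ennreal B"
        unfolding B_def using CP r \<tau> c vp en by (simp add: ennreal_mult)
      finally show ?thesis .
    qed
    have B0: "B \<ge> 0" unfolding B_def using CP r \<tau> c vp en by simp
    have "ennreal (\<bar>a - b\<bar> * vol z r) = (\<integral>\<^sup>+y\<in>ball z r. ennreal \<bar>a - b\<bar> \<partial>\<mu>)"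
      using r by (simp add: nn_integral_cmult_indicator emeasure_ball ennreal_mult del: emeasure_completion)
    also have "\<dots> \<le> (\<integral>\<^sup>+y. ennreal \<bar>f y - a\<bar> * indicator (ball z' s) y + ennreal \<bar>f y - b\<bar>
        * indicator (ball x R) y \<partial>\<mu>)"
    proof (rule nn_integral_mono)
      fix y
      have "ennreal \<bar>a - b\<bar> \<le> ennreal \<bar>f y - a\<bar> + ennreal \<bar>f y - b\<bar>"
        by (simp flip: ennreal_plus)
      then show "ennreal \<bar>a - b\<bar> * indicator (ball z r) y
          \<le> ennreal \<bar>f y - a\<bar> * indicator (ball z' s) y + ennreal \<bar>f y - b\<bar> * indicator (ball x R) y"
        using sub by (cases "y \<in> ball z r") (simp_all add: subset_iff)
    qed
    also have "\<dots> = osc f a (ball z' s) + osc f b (ball x R)"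
      by (rule nn_integral_add) measurable
    also have "\<dots> \<le> ennreal B + ennreal B"
    proof (rule add_mono)
      show "osc f a (ball z' s) \<le> ennreal B"
        by (rule order_trans[OF a[OF \<tau>] bound]) (use vol en r in simp_all)
      show "osc f b (ball x R) \<le> ennreal B"
        by (rule order_trans[OF b[OF \<tau>] bound]) (use vol en r in simp_all)
    qed
    finally have "\<bar>a - b\<bar> * vol z r \<le> 2 * B" using B0 by (simp add: ennreal_le_iff flip: ennreal_plus)
    also have "\<dots> = (2 * CP * R) * (\<tau> * (c * vol z r) + \<tau> powr (1 - p) * G)" unfolding B_def by simp
    also have "\<dots> \<le> (2 * CP * R) * (c * (\<tau> * vol z r) + c * (\<tau> powr (1 - p) * G))"
      using mult_right_mono[of 1 c "\<tau> powr (1 - p) * G"] c en r CP by (intro mult_left_mono add_mono) auto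
    finally show "\<bar>a - b\<bar> * vol z r \<le> 2 * CP * c * R * (\<tau> * vol z r + \<tau> powr (1 - p) * G)"
      by (simp add: algebra_simps)
  qed (use CP c r en in auto)
  then show ?thesis by (simp add: mult.assoc)
qed

text \<open>
  One step of the induction on scales: an estimate on all balls of radius \<open>\<rho>\<close> is carried over to
  radius \<open>r\<close>. The factor \<open>CD ^ n1\<close> counts the overlap of the balls enlarged by \<open>\<Lambda>\<close>; by \<open>n1\<close> it depends
  on \<open>\<Lambda>\<close> but not on \<open>r / \<rho>\<close>, so a gain in \<open>\<rho> / r\<close> beats it.
\<close>

lemma self_improvement_step:
  assumes f[measurable]: "f \<in> borel_measurable \<mu>" and h[measurable]: "h1 \<in> borel_measurable \<mu>"
      "h2 \<in> borel_measurable \<mu>"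
    and r: "r > 0" and \<rho>: "\<rho> > 0" and \<Lambda>: "r + \<Lambda> * \<rho> \<le> \<Lambda> * r" "\<Lambda> > 0"
    and n1: "4 * \<Lambda> + 1 \<le> 2 ^ n1" and n2: "4 * r + \<rho> \<le> 2 ^ n2 * \<rho>"
    and IH: "\<And>z. posc f (a z) (ball z \<rho>)
        \<le> ennreal c1 * mass h1 (ball z (\<Lambda> * \<rho>)) + ennreal c2 * mass h2 (ball z (\<Lambda> * \<rho>))"
    and diff: "\<And>z. z \<in> ball x r \<Longrightarrow> \<bar>a z - b\<bar> powr p * vol z \<rho> \<le> c3"
  shows "posc f b (ball x r)
    \<le> ennreal (2 powr p) * (ennreal (CD ^ n1) * (ennreal c1 * mass h1 (ball x (\<Lambda> * r))
          + ennreal c2 * mass h2 (ball x (\<Lambda> * r))) + ennreal (CD ^ n2 * c3))"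
proof -
  obtain Z where Z: "finite Z" "Z \<subseteq> ball x r" "ball x r \<subseteq> (\<Union>z\<in>Z. ball z \<rho>)"
    and sep: "\<And>z z'. \<lbrakk>z \<in> Z; z' \<in> Z; z \<noteq> z'\<rbrakk> \<Longrightarrow> \<rho> \<le> dist z z'"
    using finite_net[OF r \<rho>] by metis
  have c3: "c3 \<ge> 0"
  proof -
    have "0 \<le> \<bar>a x - b\<bar> powr p * vol x \<rho>" by simp
    also have "\<dots> \<le> c3" using r by (intro diff) auto
    finally show ?thesis .
  qed
  have cardZ: "real (card Z) \<le> CD ^ n2" by (rule card_separated[OF Z(1,2) \<rho> sep n2])
  have overlap: "real (card {z \<in> Z. y \<in> ball z (\<Lambda> * \<rho>)}) \<le> CD ^ n1" for y
  proof (rule card_separated[of _ y "\<Lambda> * \<rho>" \<rho>])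
    show "4 * (\<Lambda> * \<rho>) + \<rho> \<le> 2 ^ n1 * \<rho>"
      using mult_right_mono[OF n1, of \<rho>] \<rho> by (simp add: algebra_simps)
  qed (use Z sep \<rho> in \<open>auto simp: dist_commute\<close>)
  have sub: "ball z (\<Lambda> * \<rho>) \<subseteq> ball x (\<Lambda> * r)" if "z \<in> Z" for z
    using that Z(2) \<Lambda> by (intro ball_subset) auto
  have ov: "(\<Sum>z\<in>Z. \<integral>\<^sup>+y\<in>ball z (\<Lambda> * \<rho>). h y \<partial>\<mu>) \<le> ennreal (CD ^ n1) * mass h (ball x (\<Lambda> * r))"
    if "h \<in> borel_measurable \<mu>" for h
    by (rule sum_nn_integral_overlap[OF that Z(1)]) (use sub overlap in auto)
  have "posc f b (ball x r)
      \<le> (\<Sum>z\<in>Z. \<integral>\<^sup>+y\<in>ball z \<rho>. ennreal (\<bar>f y - b\<bar> powr p) \<partial>\<mu>)"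
    by (rule nn_integral_union_le) (use Z in auto)
  also have "\<dots> \<le> (\<Sum>z\<in>Z. ennreal (2 powr p) * (
        (ennreal c1 * mass h1 (ball z (\<Lambda> * \<rho>)) + ennreal c2 * mass h2 (ball z (\<Lambda> * \<rho>))) + ennreal c3))"
  proof (rule sum_mono)
    fix z assume z: "z \<in> Z"
    have "posc f b (ball z \<rho>)
        \<le> ennreal (2 powr p) * (posc f (a z) (ball z \<rho>) + ennreal (\<bar>a z - b\<bar> powr p * vol z \<rho>))"
      by (rule nn_integral_powr_add_le[OF f \<rho>])
    also have "\<dots> \<le> ennreal (2 powr p) * (
        (ennreal c1 * mass h1 (ball z (\<Lambda> * \<rho>)) + ennreal c2 * mass h2 (ball z (\<Lambda> * \<rho>))) + ennreal c3)"
      by (intro mult_left_mono add_mono IH ennreal_leI diff) (use z Z in auto)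
    finally show "posc f b (ball z \<rho>) \<le> ennreal (2 powr p) * (
        (ennreal c1 * mass h1 (ball z (\<Lambda> * \<rho>)) + ennreal c2 * mass h2 (ball z (\<Lambda> * \<rho>))) + ennreal c3)" .
  qed
  also have "\<dots> = ennreal (2 powr p) * (
        (ennreal c1 * (\<Sum>z\<in>Z. \<integral>\<^sup>+y\<in>ball z (\<Lambda> * \<rho>). h1 y \<partial>\<mu>) + ennreal c2 * (\<Sum>z\<in>Z. \<integral>\<^sup>+y\<in>ball z (\<Lambda>
            * \<rho>). h2 y \<partial>\<mu>))
        + of_nat (card Z) * ennreal c3)"
    by (simp only: sum_distrib_left[symmetric] sum.distrib sum_constant)
  also have "\<dots> \<le> ennreal (2 powr p) * (
        (ennreal c1 * (ennreal (CD ^ n1) * mass h1 (ball x (\<Lambda> * r)))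
          + ennreal c2 * (ennreal (CD ^ n1) * mass h2 (ball x (\<Lambda> * r)))) + ennreal (CD ^ n2 * c3))"
  proof (intro mult_left_mono add_mono ov h)
    have "of_nat (card Z) * ennreal c3 = ennreal (real (card Z) * c3)"
      by (simp add: ennreal_mult' ennreal_of_nat_eq_real_of_nat)
    also have "\<dots> \<le> ennreal (CD ^ n2 * c3)" using cardZ c3 by (intro ennreal_leI mult_right_mono)
    finally show "of_nat (card Z) * ennreal c3 \<le> ennreal (CD ^ n2 * c3)" .
  qed auto
  also have "\<dots> = ennreal (2 powr p) * (ennreal (CD ^ n1) * (ennreal c1 * mass h1 (ball x (\<Lambda> * r))
          + ennreal c2 * mass h2 (ball x (\<Lambda> * r))) + ennreal (CD ^ n2 * c3))"
    by (simp add: distrib_left mult.left_commute)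
  finally show ?thesis .
qed

lemma ennreal_distrib_coefficients:
  assumes "0 \<le> a" "0 \<le> b" "0 \<le> c" "0 \<le> d" "0 \<le> e" "0 \<le> f" "0 \<le> G"
  shows "ennreal a * (ennreal b * (ennreal c * ennreal G + ennreal d * W) + ennreal (e * (f * G)))
    = ennreal (a * b * c) * ennreal G + ennreal (a * b * d) * W + ennreal (a * (e * f)) * ennreal G"
  using assms by (simp add: distrib_left ennreal_mult mult.assoc)

text \<open>
  For bounded \<open>f\<close> the \<open>(1, p)\<close> inequality bounds the integral of \<open>\<bar>f - a\<bar>\<^sup>p\<close> over a ball of radius \<open>r\<close> by
  \<open>D0 r\<close> times the integral of \<open>1 + g\<^sup>p\<close>. This has the wrong power of \<open>r\<close> and \<open>D0\<close> depends on \<open>f\<close>, but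
  each step from radius \<open>r / 2\<^sup>m\<close> to \<open>r\<close> halves the constant of this bad term, because the radius
  enters it linearly, and keeps the constant \<open>K\<close> of the good term. In the limit the bad term
  disappears.
\<close>

lemma poincare_equal_exponents:
  obtains K \<Lambda> where "K > 0" "\<Lambda> \<ge> 2"
    "\<And>f g F x r. \<lbrakk>f \<in> borel_measurable \<mu>; upper_gradient (\<lambda>y. ereal (f y)) g; \<And>y. \<bar>f y\<bar> \<le> F; r > 0\<rbrakk> \<Longrightarrow>
      \<exists>a. posc f a (ball x r) \<le> ennreal (K * r powr p) * energy g (ball x (\<Lambda> * r))"
proof -
  define \<Lambda> where "\<Lambda> = 2 * L"
  have \<Lambda>: "\<Lambda> \<ge> 2" using L by (simp add: \<Lambda>_def)
  obtain n1 where n1: "4 * \<Lambda> + 1 \<le> 2 ^ n1"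
    using real_arch_pow[of 2 "4 * \<Lambda> + 1"] by (auto intro: less_imp_le)
  \<comment> \<open>The scale ratio \<open>2\<^sup>m\<close> must beat the overlap \<open>CD ^ n1\<close> and the convexity constant \<open>2\<^sup>p\<close>.\<close>
  obtain m0 where m0: "2 * 2 powr p * CD ^ n1 \<le> 2 ^ m0"
    using real_arch_pow[of 2 "2 * 2 powr p * CD ^ n1"] by (auto intro: less_imp_le)
  define m where "m = Suc m0"
  have "(2::real) ^ m = 2 * 2 ^ m0" "1 \<le> (2::real) ^ m0" by (auto simp: m_def)
  then have m: "2 * 2 powr p * CD ^ n1 \<le> 2 ^ m" "2 \<le> (2::real) ^ m"
    using m0 by linarith+
  define c where "c = CD ^ (m + 2)"
  have c: "c \<ge> 1" unfolding c_def using CD by (rule one_le_power)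
  have CDc: "CD \<le> c" unfolding c_def using power_increasing[of 1 "m + 2" CD] CD
      by (simp only: power_one_right)
  define K where "K = 2 * (2 powr p * (CD ^ (m + 3) * (8 * CP * c) powr p))"
  have K: "K > 0" unfolding K_def using CD CP c by simp
  have main: "\<exists>a. posc f a (ball x r) \<le> ennreal (K * r powr p) * energy g (ball x (\<Lambda> * r))"
    if f[measurable]: "f \<in> borel_measurable \<mu>" and ug: "upper_gradient (\<lambda>y. ereal (f y)) g"
        and F: "\<And>y. \<bar>f y\<bar> \<le> F" and r: "r > 0"
    for f g F x r
  proof (cases "energy g (ball x (\<Lambda> * r)) = \<infinity>")
    case True
    then show ?thesis using K r by (simp add: ennreal_mult_top)
  next
    case Efin: False
    have F0: "F \<ge> 0" using F[of x] by linarith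
    have [measurable]: "g \<in> borel_measurable \<mu>" by (rule upper_gradient_measurable[OF ug])
    define A where "A x r = (SOME a. \<bar>a\<bar> \<le> F \<and> (\<forall>\<tau>>0. osc f a (ball x r)
        \<le> ennreal (CP * r) * (ennreal (\<tau> * vol x r) + ennreal (\<tau> powr (1 - p)) * energy g (ball x (L
          * r)))))" for x r
    have A: "\<bar>A x r\<bar> \<le> F" "\<And>\<tau>. \<tau> > 0 \<Longrightarrow> osc f (A x r) (ball x r)
        \<le> ennreal (CP * r) * (ennreal (\<tau> * vol x r) + ennreal (\<tau> powr (1 - p)) * energy g (ball x (L * r)))"
      if "r > 0" for x r
      using someI_ex[OF poincare_bounded[OF f ug F that, of x]] unfolding A_def by blast+
    \<comment> \<open>The good term carries the density \<open>h1\<close>, the bad term the density \<open>h2\<close>, which also contains \<open>1\<close>.\<close>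
    define h1 where "h1 y = ennreal_pow (g y) p" for y
    define h2 where "h2 y = 1 + ennreal_pow (g y) p" for y
    have h[measurable]: "h1 \<in> borel_measurable \<mu>" "h2 \<in> borel_measurable \<mu>"
      unfolding h1_def h2_def by measurable
    have Eh1: "energy g B = mass h1 B" for B by (simp add: energy_def h1_def)
    have Wh2: "mass h2 (ball x s) = ennreal (vol x s) + energy g (ball x s)" if "s > 0" for x s
    proof -
      have "mass h2 (ball x s) = (\<integral>\<^sup>+y. indicator (ball x s) y + h1 y * indicator (ball x s) y \<partial>\<mu>)"
        by (intro nn_integral_cong) (simp add: h1_def h2_def distrib_right)
      also have "\<dots> = (\<integral>\<^sup>+y. indicator (ball x s) y \<partial>\<mu>) + energy g (ball x s)"
        unfolding Eh1 by (rule nn_integral_add) measurable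
      also have "(\<integral>\<^sup>+y. indicator (ball x s) y \<partial>\<mu>) = ennreal (vol x s)"
        using that emeasure_ball[of s x] by (simp del: emeasure_completion)
      finally show ?thesis .
    qed
    define D0 where "D0 = (2 * F) powr (p - 1) * (2 * CP)"
    have D0: "D0 \<ge> 0" unfolding D0_def using CP by simp
    \<comment> \<open>The constant is taken from the doubled ball because the small balls of a cover of
      \<open>ball x r\<close> need not lie in \<open>ball x r\<close>.\<close>
    have P: "posc f (A x (2 * r)) (ball x r)
        \<le> ennreal (K * r powr p) * mass h1 (ball x (\<Lambda> * r))
          + ennreal (D0 * r / 2 ^ n) * mass h2 (ball x (\<Lambda> * r))"
      if "r > 0" for x r n
      using that
    proof (induction n arbitrary: x r)
      case 0
      have "posc f (A x (2 * r)) (ball x r)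
          \<le> (\<integral>\<^sup>+y. ennreal ((2 * F) powr (p - 1)) * (ennreal \<bar>f y - A x (2 * r)\<bar> * indicator (ball x (2
            * r)) y) \<partial>\<mu>)"
      proof (rule nn_integral_mono)
        fix y
        define t where "t = \<bar>f y - A x (2 * r)\<bar>"
        have t: "0 \<le> t" "t \<le> 2 * F" using F[of y] A(1)[of "2 * r" x] 0 unfolding t_def by linarith+
        have "t powr p = t powr (p - 1) * t" using t by (cases "t = 0") (auto simp: powr_diff)
        also have "\<dots> \<le> (2 * F) powr (p - 1) * t" using t p by (intro mult_right_mono powr_mono2) auto
        finally have "ennreal (t powr p) \<le> ennreal ((2 * F) powr (p - 1)) * ennreal t"
          using t by (simp flip: ennreal_mult)
        then show "ennreal (\<bar>f y - A x (2 * r)\<bar> powr p) * indicator (ball x r) y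
          \<le> ennreal ((2 * F) powr (p - 1)) * (ennreal \<bar>f y - A x (2 * r)\<bar> * indicator (ball x (2 * r)) y)"
          unfolding t_def[symmetric] using 0 by (auto simp: indicator_def)
      qed
      also have "\<dots> = ennreal ((2 * F) powr (p - 1)) * osc f (A x (2 * r)) (ball x (2 * r))"
        by (rule nn_integral_cmult) measurable
      also have "\<dots> \<le> ennreal ((2 * F) powr (p - 1)) *
          (ennreal (CP * (2 * r)) * (ennreal (1 * vol x (2 * r)) + ennreal (1 powr (1 - p))
              * energy g (ball x (L * (2 * r)))))"
        using 0 by (intro mult_left_mono A) auto
      also have "\<dots> \<le> ennreal ((2 * F) powr (p - 1)) *
          (ennreal (CP * (2 * r)) * (ennreal (vol x (\<Lambda> * r)) + energy g (ball x (\<Lambda> * r))))"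
      proof (intro mult_left_mono add_mono)
        have "vol x (2 * r) \<le> vol x (\<Lambda> * r)" using 0 \<Lambda> by (intro vol_mono subset_ball) auto
        then show "ennreal (1 * vol x (2 * r)) \<le> ennreal (vol x (\<Lambda> * r))" by (simp add: ennreal_leI)
        show "ennreal (1 powr (1 - p)) * energy g (ball x (L * (2 * r))) \<le> energy g (ball x (\<Lambda> * r))"
          by (simp add: \<Lambda>_def mult_ac)
      qed auto
      also have "\<dots> = ennreal (D0 * r / 2 ^ 0) * mass h2 (ball x (\<Lambda> * r))"
        using 0 \<Lambda> CP by (subst Wh2) (auto simp: D0_def mult_ac simp flip: ennreal_mult mult.assoc)
      finally show ?case by (simp add: add_increasing)
    next
      case (Suc n)
      note r = \<open>r > 0\<close>
      define \<rho> where "\<rho> = r / 2 ^ m"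
      have \<rho>: "\<rho> > 0" "\<rho> \<le> r / 2" "2 ^ m * \<rho> = r"
        using r m(2) by (auto simp: \<rho>_def field_simps)
      show ?case
      proof (cases "energy g (ball x (\<Lambda> * r)) = \<infinity>")
        case True
        then show ?thesis using K r unfolding Eh1[symmetric] by (simp add: ennreal_mult_top)
      next
        case False
        define G where "G = enn2real (energy g (ball x (\<Lambda> * r)))"
        have G: "energy g (ball x (\<Lambda> * r)) = ennreal G" "G \<ge> 0"
          using False by (auto simp: G_def less_top)
        have diff: "\<bar>A z (2 * \<rho>) - A x (2 * r)\<bar> powr p * vol z \<rho> \<le> (4 * CP * c * (2 * r)) powr p * G"
          if z: "z \<in> ball x r" for z
        proof (rule difference_of_constants[OF f])
          show "ball z \<rho> \<subseteq> ball z (2 * \<rho>)" "ball z \<rho> \<subseteq> ball x (2 * r)"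
            using z \<rho>(1,2) by (auto intro!: ball_subset subset_ball)
          show "vol z (2 * \<rho>) \<le> c * vol z \<rho>"
            using doubling[OF \<rho>(1), of z] mult_right_mono[OF CDc, of "vol z \<rho>"] by simp
          show "vol x (2 * r) \<le> c * vol z \<rho>" unfolding c_def
          proof (rule vol_compare)
            have "2 ^ (m + 2) * \<rho> = 4 * r" using \<rho>(3) by (simp add: power_add)
            then show "dist z x + 2 * r \<le> 2 ^ (m + 2) * \<rho>" using z r by (simp add: dist_commute)
          qed (use \<rho> in auto)
          have "ball z (L * (2 * \<rho>)) \<subseteq> ball x (\<Lambda> * r)"
          proof (rule ball_subset)
            have "L * (2 * \<rho>) \<le> L * r" using \<rho> L by (intro mult_left_mono) auto
            moreover have "1 * r \<le> L * r" using r L by (intro mult_right_mono) auto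
            ultimately show "dist x z + L * (2 * \<rho>) \<le> \<Lambda> * r" using z by (simp add: \<Lambda>_def)
          qed
          then show "energy g (ball z (L * (2 * \<rho>))) \<le> ennreal G"
            unfolding G(1)[symmetric] by (rule energy_mono)
          show "energy g (ball x (L * (2 * r))) \<le> ennreal G"
            unfolding G(1)[symmetric] by (simp add: \<Lambda>_def mult_ac)
        qed (use A(2) \<rho> r c G in auto)
        define E where "E = mass h1 (ball x (\<Lambda> * r))"
        define W where "W = mass h2 (ball x (\<Lambda> * r))"
        have EG: "E = ennreal G" using G Eh1 by (simp add: E_def)
        have "posc f (A x (2 * r)) (ball x r)
          \<le> ennreal (2 powr p) * (ennreal (CD ^ n1) * (ennreal (K * \<rho> powr p) * E
              + ennreal (D0 * \<rho> / 2 ^ n) * W) + ennreal (CD ^ (m + 3) * ((4 * CP * c * (2 * r)) powr p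
                * G)))"
          unfolding E_def W_def
        proof (rule self_improvement_step[where a = "\<lambda>z. A z (2 * \<rho>)"])
          have "\<Lambda> * \<rho> \<le> \<Lambda> * (r / 2)" using \<rho>(2) \<Lambda> by (intro mult_left_mono) auto
          moreover have "2 * r \<le> \<Lambda> * r" using \<Lambda> r by (intro mult_right_mono) auto
          ultimately show "r + \<Lambda> * \<rho> \<le> \<Lambda> * r" by linarith
          show "4 * r + \<rho> \<le> 2 ^ (m + 3) * \<rho>" using \<rho> r by (simp add: power_add)
        qed (use Suc.IH \<rho> r \<Lambda> n1 diff h f in auto)
        also have "\<dots> = ennreal (2 powr p * CD ^ n1 * (K * \<rho> powr p)) * E
            + ennreal (2 powr p * CD ^ n1 * (D0 * \<rho> / 2 ^ n)) * W
            + ennreal (2 powr p * (CD ^ (m + 3) * (4 * CP * c * (2 * r)) powr p)) * E"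
          unfolding EG using CD K D0 \<rho>(1) G by (intro ennreal_distrib_coefficients) auto
        also have "\<dots> \<le> ennreal (K / 2 * r powr p) * E + ennreal (D0 * r / 2 ^ Suc n) * W
            + ennreal (K / 2 * r powr p) * E"
        proof (intro add_mono mult_right_mono ennreal_leI)
          have B: "2 powr p * CD ^ n1 \<le> 2 ^ m / 2" using m by simp
          have "((2::real) ^ m) powr 1 \<le> (2 ^ m) powr p" using m p by (intro powr_mono) auto
          then have M: "(2::real) ^ m \<le> (2 ^ m) powr p" by simp
          have "2 powr p * CD ^ n1 * \<rho> powr p \<le> (2 ^ m) powr p / 2 * \<rho> powr p"
            using B M by (intro mult_right_mono) auto
          also have "\<dots> = r powr p / 2" using \<rho> by (simp flip: powr_mult)
          finally have "K * (2 powr p * CD ^ n1 * \<rho> powr p) \<le> K * (r powr p / 2)"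
            using K by (intro mult_left_mono) auto
          then show "2 powr p * CD ^ n1 * (K * \<rho> powr p) \<le> K / 2 * r powr p" by (simp add: mult_ac)
          have "2 powr p * CD ^ n1 * (D0 * \<rho> / 2 ^ n) \<le> 2 ^ m / 2 * (D0 * \<rho> / 2 ^ n)"
            using B D0 \<rho> by (intro mult_right_mono) auto
          also have "\<dots> = D0 * r / 2 ^ Suc n" using \<rho>(3) by (simp add: field_simps)
          finally show "2 powr p * CD ^ n1 * (D0 * \<rho> / 2 ^ n) \<le> D0 * r / 2 ^ Suc n" .
          show "2 powr p * (CD ^ (m + 3) * (4 * CP * c * (2 * r)) powr p) \<le> K / 2 * r powr p"
            using CP c r by (simp add: K_def powr_mult mult_ac)
        qed auto
        also have "\<dots> = ennreal (K * r powr p) * E + ennreal (D0 * r / 2 ^ Suc n) * W"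
          using K by (simp add: add_ac flip: distrib_right ennreal_plus)
        finally show ?thesis unfolding E_def W_def .
      qed
    qed
    define E where "E = enn2real (energy g (ball x (\<Lambda> * r)))"
    have E: "energy g (ball x (\<Lambda> * r)) = ennreal E" "E \<ge> 0" using Efin by (auto simp: E_def less_top)
    define W where "W = vol x (\<Lambda> * r) + E"
    have W: "mass h2 (ball x (\<Lambda> * r)) = ennreal W" "W \<ge> 0"
      using Wh2[of "\<Lambda> * r" x] E \<Lambda> r by (auto simp: W_def)
    have le: "posc f (A x (2 * r)) (ball x r) \<le> ennreal (K * r powr p * E + D0 * r * W / 2 ^ n)" for n
    proof -
      have "ennreal (K * r powr p) * ennreal E + ennreal (D0 * r / 2 ^ n) * ennreal W
          = ennreal (K * r powr p * E + D0 * r * W / 2 ^ n)"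
        using K D0 r E(2) W(2) by (simp flip: ennreal_mult ennreal_plus)
      then show ?thesis using P[OF r, of x n] unfolding Eh1[symmetric] E(1) W(1) by simp
    qed
    have "(\<lambda>n. K * r powr p * E + D0 * r * W / 2 ^ n) \<longlonglongrightarrow> K * r powr p * E + 0"
      by (intro tendsto_intros LIMSEQ_divide_realpow_zero) auto
    then have "(\<lambda>n. ennreal (K * r powr p * E + D0 * r * W / 2 ^ n)) \<longlonglongrightarrow> ennreal (K * r powr p * E)"
      by (intro tendsto_ennrealI) simp
    then have "posc f (A x (2 * r)) (ball x r) \<le> ennreal (K * r powr p * E)"
      by (rule LIMSEQ_le_const) (use le in auto)
    then show ?thesis using E K by (auto simp: ennreal_mult)
  qed
  show thesis by (rule that[OF K \<Lambda> main])
qed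

end

section \<open>Capacity and the boundary Poincare inequality\<close>

lemma cap_admissible_real:
  assumes "u \<in> cap_admissible M p E \<Omega>"
  obtains f where "u = (\<lambda>x. ereal (f x))" "f \<in> borel_measurable (completion M)"
    "\<And>x. 0 \<le> f x" "\<And>x. f x \<le> 1" "\<And>x. x \<notin> \<Omega> \<Longrightarrow> f x = 0" "\<And>x. x \<in> E \<Longrightarrow> f x = 1"
    "(\<integral>\<^sup>+x. ennreal (f x powr p) \<partial>completion M) < \<infinity>"
proof -
  define f where "f x = real_of_ereal (u x)" for x
  have u01: "0 \<le> u x" "u x \<le> 1" for x using assms by (auto simp: cap_admissible_def)
  have uf: "u x = ereal (f x)" for x
    using u01[of x] unfolding f_def by (cases "u x") auto
  have um: "u \<in> borel_measurable (completion M)" and norm: "newtonian_norm M p u < \<infinity>"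
    using assms by (auto simp: cap_admissible_def newtonian_def)
  have f0: "0 \<le> f x" "f x \<le> 1" for x using u01[of x] unfolding uf by (auto simp: one_ereal_def)
  have "(\<integral>\<^sup>+x. ennreal_pow (e2ennreal \<bar>u x\<bar>) p \<partial>completion M) < \<infinity>"
    using norm unfolding newtonian_norm_def ennreal_pow_def[of _ "1 / p"]
    by (auto split: if_splits simp: less_top)
  also have "(\<integral>\<^sup>+x. ennreal_pow (e2ennreal \<bar>u x\<bar>) p \<partial>completion M)
      = (\<integral>\<^sup>+x. ennreal (f x powr p) \<partial>completion M)"
    using f0 by (intro nn_integral_cong) (simp add: uf ennreal_pow_ennreal)
  finally have fin: "(\<integral>\<^sup>+x. ennreal (f x powr p) \<partial>completion M) < \<infinity>" .
  show thesis
  proof (rule that[of f])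
    show "u = (\<lambda>x. ereal (f x))" using uf by auto
    show "f \<in> borel_measurable (completion M)" unfolding f_def using um by measurable
    show "f x = 0" if "x \<notin> \<Omega>" for x using assms that uf[of x] by (auto simp: cap_admissible_def)
    show "f x = 1" if "x \<in> E" for x using assms that uf[of x]
        by (auto simp: cap_admissible_def one_ereal_def)
  qed (use f0 fin in auto)
qed

lemma le_rel_cap:
  assumes "\<And>f g. \<lbrakk>f \<in> borel_measurable (completion M); \<And>x. 0 \<le> f x; \<And>x. f x \<le> 1;
      \<And>x. x \<notin> \<Omega> \<Longrightarrow> f x = 0; \<And>x. x \<in> E \<Longrightarrow> f x = 1;
      (\<integral>\<^sup>+x. ennreal (f x powr p) \<partial>completion M) < \<infinity>; upper_gradient (\<lambda>x. ereal (f x)) g\<rbrakk>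
    \<Longrightarrow> c \<le> (\<integral>\<^sup>+x. ennreal_pow (g x) p \<partial>completion M)"
  shows "c \<le> rel_cap M p E \<Omega>"
  unfolding rel_cap_def
proof (intro INF_greatest)
  fix u g assume u: "u \<in> cap_admissible M p E \<Omega>" and g: "g \<in> {g. upper_gradient u g}"
  obtain f where f: "u = (\<lambda>x. ereal (f x))" "f \<in> borel_measurable (completion M)"
    "\<And>x. 0 \<le> f x" "\<And>x. f x \<le> 1" "\<And>x. x \<notin> \<Omega> \<Longrightarrow> f x = 0" "\<And>x. x \<in> E \<Longrightarrow> f x = 1"
    "(\<integral>\<^sup>+x. ennreal (f x powr p) \<partial>completion M) < \<infinity>"
    using cap_admissible_real[OF u] by blast
  show "c \<le> (\<integral>\<^sup>+x. ennreal_pow (g x) p \<partial>M)"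
    using assms[OF f(2-7), of g] g f(1) by (simp add: nn_integral_completion)
qed

lemma rel_cap_le:
  assumes "f \<in> borel_measurable (completion M)" "\<And>x. 0 \<le> f x" "\<And>x. f x \<le> 1"
    "\<And>x. x \<notin> \<Omega> \<Longrightarrow> f x = 0" "\<And>x. x \<in> E \<Longrightarrow> f x = 1"
    "(\<integral>\<^sup>+x. ennreal (f x powr p) \<partial>completion M) < \<infinity>" and ug: "upper_gradient (\<lambda>x. ereal (f x)) g"
    and p: "p > 0"
  shows "rel_cap M p E \<Omega> \<le> (\<integral>\<^sup>+x. ennreal_pow (g x) p \<partial>completion M)"
proof (cases "(\<integral>\<^sup>+x. ennreal_pow (g x) p \<partial>completion M) = \<infinity>")
  case False
  have "(INF g\<in>{g. upper_gradient (\<lambda>x. ereal (f x)) g}. \<integral>\<^sup>+x. ennreal_pow (g x) p \<partial>M)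
      \<le> (\<integral>\<^sup>+x. ennreal_pow (g x) p \<partial>completion M)"
    unfolding nn_integral_completion by (rule INF_lower) (use ug in simp)
  then have "(INF g\<in>{g. upper_gradient (\<lambda>x. ereal (f x)) g}. \<integral>\<^sup>+x. ennreal_pow (g x) p \<partial>M) < \<infinity>"
    by (rule le_less_trans) (use False in \<open>simp add: less_top\<close>)
  moreover have "(\<integral>\<^sup>+x. ennreal_pow (e2ennreal \<bar>ereal (f x)\<bar>) p \<partial>completion M)
      = (\<integral>\<^sup>+x. ennreal (f x powr p) \<partial>completion M)"
    using assms(2) by (intro nn_integral_cong) (simp add: ennreal_pow_ennreal)
  ultimately have "newtonian_norm M p (\<lambda>x. ereal (f x)) < \<infinity>"
    using assms(6) unfolding newtonian_norm_def ennreal_pow_def[of _ "1 / p"]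
    by (auto simp: less_top[symmetric])
  then have "(\<lambda>x. ereal (f x)) \<in> cap_admissible M p E \<Omega>"
    using assms(1-5) unfolding cap_admissible_def newtonian_def by (auto simp: one_ereal_def zero_ereal_def)
  then have "rel_cap M p E \<Omega> \<le> (INF g\<in>{g. upper_gradient (\<lambda>x. ereal (f x)) g}. \<integral>\<^sup>+x. ennreal_pow (g x) p
      \<partial>M)"
    unfolding rel_cap_def by (rule INF_lower)
  also have "\<dots> \<le> (\<integral>\<^sup>+x. ennreal_pow (g x) p \<partial>completion M)"
    unfolding nn_integral_completion by (rule INF_lower) (use ug in simp)
  finally show ?thesis .
qed simp

context doubling_space
begin

text \<open>
  The majorant is infinite on a Borel null set that contains all points where \<open>f\<close> differs from a Borel
  function. It bounds \<open>f\<close> everywhere, hence along every curve, and still has the same integrals.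
\<close>

lemma borel_majorant:
  assumes "f \<in> borel_measurable \<mu>" "\<And>x. 0 \<le> f x"
  obtains U :: "'a \<Rightarrow> ennreal" where "U \<in> borel_measurable borel" "\<And>x. ennreal (f x) \<le> U x"
    "AE x in \<mu>. U x = ennreal (f x)"
proof -
  obtain f' where f': "f' \<in> borel_measurable M" "AE x in M. f x = f' x"
    using completion_ex_borel_measurable_real[OF assms(1)] by blast
  obtain N where N: "N \<in> null_sets M" "{x \<in> space M. f x \<noteq> f' x} \<subseteq> N"
    using f'(2) by (rule AE_E) (auto simp: null_sets_def)
  define U where "U x = (if x \<in> N then \<infinity> else ennreal (f' x))" for x
  have Nb: "N \<in> sets borel" using N sets_M by (auto simp: null_sets_def)
  have f'b: "f' \<in> borel_measurable borel" using f'(1) measurable_cong_sets[OF sets_M refl] by blast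
  show thesis
  proof (rule that[of U])
    show "U \<in> borel_measurable borel" unfolding U_def using Nb f'b by measurable
    have "f x = f' x" if "x \<notin> N" for x using N(2) that unfolding space_M by blast
    then show "ennreal (f x) \<le> U x" for x by (simp add: U_def)
    have "AE x in M. x \<notin> N" by (rule AE_not_in[OF N(1)])
    then have "AE x in M. U x = ennreal (f x)"
      using f'(2) by eventually_elim (simp add: U_def)
    then show "AE x in \<mu>. U x = ennreal (f x)" by (rule AE_completion)
  qed
qed

end

context poincare_space
begin

lemma energy_add_le:
  assumes [measurable]: "h1 \<in> borel_measurable \<mu>" "h2 \<in> borel_measurable \<mu>" "A \<in> sets \<mu>"
  shows "energy (\<lambda>x. h1 x + h2 x) A \<le> ennreal (2 powr p) * (energy h1 A + energy h2 A)"
proof -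
  have "energy (\<lambda>x. h1 x + h2 x) A
    \<le> (\<integral>\<^sup>+x. ennreal (2 powr p) * (ennreal_pow (h1 x) p * indicator A x + ennreal_pow (h2 x) p
      * indicator A x) \<partial>\<mu>)"
    unfolding energy_def
  proof (rule nn_integral_mono)
    fix x
    show "ennreal_pow (h1 x + h2 x) p * indicator A x
      \<le> ennreal (2 powr p) * (ennreal_pow (h1 x) p * indicator A x + ennreal_pow (h2 x) p * indicator A x)"
      using ennreal_pow_add_le[of p "h1 x" "h2 x"] p by (cases "x \<in> A") auto
  qed
  also have "\<dots> = ennreal (2 powr p) * (\<integral>\<^sup>+x. ennreal_pow (h1 x) p * indicator A x + ennreal_pow (h2 x) p
      * indicator A x \<partial>\<mu>)"
    by (rule nn_integral_cmult) measurable
  also have "(\<integral>\<^sup>+x. ennreal_pow (h1 x) p * indicator A x + ennreal_pow (h2 x) p * indicator A x \<partial>\<mu>)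
      = energy h1 A + energy h2 A"
    unfolding energy_def by (rule nn_integral_add) measurable
  finally show ?thesis .
qed

lemma energy_cmult:
  assumes [measurable]: "h \<in> borel_measurable \<mu>" "A \<in> sets \<mu>" and "c \<ge> 0"
  shows "energy (\<lambda>x. ennreal c * h x) A = ennreal (c powr p) * energy h A"
proof -
  have "energy (\<lambda>x. ennreal c * h x) A = (\<integral>\<^sup>+x. ennreal (c powr p) * (ennreal_pow (h x) p
      * indicator A x) \<partial>\<mu>)"
    unfolding energy_def using p assms(3) by (intro nn_integral_cong) (simp add: ennreal_pow_cmult
        mult.assoc)
  also have "\<dots> = ennreal (c powr p) * energy h A"
    unfolding energy_def by (rule nn_integral_cmult) measurable
  finally show ?thesis .
qed

lemma rel_cap_cutoff_le:
  assumes f[measurable]: "f \<in> borel_measurable \<mu>" and f01: "\<And>y. 0 \<le> f y" "\<And>y. f y \<le> 1"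
    and ug: "upper_gradient (\<lambda>y. ereal (f y)) g" and \<rho>: "\<rho> > 0"
    and S: "S \<subseteq> ball x \<rho>" "\<And>y. y \<in> S \<Longrightarrow> f y = 1" and \<Omega>: "ball x (2 * \<rho>) \<subseteq> \<Omega>"
  shows "rel_cap M p S \<Omega> \<le> ennreal (2 powr p) * (ennreal (2 powr p) * energy g (ball x (3 * \<rho>))
      + ennreal (\<rho> powr (- p)) * pmass f (ball x (3 * \<rho>)))"
proof -
  obtain U :: "'a \<Rightarrow> ennreal" where U: "U \<in> borel_measurable borel" "\<And>y. ennreal (f y)
      \<le> U y" "AE y in \<mu>. U y = ennreal (f y)"
    using borel_majorant[OF f f01(1)] by blast
  define B where "B = ball x (3 * \<rho>)"
  define h where "h y = ennreal (2 * indicator B y) * g y + ennreal (indicator B y / \<rho>) * U y" for y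
  have [measurable]: "g \<in> borel_measurable \<mu>" "U \<in> borel_measurable \<mu>" "B \<in> sets \<mu>"
    using upper_gradient_measurable[OF ug] borel_fun_\<mu>[OF U(1)] by (auto simp: B_def)
  have "rel_cap M p S \<Omega> \<le> (\<integral>\<^sup>+y. ennreal_pow (h y) p \<partial>\<mu>)"
  proof (rule rel_cap_le[where f = "\<lambda>y. f y * cutoff x \<rho> y"])
    have [measurable]: "cutoff x \<rho> \<in> borel_measurable \<mu>"
      by (intro borel_fun_\<mu> borel_measurable_continuous_onI continuous_on_cutoff \<rho>)
    show "(\<lambda>y. f y * cutoff x \<rho> y) \<in> borel_measurable \<mu>" by measurable
    show "0 \<le> f y * cutoff x \<rho> y" "f y * cutoff x \<rho> y \<le> 1" for y
      using f01[of y] by (auto intro!: mult_le_one)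
    show "f y * cutoff x \<rho> y = 0" if "y \<notin> \<Omega>" for y
    proof -
      have "y \<notin> ball x (2 * \<rho>)" using that \<Omega> by blast
      from cutoff_eq_0[OF \<rho> this] show ?thesis by simp
    qed
    show "f y * cutoff x \<rho> y = 1" if "y \<in> S" for y
      using that S cutoff_eq_1[OF \<rho>, of y x] by (metis mult_1_right subsetD)
    show "upper_gradient (\<lambda>y. ereal (f y * cutoff x \<rho> y)) h"
      unfolding h_def B_def by (rule upper_gradient_mult_cutoff[OF ug U(1,2) f01(1) \<rho>])
    have "(\<integral>\<^sup>+y. ennreal ((f y * cutoff x \<rho> y) powr p) \<partial>\<mu>) \<le> (\<integral>\<^sup>+y. indicator (ball x (2 * \<rho>)) y \<partial>\<mu>)"
    proof (rule nn_integral_mono)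
      fix y
      have "(f y * cutoff x \<rho> y) powr p \<le> 1 powr p"
        using f01[of y] p by (intro powr_mono2 mult_le_one) auto
      then show "ennreal ((f y * cutoff x \<rho> y) powr p) \<le> indicator (ball x (2 * \<rho>)) y"
        using cutoff_eq_0[OF \<rho>, of y x] by (cases "y \<in> ball x (2 * \<rho>)") (auto simp: ennreal_le_1)
    qed
    also have "\<dots> < \<infinity>" using \<rho> emeasure_ball[of "2 * \<rho>" x] by (simp del: emeasure_completion)
    finally show "(\<integral>\<^sup>+y. ennreal ((f y * cutoff x \<rho> y) powr p) \<partial>\<mu>) < \<infinity>" .
  qed (use p in auto)
  also have "\<dots> = energy (\<lambda>y. ennreal 2 * g y + ennreal (1 / \<rho>) * U y) B"
    unfolding energy_def h_def by (intro nn_integral_cong) (auto simp: indicator_def ennreal_pow_def)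
  also have "\<dots> \<le> ennreal (2 powr p) * (energy (\<lambda>y. ennreal 2 * g y) B + energy (\<lambda>y. ennreal (1 / \<rho>)
      * U y) B)"
    by (rule energy_add_le) measurable
  also have "energy (\<lambda>y. ennreal 2 * g y) B = ennreal (2 powr p) * energy g B"
    by (rule energy_cmult) auto
  also have "energy (\<lambda>y. ennreal (1 / \<rho>) * U y) B = ennreal (\<rho> powr (- p)) * energy U B"
    using \<rho> by (subst energy_cmult) (auto simp: powr_minus_divide powr_divide)
  also have "energy U B = pmass f B"
    unfolding energy_def using U(3)
    by (intro nn_integral_cong_AE) (auto simp: ennreal_pow_ennreal f01 elim!: eventually_mono)
  finally show ?thesis unfolding B_def .
qed

lemma energy_UNIV: "energy g UNIV = (\<integral>\<^sup>+x. ennreal_pow (g x) p \<partial>\<mu>)"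
  by (simp add: energy_def)

lemma nn_integral_const_ball:
  "r > 0 \<Longrightarrow> c \<ge> 0 \<Longrightarrow> (\<integral>\<^sup>+y\<in>ball x r. ennreal c \<partial>\<mu>) = ennreal (c * vol x r)"
  by (simp add: nn_integral_cmult_indicator emeasure_ball ennreal_mult del: emeasure_completion)

text \<open>
  A test function equals \<open>1\<close> on \<open>ball w r\<close> and \<open>0\<close> on \<open>ball x r\<close>, and any constant \<open>a\<close> is at distance
  at least \<open>1 / 2\<close> from one of these values. So it oscillates on \<open>ball w (16 * r)\<close>, which contains both
  balls. The point \<open>x\<close> is needed: if \<open>ball w (2 * r)\<close> were the whole space, the capacity would vanish.
\<close>

lemma rel_cap_ball_ge:
  assumes K: "K > 0" and pp: "\<And>f g F x r. \<lbrakk>f \<in> borel_measurable \<mu>; upper_gradient (\<lambda>y. ereal (f y)) g;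
      \<And>y. \<bar>f y\<bar> \<le> F; r > 0\<rbrakk> \<Longrightarrow>
      \<exists>a. posc f a (ball x r) \<le> ennreal (K * r powr p) * energy g (ball x (\<Lambda> * r))"
    and r: "r > 0" and x: "4 * r \<le> dist x w" "dist x w \<le> 8 * r"
  shows "ennreal (vol w (16 * r) / (2 powr p * CD ^ 5 * K * (16 * r) powr p))
      \<le> rel_cap M p (ball w r) (ball w (2 * r))"
proof (rule le_rel_cap)
  fix f g
  assume f[measurable]: "f \<in> borel_measurable \<mu>" and f01: "\<And>x. 0 \<le> f x" "\<And>x. f x \<le> 1"
    and f0: "\<And>x. x \<notin> ball w (2 * r) \<Longrightarrow> f x = 0" and f1: "\<And>x. x \<in> ball w r \<Longrightarrow> f x = 1"
    and ug: "upper_gradient (\<lambda>x. ereal (f x)) g"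
  define V where "V = vol w (16 * r)"
  have "\<bar>f y\<bar> \<le> 1" for y using f01[of y] by simp
  then obtain a where a: "posc f a (ball w (16 * r))
      \<le> ennreal (K * (16 * r) powr p) * energy g (ball w (\<Lambda> * (16 * r)))"
    using pp[OF f ug, of 1 "16 * r" w] r by auto
  have half: "ennreal ((1 / 2) powr p * (V / CD ^ 5)) \<le> posc f a (ball w (16 * r))"
    if z: "ball z r \<subseteq> ball w (16 * r)" "dist z w \<le> 8 * r"
        and c: "\<And>y. y \<in> ball z r \<Longrightarrow> 1 / 2 \<le> \<bar>f y - a\<bar>" for z
  proof -
    have "V \<le> CD ^ 5 * vol z r" unfolding V_def using z r by (intro vol_compare) auto
    then have "V / CD ^ 5 \<le> vol z r" using CD by (simp add: field_simps)
    then have "ennreal ((1 / 2) powr p * (V / CD ^ 5)) \<le> ennreal ((1 / 2) powr p * vol z r)"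
      by (intro ennreal_leI mult_left_mono) auto
    also have "\<dots> = (\<integral>\<^sup>+y\<in>ball z r. ennreal ((1 / 2) powr p) \<partial>\<mu>)"
      using r by (simp only: nn_integral_const_ball powr_ge_zero)
    also have "\<dots> \<le> posc f a (ball w (16 * r))"
    proof (rule nn_integral_mono)
      fix y
      have "y \<in> ball z r \<Longrightarrow> (1 / 2) powr p \<le> \<bar>f y - a\<bar> powr p" using c[of y] p by (intro powr_mono2) auto
      then show "ennreal ((1 / 2) powr p) * indicator (ball z r) y
          \<le> ennreal (\<bar>f y - a\<bar> powr p) * indicator (ball w (16 * r)) y"
        using z(1) by (cases "y \<in> ball z r") (auto simp: subset_iff intro: ennreal_leI)
    qed
    finally show ?thesis .
  qed
  have "ennreal ((1 / 2) powr p * (V / CD ^ 5)) \<le> posc f a (ball w (16 * r))"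
  proof (cases "a \<le> 1 / 2")
    case True
    then show ?thesis using r f1 by (intro half[of w]) (auto simp: abs_if)
  next
    case False
    have "y \<notin> ball w (2 * r)" if "y \<in> ball x r" for y
      using that x dist_triangle[of x w y] r by (auto simp: dist_commute)
    then show ?thesis using r f0 False x by (intro half[of x] ball_subset) (auto simp: abs_if dist_commute)
  qed
  also note a
  also have "ennreal (K * (16 * r) powr p) * energy g (ball w (\<Lambda> * (16 * r)))
      \<le> ennreal (K * (16 * r) powr p) * energy g UNIV"
    by (intro mult_left_mono energy_mono) auto
  finally have main: "ennreal ((1 / 2) powr p * (V / CD ^ 5))
      \<le> ennreal (K * (16 * r) powr p) * energy g UNIV" .
  show "ennreal (V / (2 powr p * CD ^ 5 * K * (16 * r) powr p)) \<le> (\<integral>\<^sup>+x. ennreal_pow (g x) p \<partial>\<mu>)"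
    unfolding energy_UNIV[symmetric]
  proof (cases "energy g UNIV")
    case (real e)
    have "(1 / 2) powr p * (V / CD ^ 5) \<le> K * (16 * r) powr p * e"
      using main real K by (simp add: ennreal_le_iff flip: ennreal_mult)
    then have "V / (2 powr p * CD ^ 5 * K * (16 * r) powr p) \<le> e"
      using CD K r by (simp add: powr_divide field_simps)
    then show "ennreal (V / (2 powr p * CD ^ 5 * K * (16 * r) powr p)) \<le> energy g UNIV"
      using real by (simp add: ennreal_leI)
  qed simp
qed

text \<open>
  A Poincare inequality without a subtracted constant, for functions that vanish on \<open>S\<close>.
\<close>

definition boundary_poincare :: "'a set \<Rightarrow> real \<Rightarrow> real \<Rightarrow> bool" where
  "boundary_poincare S K \<Lambda> \<longleftrightarrow> (\<forall>f g F x. f \<in> borel_measurable \<mu> \<and> upper_gradient (\<lambda>y. ereal (f y)) g \<and>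
      (\<forall>y. 0 \<le> f y \<and> f y \<le> F) \<and> (\<forall>y\<in>S. f y = 0) \<and> x \<notin> S \<longrightarrow>
      pmass f (ball x (infdist x S / 2))
        \<le> ennreal (K * infdist x S powr p) * energy g (ball x (\<Lambda> * infdist x S)))"

text \<open>
  With \<open>w \<in> S\<close> less than twice as far from \<open>x\<close> as \<open>S\<close> is, and \<open>4 * r = infdist x S\<close>,
  the ball \<open>ball w (16 * r)\<close> contains \<open>ball x (2 * r)\<close>. Let \<open>a\<close> be its Poincare constant. If \<open>a
      \<le> 0\<close>, then \<open>f \<le> \<bar>f - a\<bar>\<close> and the Poincare
  inequality suffices. Otherwise \<open>(1 - f / a)\<^sub>+\<close> is \<open>1\<close> on \<open>S\<close> and at most \<open>\<bar>f - a\<bar> / a\<close>, so a cutoff of it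
  shows that the capacity of \<open>S \<inter> ball w r\<close> is at most \<open>C a\<^sup>-\<^sup>p\<close> times the energy of \<open>f\<close>. Fatness bounds
  the same capacity from below, which yields the required bound for \<open>a\<close>.
\<close>

lemma boundary_poincare_of_fat:
  assumes S: "closed S" "S \<noteq> {}" and Cf: "Cf > 0"
    and fat: "\<And>w r. \<lbrakk>w \<in> S; r > 0\<rbrakk> \<Longrightarrow>
      ennreal Cf * rel_cap M p (ball w r) (ball w (2 * r)) \<le> rel_cap M p (S \<inter> ball w r) (ball w (2 * r))"
  obtains K \<Lambda> where "K > 0" "\<Lambda> \<ge> 1" "boundary_poincare S K \<Lambda>"
proof -
  obtain K \<Lambda> where K: "K > 0" and \<Lambda>: "\<Lambda> \<ge> 2"
    and pp: "\<And>f g F x r. \<lbrakk>f \<in> borel_measurable \<mu>; upper_gradient (\<lambda>y. ereal (f y)) g; \<And>y. \<bar>f y\<bar> \<le> F;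
        r > 0\<rbrakk> \<Longrightarrow>
      \<exists>a. posc f a (ball x r) \<le> ennreal (K * r powr p) * energy g (ball x (\<Lambda> * r))"
    using poincare_equal_exponents by blast
  define C1 where "C1 = 2 powr p * (2 powr p + K * 16 powr p)"
  define C2 where "C2 = C1 * (2 powr p * CD ^ 5 * K * 16 powr p) / Cf"
  define K' where "K' = 2 powr p * (K * 16 powr p + C2)"
  have C: "C1 > 0" "C2 > 0" "K' > 0"
    unfolding C1_def C2_def K'_def using K CD Cf by (auto intro!: add_pos_pos mult_pos_pos divide_pos_pos)
  have main: "pmass f (ball x (infdist x S / 2))
        \<le> ennreal (K' * infdist x S powr p) * energy g (ball x ((4 * \<Lambda> + 2) * infdist x S))"
    if f[measurable]: "f \<in> borel_measurable \<mu>" and ug: "upper_gradient (\<lambda>y. ereal (f y)) g"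
      and f0: "\<And>y. 0 \<le> f y" and F: "\<And>y. f y \<le> F" and fS: "\<And>y. y \<in> S \<Longrightarrow> f y = 0" and xS: "x \<notin> S" for f g F x
  proof -
    define D where "D = infdist x S"
    have D: "D > 0" unfolding D_def using S xS by (simp add: infdist_pos_not_in_closed)
    define r where "r = D / 4"
    have r: "r > 0" "D = 4 * r" using D by (auto simp: r_def)
    have "\<exists>w\<in>S. dist x w < 2 * D"
    proof (rule ccontr)
      assume "\<not> ?thesis"
      then have "2 * D \<le> infdist x S" unfolding infdist_def using S by (auto intro!: cINF_greatest)
      then show False using D by (simp add: D_def)
    qed
    then obtain w where w: "w \<in> S" "dist x w < 8 * r" using r by auto
    have xw: "4 * r \<le> dist x w" using infdist_le[OF w(1), of x] r unfolding D_def by simp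
    define B where "B = ball w (16 * r)"
    define e' where "e' = energy g (ball w (\<Lambda> * (16 * r)))"
    have sub1: "ball x (D / 2) \<subseteq> B" unfolding B_def using w r
        by (intro ball_subset) (auto simp: dist_commute)
    have sub2: "ball w (\<Lambda> * (16 * r)) \<subseteq> ball x ((4 * \<Lambda> + 2) * D)"
      using w r by (intro ball_subset) (auto simp: algebra_simps)
    have "\<bar>f y\<bar> \<le> F" for y using f0[of y] F[of y] by simp
    then obtain a where a: "posc f a B \<le> ennreal (K * (16 * r) powr p) * e'"
      using pp[OF f ug, of F "16 * r" w] r unfolding B_def e'_def by auto
    have "pmass f B \<le> ennreal (K' * r powr p) * e'"
    proof (cases "e' = \<infinity>")
      case True
      then show ?thesis using C r by (simp add: ennreal_mult_top)
    next
      case False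
      define e where "e = enn2real e'"
      have e: "e' = ennreal e" "e \<ge> 0" using False by (auto simp: e_def less_top)
      have osc: "posc f a B \<le> ennreal (K * (16 * r) powr p * e)"
        using a e K by (simp add: ennreal_mult)
      show ?thesis
      proof (cases "a \<le> 0")
        case True
        have "pmass f B \<le> posc f a B"
          using True f0 p by (intro nn_integral_mono mult_right_mono ennreal_leI powr_mono2) (auto simp:
              abs_if)
        also note osc
        also have "ennreal (K * (16 * r) powr p * e) \<le> ennreal (K' * r powr p * e)"
        proof (intro ennreal_leI mult_right_mono)
          have "K * 16 powr p * 1 \<le> (K * 16 powr p + C2) * 2 powr p"
            using K C p by (intro mult_mono) (auto simp: ge_one_powr_ge_zero)
          then have "K * 16 powr p * r powr p \<le> K' * r powr p"
            unfolding K'_def by (intro mult_right_mono) (auto simp: mult.commute)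
          then show "K * (16 * r) powr p \<le> K' * r powr p" using r by (simp add: powr_mult mult.assoc)
        qed (use e in auto)
        finally show ?thesis using e C r by (simp add: ennreal_mult)
      next
        case False
        then have apos: "a > 0" by simp
        define f1 where "f1 y = max 0 (1 - 1 / a * f y)" for y
        have [measurable]: "f1 \<in> borel_measurable \<mu>" unfolding f1_def by measurable
        have [measurable]: "g \<in> borel_measurable \<mu>" by (rule upper_gradient_measurable[OF ug])
        have ug1: "upper_gradient (\<lambda>y. ereal (f1 y)) (\<lambda>y. ennreal (1 / a) * g y)"
          unfolding f1_def
        proof (rule upper_gradient_lipschitz_compose[OF ug, of "1 / a" "\<lambda>t. max 0 (1 - 1 / a * t)"])
          fix x y
          have "\<bar>max 0 (1 - 1 / a * f x) - max 0 (1 - 1 / a * f y)\<bar> \<le> \<bar>1 / a * f x - 1 / a * f y\<bar>"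
            by (auto simp: max_def)
          also have "\<dots> = 1 / a * \<bar>f x - f y\<bar>"
            using apos by (simp add: abs_mult flip: right_diff_distrib diff_divide_distrib)
          finally show "\<bar>max 0 (1 - 1 / a * f x) - max 0 (1 - 1 / a * f y)\<bar> \<le> 1 / a * \<bar>f x - f y\<bar>" .
        qed (use apos in auto)
        have f1le: "f1 y powr p \<le> a powr (- p) * \<bar>f y - a\<bar> powr p" for y
        proof -
          have "f1 y \<le> \<bar>f y - a\<bar> / a" using apos unfolding f1_def by (auto simp: field_simps abs_if)
          then have "f1 y powr p \<le> (\<bar>f y - a\<bar> / a) powr p" using p by (intro powr_mono2) (auto simp: f1_def)
          also have "\<dots> = a powr (- p) * \<bar>f y - a\<bar> powr p" using apos
              by (simp add: powr_divide powr_minus_divide)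
          finally show ?thesis .
        qed
        \<comment> \<open>Compare the lower bound \<open>cl\<close> for the capacity of the ball with the test function \<open>f1\<close>.\<close>
        define V where "V = vol w (16 * r)"
        define cl where "cl = V / (2 powr p * CD ^ 5 * K * (16 * r) powr p)"
        have cl: "cl > 0" unfolding cl_def V_def using r K CD vol_pos[of "16 * r" w] by simp
        have "ennreal Cf * ennreal cl \<le> ennreal Cf * rel_cap M p (ball w r) (ball w (2 * r))"
          unfolding cl_def V_def
          by (intro mult_left_mono rel_cap_ball_ge[OF K pp]) (use r w xw in auto)
        also have "\<dots> \<le> rel_cap M p (S \<inter> ball w r) (ball w (2 * r))" by (rule fat[OF w(1) r(1)])
        also have "\<dots> \<le> ennreal (2 powr p) * (ennreal (2 powr p) * energy (\<lambda>y. ennreal (1 / a)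
            * g y) (ball w (3 * r))
            + ennreal (r powr (- p)) * pmass f1 (ball w (3 * r)))"
          by (rule rel_cap_cutoff_le) (use ug1 fS r apos f0 in \<open>auto simp: f1_def\<close>)
        also have "\<dots> \<le> ennreal (2 powr p) * (ennreal (2 powr p) * ennreal (a powr (- p) * e)
            + ennreal (r powr (- p)) * ennreal (a powr (- p) * (K * (16 * r) powr p * e)))"
        proof (intro mult_left_mono add_mono)
          have "16 * r \<ge> 3 * r" using r by simp
          moreover have "2 * (16 * r) \<le> \<Lambda> * (16 * r)" using \<Lambda> r by (intro mult_right_mono) auto
          ultimately have s: "ball w (3 * r) \<subseteq> ball w (\<Lambda> * (16 * r))" using r by (intro subset_ball) auto
          have "energy (\<lambda>y. ennreal (1 / a) * g y) (ball w (3 * r))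
              = ennreal ((1 / a) powr p) * energy g (ball w (3 * r))"
            by (rule energy_cmult) (use apos in auto)
          also have "\<dots> \<le> ennreal ((1 / a) powr p) * e'"
            unfolding e'_def by (intro mult_left_mono energy_mono s) auto
          also have "\<dots> = ennreal (a powr (- p) * e)"
            using apos e by (simp add: powr_divide powr_minus_divide flip: ennreal_mult)
          finally show "energy (\<lambda>y. ennreal (1 / a) * g y) (ball w (3 * r)) \<le> ennreal (a powr (- p) * e)" .
          have "pmass f1 (ball w (3 * r))
              \<le> (\<integral>\<^sup>+y. ennreal (a powr (- p)) * (ennreal (\<bar>f y - a\<bar> powr p) * indicator B y) \<partial>\<mu>)"
          proof (rule nn_integral_mono)
            fix y
            have "ennreal (f1 y powr p) \<le> ennreal (a powr (- p)) * ennreal (\<bar>f y - a\<bar> powr p)"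
              using f1le[of y] by (simp flip: ennreal_mult)
            then show "ennreal (f1 y powr p) * indicator (ball w (3 * r)) y
                \<le> ennreal (a powr (- p)) * (ennreal (\<bar>f y - a\<bar> powr p) * indicator B y)"
              using r by (cases "y \<in> ball w (3 * r)") (auto simp: B_def)
          qed
          also have "\<dots> = ennreal (a powr (- p)) * posc f a B"
            unfolding B_def by (rule nn_integral_cmult) measurable
          also have "\<dots> \<le> ennreal (a powr (- p)) * ennreal (K * (16 * r) powr p * e)"
            by (intro mult_left_mono osc) auto
          finally show "pmass f1 (ball w (3 * r)) \<le> ennreal (a powr (- p) * (K * (16 * r) powr p * e))"
            using K e by (simp add: ennreal_mult)
        qed auto
        also have "\<dots> = ennreal (2 powr p * (2 powr p * (a powr (- p) * e) + r powr (- p) * (a powr (- p)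
            * (K * (16 * r) powr p * e))))"
          using K e by (simp flip: ennreal_mult ennreal_plus)
        finally have "Cf * cl \<le> 2 powr p * (2 powr p * (a powr (- p) * e) + r powr (- p) * (a powr (- p)
            * (K * (16 * r) powr p * e)))"
          using Cf cl K e by (simp add: ennreal_le_iff flip: ennreal_mult)
        also have "\<dots> = C1 * a powr (- p) * e"
        proof -
          have "r powr (- p) * (16 * r) powr p = 16 powr p" using r by (simp add: powr_mult powr_minus)
          moreover have "r powr (- p) * (a powr (- p) * (K * (16 * r) powr p * e))
              = K * (r powr (- p) * (16 * r) powr p) * (a powr (- p) * e)"
            by (simp only: mult_ac)
          ultimately show ?thesis unfolding C1_def by (simp only: distrib_left distrib_right mult_ac)
        qed
        finally have "Cf * cl * a powr p \<le> C1 * a powr (- p) * e * a powr p"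
          by (intro mult_right_mono) auto
        also have "\<dots> = C1 * e" using apos by (simp add: powr_minus)
        finally have "a powr p * V \<le> C2 * r powr p * e"
          unfolding cl_def C2_def using r Cf K CD by (simp add: powr_mult field_simps)
        then have bd: "\<bar>a - 0\<bar> powr p * vol w (16 * r) \<le> C2 * r powr p * e" using apos by (simp add: V_def)
        have "posc f 0 B
            \<le> ennreal (2 powr p) * (posc f a B + ennreal (\<bar>a - 0\<bar> powr p * vol w (16 * r)))"
          unfolding B_def by (rule nn_integral_powr_add_le[OF f]) (use r in auto)
        also have "\<dots> \<le> ennreal (2 powr p) * (ennreal (K * (16 * r) powr p * e) + ennreal (C2 * r powr p
            * e))"
          by (intro mult_left_mono add_mono osc ennreal_leI bd) auto
        also have "\<dots> = ennreal (2 powr p * (K * (16 * r) powr p * e + C2 * r powr p * e))"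
          using K e C by (simp flip: ennreal_mult ennreal_plus)
        also have "2 powr p * (K * (16 * r) powr p * e + C2 * r powr p * e) = K' * r powr p * e"
          unfolding K'_def using r by (simp add: powr_mult algebra_simps)
        finally show ?thesis using f0 e C by (simp add: ennreal_mult)
      qed
    qed
    moreover have "pmass f (ball x (D / 2)) \<le> pmass f B"
      using sub1 by (intro nn_integral_mono) (auto simp: indicator_def)
    moreover have "ennreal (K' * r powr p) * e'
        \<le> ennreal (K' * D powr p) * energy g (ball x ((4 * \<Lambda> + 2) * D))"
      unfolding e'_def using r C p
      by (intro mult_mono ennreal_leI energy_mono sub2) (auto intro!: mult_left_mono powr_mono2)
    ultimately show ?thesis unfolding D_def[symmetric] by (meson order_trans)
  qed
  have "boundary_poincare S K' (4 * \<Lambda> + 2)"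
    unfolding boundary_poincare_def
  proof (intro allI impI, elim conjE)
    fix f g F x
    assume "f \<in> borel_measurable \<mu>" "upper_gradient (\<lambda>y. ereal (f y)) g"
      and "\<forall>y. 0 \<le> f y \<and> f y \<le> F" "\<forall>y\<in>S. f y = 0" "x \<notin> S"
    then show "pmass f (ball x (infdist x S / 2))
        \<le> ennreal (K' * infdist x S powr p) * energy g (ball x ((4 * \<Lambda> + 2) * infdist x S))"
      by (intro main[of f g F x]) auto
  qed
  then show thesis by (rule that[OF C(3), rotated]) (use \<Lambda> in simp)
qed

end

section \<open>The Hardy inequality over a Whitney family\<close>

text \<open>
  The Whitney cover of the complement of \<open>S\<close>: the index set \<open>J\<close> leaves out the empty members, and
  the bound on the overlap is stated as a count of indices, so that repeated members are counted
  repeatedly.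
\<close>

locale whitney_family = poincare_space M CD p CP L
  for M :: "'a::metric_space measure" and CD p CP L :: real +
  fixes S :: "'a set" and J :: "nat set" and ctr :: "nat \<Rightarrow> 'a" and c NW :: real
  assumes S: "closed S" "S \<noteq> {}" and c: "0 < c" "c \<le> 1 / 8"
    and ctr: "i \<in> J \<Longrightarrow> ctr i \<notin> S"
    and cover: "x \<notin> S \<Longrightarrow> \<exists>i\<in>J. x \<in> ball (ctr i) (c * infdist (ctr i) S)"
    and overlap: "\<lbrakk>finite F; F \<subseteq> J\<rbrakk> \<Longrightarrow>
      real (card {i \<in> F. y \<in> ball (ctr i) (c * infdist (ctr i) S)}) \<le> NW"
begin

abbreviation d :: "'a \<Rightarrow> real" where "d x \<equiv> infdist x S"
abbreviation rad :: "nat \<Rightarrow> real" where "rad i \<equiv> infdist (ctr i) S"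
abbreviation tent :: "nat \<Rightarrow> 'a set" where "tent i \<equiv> ball (ctr i) (rad i / 2)"

text \<open>
  The Whitney balls enlarged by a large factor \<open>\<Lambda>\<close> overlap boundedly only within each dyadic range of
  radii: a point near \<open>S\<close> lies in enlarged balls of all larger radii.
\<close>

definition scale_packing :: "real \<Rightarrow> real \<Rightarrow> bool" where
  "scale_packing \<Lambda> N \<longleftrightarrow> (\<forall>F x s. finite F \<and> F \<subseteq> J \<and> s > 0 \<and>
      (\<forall>i\<in>F. s \<le> rad i \<and> rad i < 2 * s \<and> x \<in> ball (ctr i) (\<Lambda> * rad i)) \<longrightarrow> real (card F) \<le> N)"

lemma scale_packingD:
  "\<lbrakk>scale_packing \<Lambda> N; finite F; F \<subseteq> J; s > 0;
    \<And>i. i \<in> F \<Longrightarrow> s \<le> rad i \<and> rad i < 2 * s \<and> x \<in> ball (ctr i) (\<Lambda> * rad i)\<rbrakk> \<Longrightarrow> real (card F) \<le> N"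
  unfolding scale_packing_def by blast

lemma scale_packing_nonneg: "scale_packing \<Lambda> N \<Longrightarrow> 0 \<le> N"
  using scale_packingD[of \<Lambda> N "{}" 1 undefined] by simp

lemma rad_pos: "i \<in> J \<Longrightarrow> rad i > 0"
  using infdist_pos_not_in_closed[OF S ctr] by simp

lemma d_lipschitz: "\<bar>d x - d y\<bar> \<le> dist x y"
  by (rule infdist_triangle_abs)

lemma NW: "NW \<ge> 0"
  using overlap[of "{}" undefined] by simp

lemma card_scale:
  assumes "\<Lambda> \<ge> 1"
  obtains N where "N \<ge> 1" "scale_packing \<Lambda> N"
proof -
  obtain n where n: "(4 * \<Lambda> + 2) / c \<le> 2 ^ n"
    using real_arch_pow[of 2 "(4 * \<Lambda> + 2) / c"] by (auto intro: less_imp_le)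
  then have n: "4 * \<Lambda> + 2 \<le> 2 ^ n * c" using c by (simp add: field_simps)
  show thesis
  proof (rule that[of "NW * CD ^ n + 1"])
    show "NW * CD ^ n + 1 \<ge> 1" using NW CD by simp
    show "scale_packing \<Lambda> (NW * CD ^ n + 1)"
      unfolding scale_packing_def
    proof (intro allI impI, elim conjE)
      fix F x s
      assume F: "finite F" "F \<subseteq> J" "s > 0" and "\<forall>i\<in>F. s \<le> rad i \<and> rad i < 2 * s
          \<and> x \<in> ball (ctr i) (\<Lambda> * rad i)"
      then have *: "\<And>i. i \<in> F \<Longrightarrow> s \<le> rad i \<and> rad i < 2 * s \<and> x \<in> ball (ctr i) (\<Lambda> * rad i)" by blast
      have dx: "dist (ctr i) x < 2 * \<Lambda> * s" "c * rad i \<le> 2 * s" if "i \<in> F" for i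
      proof -
        have "\<Lambda> * rad i \<le> \<Lambda> * (2 * s)" using *[OF that] assms by (intro mult_left_mono) auto
        then show "dist (ctr i) x < 2 * \<Lambda> * s" using *[OF that] by auto
        have "c * rad i \<le> 1 * (2 * s)" using *[OF that] c F by (intro mult_mono) auto
        then show "c * rad i \<le> 2 * s" by simp
      qed
      have "real (card F) \<le> NW * CD ^ n"
      proof (rule card_packing[where z = ctr and s = "\<lambda>i. c * rad i" and y = x and R = "(2 * \<Lambda> + 2) * s"])
        fix i assume i: "i \<in> F"
        show "c * rad i > 0" using *[OF i] F c by (intro mult_pos_pos) auto
        show "ball (ctr i) (c * rad i) \<subseteq> ball x ((2 * \<Lambda> + 2) * s)"
          using dx[OF i] by (intro ball_subset) (simp add: dist_commute algebra_simps)
        have "dist (ctr i) x + (2 * \<Lambda> + 2) * s \<le> (4 * \<Lambda> + 2) * s"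
          using dx[OF i] by (simp add: algebra_simps)
        also have "\<dots> \<le> 2 ^ n * c * s" using n F by (intro mult_right_mono) auto
        also have "\<dots> \<le> 2 ^ n * c * rad i" using *[OF i] c by (intro mult_left_mono) auto
        finally show "dist (ctr i) x + (2 * \<Lambda> + 2) * s \<le> 2 ^ n * (c * rad i)" by (simp add: mult.assoc)
      next
        show "real (card {i \<in> F. w \<in> ball (ctr i) (c * rad i)}) \<le> NW" for w by (rule overlap[OF F(1,2)])
      qed (use F assms in auto)
      then show "real (card F) \<le> NW * CD ^ n + 1" by simp
    qed
  qed
qed

lemma one_minus_two_powr:
  fixes \<beta> :: real
  assumes "0 < \<beta>" "\<beta> \<le> 1"
  shows "\<beta> / 2 \<le> 1 - 2 powr (- \<beta>)"
proof -
  have "(1 / 2) powr \<beta> * 1 powr (1 - \<beta>) \<le> \<beta> * (1 / 2) + (1 - \<beta>) * (1::real)"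
    by (rule Youngs_inequality_0) (use assms in auto)
  then show ?thesis by (simp add: powr_divide powr_minus_divide)
qed

text \<open>
  By \<open>scale_packing\<close> the sum over dyadic sizes is \<open>N\<close> times a geometric series of ratio \<open>2\<^sup>-\<^sup>\<beta>\<close>, whose
  sum is at most \<open>2 / \<beta>\<close> by \<open>one_minus_two_powr\<close>.
\<close>

lemma sum_rad_powr:
  assumes N: "scale_packing \<Lambda> N"
    and F: "finite F" "F \<subseteq> J" and s: "s > 0" and \<beta>: "0 < \<beta>" "\<beta> \<le> 1"
    and *: "\<And>i. i \<in> F \<Longrightarrow> s \<le> rad i \<and> x \<in> ball (ctr i) (\<Lambda> * rad i)"
  shows "(\<Sum>i\<in>F. rad i powr (- \<beta>)) \<le> N * (2 / \<beta>) * s powr (- \<beta>)"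
proof -
  define j where "j i = nat \<lfloor>log 2 (rad i / s)\<rfloor>" for i
  have j: "2 ^ j i * s \<le> rad i" "rad i < 2 * (2 ^ j i * s)" if i: "i \<in> F" for i
  proof -
    have q: "rad i / s \<ge> 1" using *[OF i] s by simp
    then have l: "0 \<le> log 2 (rad i / s)" by simp
    have ji: "real (j i) \<le> log 2 (rad i / s)" "log 2 (rad i / s) < real (j i) + 1"
      unfolding j_def using l by (auto simp: of_nat_nat)
    have "2 powr real (j i) \<le> rad i / s" using ji(1) q by (subst (asm) le_log_iff) auto
    then show "2 ^ j i * s \<le> rad i" using s by (simp add: powr_realpow field_simps)
    have "rad i / s < 2 powr (real (j i) + 1)" using ji(2) q by (subst (asm) log_less_iff) auto
    then show "rad i < 2 * (2 ^ j i * s)" using s by (simp add: powr_realpow powr_add field_simps)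
  qed
  have q: "0 < 2 powr (- \<beta>)" "2 powr (- \<beta>) < (1::real)"
    using one_minus_two_powr[OF \<beta>] \<beta> by (auto intro: order.strict_trans1)
  have N0: "N \<ge> 0" by (rule scale_packing_nonneg[OF N])
  have "(\<Sum>i\<in>F. rad i powr (- \<beta>)) \<le> (\<Sum>i\<in>F. (2 powr (- \<beta>)) ^ j i * s powr (- \<beta>))"
  proof (rule sum_mono)
    fix i assume i: "i \<in> F"
    have "rad i powr (- \<beta>) \<le> (2 ^ j i * s) powr (- \<beta>)" using j[OF i] s \<beta> by (intro powr_mono2') auto
    also have "\<dots> = (2 powr (- \<beta>)) ^ j i * s powr (- \<beta>)"
      using s by (simp add: powr_mult powr_power powr_powr mult.commute flip: powr_realpow)
    finally show "rad i powr (- \<beta>) \<le> (2 powr (- \<beta>)) ^ j i * s powr (- \<beta>)" .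
  qed
  also have "\<dots> = (\<Sum>k\<in>j ` F. \<Sum>i\<in>{i. i \<in> F \<and> j i = k}. (2 powr (- \<beta>)) ^ j i * s powr (- \<beta>))"
    by (rule sum.image_gen[OF F(1)])
  also have "\<dots> \<le> (\<Sum>k\<in>j ` F. N * ((2 powr (- \<beta>)) ^ k * s powr (- \<beta>)))"
  proof (rule sum_mono)
    fix k
    have "real (card {i. i \<in> F \<and> j i = k}) \<le> N"
      by (rule scale_packingD[OF N, of _ "2 ^ k * s" x]) (use F s j * in auto)
    then have "real (card {i. i \<in> F \<and> j i = k}) * ((2 powr (- \<beta>)) ^ k * s powr (- \<beta>))
        \<le> N * ((2 powr (- \<beta>)) ^ k * s powr (- \<beta>))" by (intro mult_right_mono) auto
    then show "(\<Sum>i\<in>{i. i \<in> F \<and> j i = k}. (2 powr (- \<beta>)) ^ j i * s powr (- \<beta>))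
        \<le> N * ((2 powr (- \<beta>)) ^ k * s powr (- \<beta>))" by simp
  qed
  also have "\<dots> = N * s powr (- \<beta>) * (\<Sum>k\<in>j ` F. (2 powr (- \<beta>)) ^ k)"
    by (simp add: sum_distrib_left mult_ac)
  also have "\<dots> \<le> N * s powr (- \<beta>) * (2 / \<beta>)"
  proof (rule mult_left_mono)
    have "(\<Sum>k\<in>j ` F. (2 powr (- \<beta>)) ^ k) \<le> (\<Sum>k. (2 powr (- \<beta>)) ^ k)"
      by (rule sum_le_suminf) (use F q in \<open>auto intro: summable_geometric\<close>)
    also have "\<dots> = 1 / (1 - 2 powr (- \<beta>))" by (rule suminf_geometric) (use q in auto)
    also have "\<dots> \<le> 1 / (\<beta> / 2)" using one_minus_two_powr[OF \<beta>] \<beta> by (intro divide_left_mono) auto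
    finally show "(\<Sum>k\<in>j ` F. (2 powr (- \<beta>)) ^ k) \<le> 2 / \<beta>" by simp
  qed (use N0 in auto)
  finally show ?thesis by (simp add: mult_ac)
qed

text \<open>
  The size of a ball \<open>tent i\<close> through \<open>y\<close> is comparable to \<open>d y\<close>: its \<open>rad i\<close> lies in one of two dyadic
  intervals.
\<close>

lemma card_tent:
  assumes N: "scale_packing \<Lambda> N"
    and \<Lambda>: "\<Lambda> \<ge> 1" and F: "finite F" "F \<subseteq> J"
  shows "real (card {i \<in> F. y \<in> tent i}) \<le> 2 * N"
proof -
  have N0: "N \<ge> 0" by (rule scale_packing_nonneg[OF N])
  have sc: "2 / 3 * d y < rad i" "rad i < 2 * d y" "y \<in> ball (ctr i) (\<Lambda> * rad i)" if i: "i \<in> F"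
      "y \<in> tent i" for i
  proof -
    have di: "dist (ctr i) y < rad i / 2" using i by simp
    then show "2 / 3 * d y < rad i" "rad i < 2 * d y" using d_lipschitz[of "ctr i" y] by linarith+
    have "rad i > 0" using di zero_le_dist[of "ctr i" y] by linarith
    then have "1 * rad i \<le> \<Lambda> * rad i" using \<Lambda> by (intro mult_right_mono) auto
    then show "y \<in> ball (ctr i) (\<Lambda> * rad i)" using di \<open>rad i > 0\<close> unfolding mem_ball by linarith
  qed
  show ?thesis
  proof (cases "d y > 0")
    case True
    \<comment> \<open>The interval from \<open>2/3 d\<close> to \<open>2 d\<close> is covered by two dyadic ones.\<close>
    define A where "A t = {i \<in> F. y \<in> tent i \<and> t \<le> rad i \<and> rad i < 2 * t}" for t
    have A: "real (card (A t)) \<le> N" if "t > 0" for t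
      by (rule scale_packingD[OF N, of _ t y]) (use F sc that in \<open>auto simp: A_def\<close>)
    have "{i \<in> F. y \<in> tent i} \<subseteq> A (2 / 3 * d y) \<union> A (4 / 3 * d y)"
      using sc True unfolding A_def by (fastforce simp: not_le)
    then have "card {i \<in> F. y \<in> tent i} \<le> card (A (2 / 3 * d y) \<union> A (4 / 3 * d y))"
      using F by (intro card_mono) (auto simp: A_def)
    also have "\<dots> \<le> card (A (2 / 3 * d y)) + card (A (4 / 3 * d y))" by (rule card_Un_le)
    finally have "real (card {i \<in> F. y \<in> tent i}) \<le> real (card (A (2 / 3 * d y)) + card (A (4 / 3 * d y)))"
      by (rule of_nat_mono)
    then show ?thesis using A[of "2 / 3 * d y"] A[of "4 / 3 * d y"] True by simp
  next
    case False
    then have e: "{i \<in> F. y \<in> tent i} = {}" using sc by fastforce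
    show ?thesis unfolding e using N0 by simp
  qed
qed

text \<open>
  The distance to \<open>S\<close>, truncated as in \<open>upper_gradient_mult_distance_powr\<close>.
\<close>

abbreviation dtrunc :: "real \<Rightarrow> 'a \<Rightarrow> real" where "dtrunc \<delta> x \<equiv> max (d x) (2 * \<delta>)"

abbreviation inner_hardy :: "real \<Rightarrow> ('a \<Rightarrow> real) \<Rightarrow> ennreal" where
  "inner_hardy \<delta> f \<equiv> \<integral>\<^sup>+y\<in>{y. \<delta> < d y}. ennreal (dtrunc \<delta> y powr (- p) * f y powr p) \<partial>\<mu>"

text \<open>
  The Hardy integral of \<open>f\<close>, discretized over the Whitney family.
\<close>

abbreviation tent_sum :: "('a \<Rightarrow> real) \<Rightarrow> nat set \<Rightarrow> ennreal" where
  "tent_sum f F \<equiv> \<Sum>i\<in>F. ennreal (rad i powr (- p)) * pmass f (tent i)"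

lemma d_measurable [measurable]: "d \<in> borel_measurable \<mu>"
  by (intro borel_fun_\<mu> borel_measurable_continuous_onI continuous_intros)

lemma d_tent:
  assumes "y \<in> tent i"
  shows "rad i / 2 \<le> d y" "d y \<le> 2 * rad i"
proof -
  have "dist (ctr i) y < rad i / 2" using assms by simp
  then show "rad i / 2 \<le> d y" "d y \<le> 2 * rad i"
    using d_lipschitz[of "ctr i" y] infdist_nonneg[of "ctr i" S] by linarith+
qed

text \<open>
  The boundary estimate for \<open>w = f d\<^sup>\<beta>\<^sup>/\<^sup>p\<close>, with the truncated distance, on each ball,
  added with weights \<open>rad i powr (- p - \<beta>)\<close>. On
  \<open>tent i\<close> the distance is comparable to \<open>rad i\<close>, so the left-hand sides add up to the Hardy sum of
  \<open>f\<close>. On the right, a point at distance \<open>d\<close> only sees balls with \<open>rad i\<close> at least a multiple of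
  \<open>d\<close>, and \<open>sum_rad_powr\<close> gives \<open>d\<^sup>-\<^sup>\<beta> / \<beta>\<close>. Balls with \<open>rad i\<close> below \<open>\<delta> / 2\<close> are left out so that the
  truncation of \<open>d\<close> at \<open>2 * \<delta>\<close> is harmless.
\<close>

lemma tent_sum_weighted:
  assumes bp: "boundary_poincare S K \<Lambda>"
    and K: "K > 0" and \<Lambda>: "\<Lambda> \<ge> 1"
    and N: "scale_packing \<Lambda> N"
    and f[measurable]: "f \<in> borel_measurable \<mu>" and f01: "\<And>y. 0 \<le> f y" "\<And>y. f y \<le> 1"
        and fS: "\<And>y. y \<in> S \<Longrightarrow> f y = 0"
    and \<delta>: "\<delta> > 0" and \<beta>: "0 < \<beta>" "\<beta> \<le> 1"
    and ug: "upper_gradient (\<lambda>y. ereal (f y * dtrunc \<delta> y powr (\<beta> / p))) h"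
    and F: "finite F" "F \<subseteq> J" "\<And>i. i \<in> F \<Longrightarrow> \<delta> / 2 \<le> rad i"
  shows "tent_sum f F \<le> ennreal (16 * K * N * (1 + \<Lambda>) / \<beta>) * (\<integral>\<^sup>+y. ennreal (dtrunc \<delta> y powr (- \<beta>))
      * ennreal_pow (h y) p \<partial>\<mu>)"
proof -
  have [measurable]: "h \<in> borel_measurable \<mu>" by (rule upper_gradient_measurable[OF ug])
  have N0: "N \<ge> 0" by (rule scale_packing_nonneg[OF N])
  define w where "w y = f y * dtrunc \<delta> y powr (\<beta> / p)" for y
  have w[measurable]: "w \<in> borel_measurable \<mu>" unfolding w_def by measurable
  have w0: "0 \<le> w y" for y unfolding w_def using f01 by simp
  have wp: "w y powr p = f y powr p * dtrunc \<delta> y powr \<beta>" for y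
    unfolding w_def using f01[of y] p by (simp add: powr_mult powr_powr)
  have local: "pmass w (tent i) \<le> ennreal (K * rad i powr p) * energy h (ball (ctr i) (\<Lambda> * rad i))"
    if i: "i \<in> F" for i
  proof -
    \<comment> \<open>The weight is unbounded, but \<open>b\<close> bounds \<open>w\<close> on \<open>tent i\<close>, so \<open>w\<close> may be truncated there.\<close>
    define b where "b = max (2 * rad i) (2 * \<delta>) powr (\<beta> / p)"
    have "upper_gradient (\<lambda>y. ereal (min (w y) b)) (\<lambda>y. ennreal 1 * h y)"
      by (rule upper_gradient_lipschitz_compose[OF ug[folded w_def], of 1
          "\<lambda>t. min t b"]) (auto simp: min_def)
    then have ugb: "upper_gradient (\<lambda>y. ereal (min (w y) b)) h" by simp
    have wb: "w y \<le> b" if "y \<in> tent i" for y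
    proof -
      have "w y \<le> 1 * dtrunc \<delta> y powr (\<beta> / p)" unfolding w_def using f01 by (intro mult_right_mono) auto
      also have "\<dots> \<le> b" unfolding b_def using d_tent[OF that] \<delta> \<beta> p by (simp, intro powr_mono2) auto
      finally show ?thesis .
    qed
    have "pmass w (tent i) = (\<integral>\<^sup>+y\<in>tent i. ennreal (min (w y) b powr p) \<partial>\<mu>)"
    proof (rule nn_integral_cong)
      fix y show "ennreal (w y powr p) * indicator (tent i) y
          = ennreal (min (w y) b powr p) * indicator (tent i) y"
        using wb[of y] by (cases "y \<in> tent i") (simp_all add: min_absorb1)
    qed
    also have "\<dots> \<le> ennreal (K * rad i powr p) * energy h (ball (ctr i) (\<Lambda> * rad i))"
    proof (rule bp[unfolded boundary_poincare_def, rule_format, of _ _ b], intro conjI allI ballI)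
      show "(\<lambda>y. min (w y) b) \<in> borel_measurable \<mu>" by measurable
      show "upper_gradient (\<lambda>y. ereal (min (w y) b)) h" by (rule ugb)
      show "0 \<le> min (w y) b" for y using w0[of y] by (simp add: b_def)
      show "min (w y) b = 0" if "y \<in> S" for y using fS[OF that] by (simp add: w_def b_def)
      show "min (w y) b \<le> b" for y by simp
      show "ctr i \<notin> S" using ctr i F by auto
    qed
    finally show ?thesis .
  qed
  have "tent_sum f F \<le> (\<Sum>i\<in>F. ennreal (2 * K * rad i powr (- \<beta>)) * energy h (ball (ctr i) (\<Lambda> * rad i)))"
  proof (rule sum_mono)
    fix i assume i: "i \<in> F"
    then have ri: "rad i > 0" using rad_pos F by auto
    have "pmass f (tent i)
        \<le> (\<integral>\<^sup>+y. ennreal (2 * rad i powr (- \<beta>)) * (ennreal (w y powr p) * indicator (tent i) y) \<partial>\<mu>)"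
    proof (rule nn_integral_mono)
      fix y
      show "ennreal (f y powr p) * indicator (tent i) y
          \<le> ennreal (2 * rad i powr (- \<beta>)) * (ennreal (w y powr p) * indicator (tent i) y)"
      proof (cases "y \<in> tent i")
        case True
        have "rad i powr \<beta> = (rad i / 2) powr \<beta> * 2 powr \<beta>" using ri by (simp add: powr_divide)
        also have "\<dots> \<le> dtrunc \<delta> y powr \<beta> * 2"
        proof (intro mult_mono powr_mono2)
          show "2 powr \<beta> \<le> (2::real)" using powr_mono[of \<beta> 1 2] \<beta> by simp
        qed (use d_tent[OF True] ri \<beta> in auto)
        finally have "1 \<le> 2 * rad i powr (- \<beta>) * dtrunc \<delta> y powr \<beta>"
          using ri by (simp add: powr_minus field_simps)
        then have "1 * f y powr p \<le> 2 * rad i powr (- \<beta>) * dtrunc \<delta> y powr \<beta> * f y powr p"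
          by (intro mult_right_mono) auto
        then have "f y powr p \<le> 2 * rad i powr (- \<beta>) * w y powr p" unfolding wp by (simp add: mult_ac)
        then show ?thesis using True by (simp add: ennreal_leI flip: ennreal_mult)
      qed auto
    qed
    also have "\<dots> = ennreal (2 * rad i powr (- \<beta>)) * pmass w (tent i)"
      by (rule nn_integral_cmult) measurable
    also have "\<dots> \<le> ennreal (2 * rad i powr (- \<beta>)) * (ennreal (K * rad i powr p)
        * energy h (ball (ctr i) (\<Lambda> * rad i)))"
      by (intro mult_left_mono local i) auto
    finally have "ennreal (rad i powr (- p)) * pmass f (tent i)
        \<le> ennreal (rad i powr (- p)) * (ennreal (2 * rad i powr (- \<beta>)) * (ennreal (K * rad i powr p)
          * energy h (ball (ctr i) (\<Lambda> * rad i))))"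
      by (rule mult_left_mono) simp
    also have "\<dots> = ennreal (rad i powr (- p) * (2 * rad i powr (- \<beta>)) * (K * rad i powr p))
        * energy h (ball (ctr i) (\<Lambda> * rad i))"
      using K by (simp add: ennreal_mult mult.assoc)
    also have "rad i powr (- p) * (2 * rad i powr (- \<beta>)) * (K * rad i powr p) = 2 * K * rad i powr (- \<beta>)"
      using ri by (simp add: powr_minus field_simps)
    finally show "ennreal (rad i powr (- p)) * pmass f (tent i)
        \<le> ennreal (2 * K * rad i powr (- \<beta>)) * energy h (ball (ctr i) (\<Lambda> * rad i))" .
  qed
  also have "\<dots> = (\<Sum>i\<in>F. \<integral>\<^sup>+y. ennreal (2 * K * rad i powr (- \<beta>)) * (ennreal_pow (h y) p
      * indicator (ball (ctr i) (\<Lambda> * rad i)) y) \<partial>\<mu>)"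
    unfolding energy_def by (intro sum.cong refl nn_integral_cmult[symmetric]) measurable
  also have "\<dots> = (\<integral>\<^sup>+y. (\<Sum>i\<in>F. ennreal (2 * K * rad i powr (- \<beta>)) * (ennreal_pow (h y) p
      * indicator (ball (ctr i) (\<Lambda> * rad i)) y)) \<partial>\<mu>)"
    by (intro nn_integral_sum[symmetric]) measurable
  also have "\<dots> \<le> (\<integral>\<^sup>+y. ennreal (16 * K * N * (1 + \<Lambda>) / \<beta>) * (ennreal (dtrunc \<delta> y powr (- \<beta>))
      * ennreal_pow (h y) p) \<partial>\<mu>)"
  proof (rule nn_integral_mono)
    fix y
    define Fy where "Fy = {i \<in> F. y \<in> ball (ctr i) (\<Lambda> * rad i)}"
    define s where "s = dtrunc \<delta> y / (4 * (1 + \<Lambda>))"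
    have my: "dtrunc \<delta> y > 0" using \<delta> by simp
    have s: "s > 0" unfolding s_def using my \<Lambda> by simp
    have "(\<Sum>i\<in>Fy. rad i powr (- \<beta>)) \<le> N * (2 / \<beta>) * s powr (- \<beta>)"
    proof (rule sum_rad_powr[OF N])
      fix i assume i: "i \<in> Fy"
      have y: "dist (ctr i) y < \<Lambda> * rad i" and ri: "\<delta> / 2 \<le> rad i" using i F(3) by (auto simp: Fy_def)
      have "d y \<le> (1 + \<Lambda>) * rad i" using d_lipschitz[of "ctr i" y] y by (simp add: algebra_simps)
      moreover have "1 * rad i \<le> (1 + \<Lambda>) * rad i" using \<Lambda> ri \<delta> by (intro mult_right_mono) auto
      ultimately have "dtrunc \<delta> y \<le> 4 * ((1 + \<Lambda>) * rad i)"
        using ri \<delta> by (intro max.boundedI; linarith)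
      then have "dtrunc \<delta> y \<le> rad i * (4 * (1 + \<Lambda>))" by (simp only: mult_ac)
      moreover have "0 < 4 * (1 + \<Lambda>)" using \<Lambda> by simp
      ultimately have "s \<le> rad i" unfolding s_def by (simp only: pos_divide_le_eq)
      then show "s \<le> rad i \<and> y \<in> ball (ctr i) (\<Lambda> * rad i)" using y by simp
    qed (use F s \<beta> in \<open>auto simp: Fy_def\<close>)
    also have "s powr (- \<beta>) = (4 * (1 + \<Lambda>)) powr \<beta> * dtrunc \<delta> y powr (- \<beta>)"
      unfolding s_def using my \<Lambda> by (simp add: powr_divide powr_minus field_simps)
    also have "N * (2 / \<beta>) * ((4 * (1 + \<Lambda>)) powr \<beta> * dtrunc \<delta> y powr (- \<beta>))
        \<le> N * (2 / \<beta>) * ((4 * (1 + \<Lambda>)) * dtrunc \<delta> y powr (- \<beta>))"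
      using powr_mono[of \<beta> 1 "4 * (1 + \<Lambda>)"] \<Lambda> \<beta> N0 by (intro mult_left_mono mult_right_mono) auto
    finally have "2 * K * (\<Sum>i\<in>Fy. rad i powr (- \<beta>))
        \<le> 2 * K * (N * (2 / \<beta>) * ((4 * (1 + \<Lambda>)) * dtrunc \<delta> y powr (- \<beta>)))"
      using K by (intro mult_left_mono) auto
    also have "\<dots> = 16 * K * N * (1 + \<Lambda>) / \<beta> * dtrunc \<delta> y powr (- \<beta>)" by simp
    finally have le: "(\<Sum>i\<in>Fy. 2 * K * rad i powr (- \<beta>)) \<le> 16 * K * N * (1 + \<Lambda>) / \<beta> * dtrunc \<delta> y powr (- \<beta>)"
      by (simp add: sum_distrib_left)
    have "(\<Sum>i\<in>F. ennreal (2 * K * rad i powr (- \<beta>)) * (ennreal_pow (h y) p * indicator (ball (ctr i) (\<Lambda>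
        * rad i)) y))
        = (\<Sum>i\<in>Fy. ennreal (2 * K * rad i powr (- \<beta>)) * ennreal_pow (h y) p)"
      unfolding Fy_def using F(1) by (intro sum.mono_neutral_cong_right) auto
    also have "\<dots> = ennreal (\<Sum>i\<in>Fy. 2 * K * rad i powr (- \<beta>)) * ennreal_pow (h y) p"
      using K by (simp add: sum_ennreal flip: sum_distrib_right)
    also have "\<dots> \<le> ennreal (16 * K * N * (1 + \<Lambda>) / \<beta> * dtrunc \<delta> y powr (- \<beta>)) * ennreal_pow (h y) p"
      by (intro mult_right_mono ennreal_leI le) auto
    also have "\<dots> = ennreal (16 * K * N * (1 + \<Lambda>) / \<beta>) * (ennreal (dtrunc \<delta> y powr (- \<beta>))
        * ennreal_pow (h y) p)"
      using K N0 \<Lambda> \<beta> by (subst ennreal_mult) (auto simp: mult.assoc)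
    finally show "(\<Sum>i\<in>F. ennreal (2 * K * rad i powr (- \<beta>)) * (ennreal_pow (h y) p
        * indicator (ball (ctr i) (\<Lambda> * rad i)) y))
        \<le> ennreal (16 * K * N * (1 + \<Lambda>) / \<beta>) * (ennreal (dtrunc \<delta> y powr (- \<beta>)) * ennreal_pow (h y) p)" .
  qed
  also have "\<dots> = ennreal (16 * K * N * (1 + \<Lambda>) / \<beta>) * (\<integral>\<^sup>+y. ennreal (dtrunc \<delta> y powr (- \<beta>))
      * ennreal_pow (h y) p \<partial>\<mu>)"
    by (rule nn_integral_cmult) measurable
  finally show ?thesis .
qed

text \<open>
  The integrand is the \<open>p\<close>-th power of the gradient given by \<open>upper_gradient_mult_distance_powr\<close> with
  exponent \<open>\<beta> / p\<close>. The weight \<open>d\<^sup>-\<^sup>\<beta>\<close> cancels the weight of \<open>g\<close>, and the derivative of the weight leaves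
  \<open>\<beta>\<^sup>p\<close> times the Hardy integral.
\<close>

lemma weighted_energy_le:
  assumes [measurable]: "g \<in> borel_measurable \<mu>" "U \<in> borel_measurable \<mu>" and f0: "\<And>y. 0 \<le> f y"
    and U: "AE y in \<mu>. U y = ennreal (f y)" and f[measurable]: "f \<in> borel_measurable \<mu>"
    and \<delta>: "\<delta> > 0" and \<beta>: "0 < \<beta>"
  shows "(\<integral>\<^sup>+y. ennreal (dtrunc \<delta> y powr (- \<beta>)) * ennreal_pow (ennreal (2 * (2
      * dtrunc \<delta> y powr (\<beta> / p))) * g y
          + ennreal (2 * (\<beta> / p) * dtrunc \<delta> y powr (\<beta> / p - 1) * indicator {y. \<delta> < d y} y) * U y) p \<partial>\<mu>)
    \<le> ennreal (8 powr p) * energy g UNIV + ennreal (4 powr p * \<beta> powr p) *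
        inner_hardy \<delta> f"
proof -
  have "(\<integral>\<^sup>+y. ennreal (dtrunc \<delta> y powr (- \<beta>)) * ennreal_pow (ennreal (2 * (2
      * dtrunc \<delta> y powr (\<beta> / p))) * g y
          + ennreal (2 * (\<beta> / p) * dtrunc \<delta> y powr (\<beta> / p - 1) * indicator {y. \<delta> < d y} y) * U y) p \<partial>\<mu>)
    \<le> (\<integral>\<^sup>+y. ennreal (8 powr p) * ennreal_pow (g y) p
          + ennreal (4 powr p * \<beta> powr p) * (ennreal (dtrunc \<delta> y powr (- p) * f y powr p)
            * indicator {y. \<delta> < d y} y) \<partial>\<mu>)"
  proof (rule nn_integral_mono_AE, use U in eventually_elim)
    fix y assume Uy: "U y = ennreal (f y)"
    define mm where "mm = dtrunc \<delta> y"
    have mm: "mm > 0" unfolding mm_def using \<delta> by simp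
    define A where "A = 2 * (2 * mm powr (\<beta> / p))"
    define B where "B = 2 * (\<beta> / p) * mm powr (\<beta> / p - 1) * indicator {y. \<delta> < d y} y"
    have AB: "A \<ge> 0" "B \<ge> 0" unfolding A_def B_def using \<beta> p by (auto simp: indicator_def)
    have Ap: "2 powr p * mm powr (- \<beta>) * A powr p = 8 powr p"
    proof -
      have "A powr p = 4 powr p * mm powr \<beta>"
        unfolding A_def using mm p by (simp add: powr_mult powr_powr flip: mult.assoc)
      then have "2 powr p * mm powr (- \<beta>) * A powr p = 2 powr p * 4 powr p"
        using mm by (simp add: powr_minus)
      then show ?thesis by (simp flip: powr_mult)
    qed
    have Bp: "2 powr p * mm powr (- \<beta>) * B powr p
        \<le> 4 powr p * \<beta> powr p * (mm powr (- p) * indicator {y. \<delta> < d y} y)"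
    proof (cases "\<delta> < d y")
      case True
      have "B powr p = 2 powr p * (\<beta> / p) powr p * mm powr (\<beta> - p)"
      proof -
        have "B = 2 * (\<beta> / p) * mm powr (\<beta> / p - 1)" unfolding B_def using True by simp
        then have "B powr p = 2 powr p * (\<beta> / p) powr p * (mm powr (\<beta> / p - 1)) powr p"
          using \<beta> p by (simp only: powr_mult)
        also have "(mm powr (\<beta> / p - 1)) powr p = mm powr (\<beta> - p)"
          using p by (simp add: powr_powr left_diff_distrib)
        finally show ?thesis .
      qed
      then have "2 powr p * mm powr (- \<beta>) * B powr p = 2 powr p * 2 powr p * (\<beta> / p) powr p * mm powr (- p)"
        using mm by (simp add: powr_minus powr_diff field_simps)
      also have "\<dots> = 4 powr p * (\<beta> / p) powr p * mm powr (- p)" by (simp flip: powr_mult)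
      also have "\<dots> \<le> 4 powr p * \<beta> powr p * mm powr (- p)"
        using \<beta> p by (intro mult_right_mono mult_left_mono powr_mono2) (auto simp: divide_le_eq)
      finally show ?thesis using True by simp
    qed (auto simp: B_def)
    have "ennreal (mm powr (- \<beta>)) * ennreal_pow (ennreal A * g y + ennreal B * U y) p
        \<le> ennreal (mm powr (- \<beta>)) * (ennreal (2 powr p) * (ennreal_pow (ennreal A * g y) p
          + ennreal_pow (ennreal B * U y) p))"
      using p by (intro mult_left_mono ennreal_pow_add_le) auto
    also have "ennreal_pow (ennreal A * g y) p = ennreal (A powr p) * ennreal_pow (g y) p"
      using AB p by (simp add: ennreal_pow_cmult)
    also have "ennreal_pow (ennreal B * U y) p = ennreal (B powr p) * ennreal (f y powr p)"
      using AB p f0 by (simp add: ennreal_pow_cmult Uy ennreal_pow_ennreal)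
    also have "ennreal (mm powr (- \<beta>)) * (ennreal (2 powr p) * (ennreal (A powr p) * ennreal_pow (g y) p
        + ennreal (B powr p) * ennreal (f y powr p)))
        = ennreal (2 powr p * mm powr (- \<beta>) * A powr p) * ennreal_pow (g y) p + ennreal (2 powr p
          * mm powr (- \<beta>) * B powr p * f y powr p)"
      by (simp add: distrib_left ennreal_mult mult_ac)
    also have "\<dots> \<le> ennreal (8 powr p) * ennreal_pow (g y) p
        + ennreal (4 powr p * \<beta> powr p * (mm powr (- p) * indicator {y. \<delta> < d y} y) * f y powr p)"
      unfolding Ap by (intro add_left_mono ennreal_leI mult_right_mono Bp) auto
    also have "ennreal (4 powr p * \<beta> powr p * (mm powr (- p) * indicator {y. \<delta> < d y} y) * f y powr p)
        = ennreal (4 powr p * \<beta> powr p) * (ennreal (mm powr (- p) * f y powr p) * indicator {y. \<delta> < d y} y)"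
      by (auto simp: indicator_def mult.assoc simp flip: ennreal_mult)
    finally show "ennreal (dtrunc \<delta> y powr (- \<beta>)) * ennreal_pow (ennreal (2 * (2
        * dtrunc \<delta> y powr (\<beta> / p))) * g y
          + ennreal (2 * (\<beta> / p) * dtrunc \<delta> y powr (\<beta> / p - 1) * indicator {y. \<delta> < d y} y) * U y) p
      \<le> ennreal (8 powr p) * ennreal_pow (g y) p
          + ennreal (4 powr p * \<beta> powr p) * (ennreal (dtrunc \<delta> y powr (- p) * f y powr p)
            * indicator {y. \<delta> < d y} y)"
      unfolding mm_def A_def B_def .
  qed
  also have "\<dots> = (\<integral>\<^sup>+y. ennreal (8 powr p) * ennreal_pow (g y) p \<partial>\<mu>)
      + (\<integral>\<^sup>+y. ennreal (4 powr p * \<beta> powr p) * (ennreal (dtrunc \<delta> y powr (- p) * f y powr p)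
        * indicator {y. \<delta> < d y} y) \<partial>\<mu>)"
    by (rule nn_integral_add) measurable
  also have "(\<integral>\<^sup>+y. ennreal (8 powr p) * ennreal_pow (g y) p \<partial>\<mu>) = ennreal (8 powr p) * energy g UNIV"
    unfolding energy_UNIV by (rule nn_integral_cmult) measurable
  also have "(\<integral>\<^sup>+y. ennreal (4 powr p * \<beta> powr p) * (ennreal (dtrunc \<delta> y powr (- p) * f y powr p)
      * indicator {y. \<delta> < d y} y) \<partial>\<mu>)
      = ennreal (4 powr p * \<beta> powr p) * inner_hardy \<delta> f"
    by (rule nn_integral_cmult) measurable
  finally show ?thesis .
qed

text \<open>
  A point at distance more than \<open>\<delta>\<close> from \<open>S\<close> lies in some Whitney ball with \<open>rad i \<ge> \<delta> / 2\<close>, so the Hardy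
  integral over these points is controlled by the Hardy sums over such balls.
\<close>

lemma integral_away_from_complement_le:
  assumes f[measurable]: "f \<in> borel_measurable \<mu>" and \<delta>: "\<delta> > 0"
    and T: "\<And>F. \<lbrakk>finite F; F \<subseteq> J; \<And>i. i \<in> F \<Longrightarrow> \<delta> / 2 \<le> rad i\<rbrakk> \<Longrightarrow> tent_sum f F \<le> T"
  shows "inner_hardy \<delta> f \<le> ennreal (2 powr p) * T"
proof -
  define I where "I = {i \<in> J. \<delta> / 2 \<le> rad i}"
  define t where "t i y = (if i \<in> I then ennreal (2 powr p * rad i powr (- p)) * (ennreal (f y powr p)
      * indicator (tent i) y) else 0)" for i y
  have tm[measurable]: "t i \<in> borel_measurable \<mu>" for i unfolding t_def by measurable
  have "inner_hardy \<delta> f \<le> (\<integral>\<^sup>+y. (\<Sum>i. t i y) \<partial>\<mu>)"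
  proof (rule nn_integral_mono)
    fix y
    show "ennreal (dtrunc \<delta> y powr (- p) * f y powr p) * indicator {y. \<delta> < d y} y \<le> (\<Sum>i. t i y)"
    proof (cases "\<delta> < d y")
      case True
      then have "y \<notin> S" using \<delta> by auto
      then obtain i where i: "i \<in> J" "dist (ctr i) y < c * rad i" using cover by fastforce
      have ri: "rad i > 0" by (rule rad_pos[OF i(1)])
      have "c * rad i \<le> 1 / 8 * rad i" using c ri by (intro mult_right_mono) auto
      then have di: "dist (ctr i) y < 1 / 8 * rad i" using i by linarith
      then have y: "y \<in> tent i" using ri by simp
      have "\<delta> / 2 \<le> rad i" using d_lipschitz[of "ctr i" y] di True ri by linarith
      then have iI: "i \<in> I" using i by (simp add: I_def)
      have "dtrunc \<delta> y powr (- p) \<le> (rad i / 2) powr (- p)"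
        using d_tent(1)[OF y] ri p by (intro powr_mono2') auto
      also have "\<dots> = 2 powr p * rad i powr (- p)" using ri by (simp add: powr_divide powr_minus field_simps)
      finally have "dtrunc \<delta> y powr (- p) * f y powr p \<le> 2 powr p * rad i powr (- p) * f y powr p"
        by (intro mult_right_mono) auto
      then have "ennreal (dtrunc \<delta> y powr (- p) * f y powr p) \<le> t i y"
        using iI y by (simp add: t_def ennreal_leI flip: ennreal_mult)
      also have "\<dots> \<le> (\<Sum>i. t i y)"
        using sum_le_suminf[OF summableI, of "{i}" "\<lambda>i. t i y"] by simp
      finally show ?thesis using True by simp
    qed simp
  qed
  also have "\<dots> = (\<Sum>i. \<integral>\<^sup>+y. t i y \<partial>\<mu>)" by (rule nn_integral_suminf) measurable
  also have "\<dots> \<le> ennreal (2 powr p) * T"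
  proof (rule suminf_le_const[OF summableI])
    fix n
    have "(\<Sum>i<n. \<integral>\<^sup>+y. t i y \<partial>\<mu>) = (\<Sum>i\<in>{..<n} \<inter> I. \<integral>\<^sup>+y. t i y \<partial>\<mu>)"
      by (rule sum.mono_neutral_right) (auto simp: t_def)
    also have "\<dots> = (\<Sum>i\<in>{..<n} \<inter> I. ennreal (2 powr p) * (ennreal (rad i powr (- p)) * pmass f (tent i)))"
    proof (rule sum.cong[OF refl])
      fix i assume "i \<in> {..<n} \<inter> I"
      then have "(\<integral>\<^sup>+y. t i y \<partial>\<mu>) = (\<integral>\<^sup>+y. ennreal (2 powr p * rad i powr (- p)) * (ennreal (f y powr p)
          * indicator (tent i) y) \<partial>\<mu>)"
        by (simp add: t_def)
      also have "\<dots> = ennreal (2 powr p * rad i powr (- p)) * pmass f (tent i)"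
        by (rule nn_integral_cmult) measurable
      finally show "(\<integral>\<^sup>+y. t i y \<partial>\<mu>)
          = ennreal (2 powr p) * (ennreal (rad i powr (- p)) * pmass f (tent i))"
        by (simp add: ennreal_mult mult.assoc)
    qed
    also have "\<dots> = ennreal (2 powr p) * tent_sum f ({..<n} \<inter> I)" by (simp only: sum_distrib_left)
    also have "\<dots> \<le> ennreal (2 powr p) * T" by (intro mult_left_mono T) (auto simp: I_def)
    finally show "(\<Sum>i<n. \<integral>\<^sup>+y. t i y \<partial>\<mu>) \<le> ennreal (2 powr p) * T" .
  qed
  finally show ?thesis .
qed

text \<open>
  Let \<open>T\<close> be the supremum of the Hardy sums over balls with \<open>rad i \<ge> \<delta> / 2\<close>. It is finite, because
  \<open>f\<^sup>p\<close> is integrable, and the preceding lemmas bound it by the energy of \<open>f\<close>, divided by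
  \<open>\<beta>\<close>, plus \<open>\<beta>\<^sup>p\<^sup>-\<^sup>1 T\<close>, up to constants. The exponent \<open>\<beta>\<close> is chosen, depending only on these constants,
  to make the coefficient of \<open>T\<close> at most \<open>1 / 2\<close>.
\<close>

lemma hardy:
  assumes bp: "boundary_poincare S K \<Lambda>"
    and K: "K > 0" and \<Lambda>: "\<Lambda> \<ge> 1"
    and N: "N \<ge> 1" "scale_packing \<Lambda> N"
  obtains C where "C > 0" "\<forall>f g F. f \<in> borel_measurable \<mu> \<and> (\<forall>y. 0 \<le> f y \<and> f y \<le> 1) \<and> (\<forall>y\<in>S. f y = 0) \<and>
      upper_gradient (\<lambda>y. ereal (f y)) g \<and> (\<integral>\<^sup>+y. ennreal (f y powr p) \<partial>\<mu>) < \<infinity> \<and> finite F \<and> F \<subseteq> J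
    \<longrightarrow> tent_sum f F \<le> ennreal C * energy g UNIV"
proof -
  define C3 where "C3 = 16 * K * N * (1 + \<Lambda>)"
  have C3: "C3 > 0" unfolding C3_def using K N(1) \<Lambda> by simp
  \<comment> \<open>The target value of \<open>\<beta> powr (p - 1)\<close>; the summand \<open>1\<close> keeps it below \<open>1\<close>.\<close>
  define \<epsilon> where "\<epsilon> = 1 / (2 * (C3 * 8 powr p) + 1)"
  have \<epsilon>: "0 < \<epsilon>" "\<epsilon> \<le> 1" "C3 * 8 powr p * \<epsilon> \<le> 1 / 2"
    unfolding \<epsilon>_def using C3 by (auto simp: field_simps add_pos_pos)
  define \<beta> where "\<beta> = \<epsilon> powr (1 / (p - 1))"
  have \<beta>: "0 < \<beta>" "\<beta> \<le> 1" "\<beta> powr (p - 1) = \<epsilon>"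
    unfolding \<beta>_def using \<epsilon> p by (auto simp: powr_powr powr_le1)
  define C where "C = 2 * (C3 / \<beta> * 8 powr p)"
  have C: "C > 0" unfolding C_def using C3 \<beta> by simp
  have main: "tent_sum f F \<le> ennreal C * energy g UNIV"
    if f[measurable]: "f \<in> borel_measurable \<mu>" and f01: "\<And>y. 0 \<le> f y" "\<And>y. f y \<le> 1"
        and fS: "\<And>y. y \<in> S \<Longrightarrow> f y = 0"
      and ug: "upper_gradient (\<lambda>y. ereal (f y)) g" and fin: "(\<integral>\<^sup>+y. ennreal (f y powr p) \<partial>\<mu>) < \<infinity>"
          and F: "finite F" "F \<subseteq> J"
    for f g F
  proof (cases "energy g UNIV")
    case top
    then show ?thesis using C by (simp add: ennreal_mult_top)
  next
    case (real e)
    define \<delta> where "\<delta> = Min (insert 1 (rad ` F))"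
    have \<delta>: "\<delta> > 0" "\<And>i. i \<in> F \<Longrightarrow> \<delta> \<le> rad i"
      unfolding \<delta>_def using F rad_pos by auto
    define FF where "FF = {F. finite F \<and> F \<subseteq> J \<and> (\<forall>i\<in>F. \<delta> / 2 \<le> rad i)}"
    define T where "T = (SUP F\<in>FF. tent_sum f F)"
    have "F \<in> FF" using F \<delta> unfolding FF_def by force
    then have FT: "tent_sum f F \<le> T" unfolding T_def by (rule SUP_upper)
    have "T \<le> ennreal ((\<delta> / 2) powr (- p)) * (ennreal (2 * N) * (\<integral>\<^sup>+y. ennreal (f y powr p) \<partial>\<mu>))"
      unfolding T_def
    proof (rule SUP_least)
      fix G assume G: "G \<in> FF"
      have "tent_sum f G \<le> (\<Sum>i\<in>G. ennreal ((\<delta> / 2) powr (- p)) * pmass f (tent i))"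
        using G \<delta> p unfolding FF_def by (intro sum_mono mult_right_mono ennreal_leI powr_mono2') auto
      also have "\<dots> = ennreal ((\<delta> / 2) powr (- p)) * (\<Sum>i\<in>G. \<integral>\<^sup>+y\<in>tent i. ennreal (f y powr p) \<partial>\<mu>)"
        by (simp only: sum_distrib_left)
      also have "(\<Sum>i\<in>G. \<integral>\<^sup>+y\<in>tent i. ennreal (f y powr p) \<partial>\<mu>) \<le> ennreal (2 * N) * pmass f UNIV"
      proof (rule sum_nn_integral_overlap)
        show "UNIV \<in> sets \<mu>" by (simp add: borel_sets_\<mu>)
        show "real (card {i \<in> G. y \<in> tent i}) \<le> 2 * N" for y
          by (rule card_tent[OF N(2) \<Lambda>]) (use G in \<open>auto simp: FF_def\<close>)
      qed (use G in \<open>auto simp: FF_def\<close>)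
      finally show "tent_sum f G \<le> ennreal ((\<delta> / 2) powr (- p)) * (ennreal (2 * N)
          * (\<integral>\<^sup>+y. ennreal (f y powr p) \<partial>\<mu>))"
        by (simp add: mult_left_mono)
    qed
    also have "\<dots> < \<infinity>" using fin by (simp add: ennreal_mult_less_top)
    finally have "T < \<infinity>" .
    then obtain s where s: "T = ennreal s" "s \<ge> 0" by (cases T) auto
    obtain U :: "'a \<Rightarrow> ennreal" where U: "U \<in> borel_measurable borel" "\<And>y. ennreal (f y)
        \<le> U y" "AE y in \<mu>. U y = ennreal (f y)"
      using borel_majorant[OF f f01(1)] by blast
    have [measurable]: "g \<in> borel_measurable \<mu>" "U \<in> borel_measurable \<mu>"
      using upper_gradient_measurable[OF ug] borel_fun_\<mu>[OF U(1)] by auto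
    have \<beta>p: "0 < \<beta> / p" "\<beta> / p \<le> 1" using \<beta> p by (auto simp: divide_le_eq)
    note ugw = upper_gradient_mult_distance_powr[OF ug U(1,2) f01(1) \<delta>(1) \<beta>p, of S]
    have "T \<le> ennreal (C3 / \<beta>) * (ennreal (8 powr p) * energy g UNIV + ennreal (4 powr p * \<beta> powr p)
        * (ennreal (2 powr p) * T))"
      unfolding T_def
    proof (rule SUP_least)
      fix G assume G: "G \<in> FF"
      have "tent_sum f G \<le> ennreal (C3 / \<beta>) * (\<integral>\<^sup>+y. ennreal (dtrunc \<delta> y powr (- \<beta>))
          * ennreal_pow (ennreal (2 * (2 * dtrunc \<delta> y powr (\<beta> / p))) * g y
          + ennreal (2 * (\<beta> / p) * dtrunc \<delta> y powr (\<beta> / p - 1) * indicator {y. \<delta> < d y} y) * U y) p \<partial>\<mu>)"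
        unfolding C3_def
        by (rule tent_sum_weighted[OF bp K \<Lambda> N(2) f f01 fS \<delta>(1) \<beta>(1,2) ugw]) (use G in \<open>auto simp: FF_def\<close>)
      also have "\<dots> \<le> ennreal (C3 / \<beta>) * (ennreal (8 powr p) * energy g UNIV + ennreal (4 powr p
          * \<beta> powr p) *
          inner_hardy \<delta> f)"
        by (intro mult_left_mono weighted_energy_le[OF _ _ f01(1) U(3) f \<delta>(1) \<beta>(1)]) auto
      also have "\<dots> \<le> ennreal (C3 / \<beta>) * (ennreal (8 powr p) * energy g UNIV + ennreal (4 powr p
          * \<beta> powr p) * (ennreal (2 powr p) * T))"
      proof (intro mult_left_mono add_left_mono)
        show "inner_hardy \<delta> f \<le> ennreal (2 powr p) * T"
          by (rule integral_away_from_complement_le[OF f \<delta>(1)]) (auto simp: T_def FF_def intro!: SUP_upper)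
      qed auto
      finally show "tent_sum f G \<le> ennreal (C3 / \<beta>) * (ennreal (8 powr p) * energy g UNIV
          + ennreal (4 powr p * \<beta> powr p) * (ennreal (2 powr p) * (SUP F\<in>FF. tent_sum f F)))"
        unfolding T_def .
    qed
    also have "\<dots> = ennreal (C3 / \<beta> * (8 powr p * e + 4 powr p * \<beta> powr p * (2 powr p * s)))"
      unfolding s(1) real(2) using s real C3 \<beta> by (simp flip: ennreal_mult ennreal_plus)
    finally have "s \<le> C3 / \<beta> * (8 powr p * e + 4 powr p * \<beta> powr p * (2 powr p * s))"
      unfolding s(1) using s real C3 \<beta> by (subst (asm) ennreal_le_iff) auto
    also have "\<dots> = C3 / \<beta> * 8 powr p * e + C3 * (4 powr p * 2 powr p) * (\<beta> powr p / \<beta>) * s"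
      by (simp add: algebra_simps)
    also have "4 powr p * 2 powr p = (8::real) powr p" by (simp flip: powr_mult)
    also have "\<beta> powr p / \<beta> = \<epsilon>" using \<beta> by (simp add: powr_diff)
    also have "C3 / \<beta> * 8 powr p * e + C3 * 8 powr p * \<epsilon> * s \<le> C3 / \<beta> * 8 powr p * e + 1 / 2 * s"
      using \<epsilon>(3) s by (intro add_left_mono mult_right_mono) auto
    finally have "s \<le> C * e" unfolding C_def by simp
    then have "ennreal s \<le> ennreal C * ennreal e" using C real by (simp add: ennreal_leI flip: ennreal_mult)
    then show ?thesis using FT unfolding s(1) real(2) by (rule order_trans[rotated])
  qed
  show thesis
  proof (rule that[OF C], intro allI impI, elim conjE)
    fix f g F
    assume "f \<in> borel_measurable \<mu>" "\<forall>y. 0 \<le> f y \<and> f y \<le> 1" "\<forall>y\<in>S. f y = 0"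
      "upper_gradient (\<lambda>y. ereal (f y)) g" "(\<integral>\<^sup>+y. ennreal (f y powr p) \<partial>\<mu>) < \<infinity>" "finite F" "F \<subseteq> J"
    then show "tent_sum f F \<le> ennreal C * energy g UNIV" by (intro main) auto
  qed
qed

lemma rel_cap_empty: "rel_cap M p {} \<Omega> = 0"
proof -
  have "rel_cap M p {} \<Omega> \<le> (\<integral>\<^sup>+x. ennreal_pow ((\<lambda>_. 0) x) p \<partial>\<mu>)"
    by (rule rel_cap_le[where f = "\<lambda>_. 0"]) (use p in \<open>auto simp: upper_gradient_real\<close>)
  then show ?thesis using p by (simp add: ennreal_pow_def)
qed

text \<open>
  The functions \<open>f * cutoff (ctr i) (c * rad i)\<close> test the sets \<open>E \<inter> W i\<close>. Their energies are local parts
  of the energy of \<open>f\<close>, which overlap boundedly, and the terms of the Hardy sum.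
\<close>

lemma quasiadditive_of_fat_complement:
  assumes Cf: "Cf > 0"
    and fat: "\<And>w r. \<lbrakk>w \<in> S; r > 0\<rbrakk> \<Longrightarrow>
      ennreal Cf * rel_cap M p (ball w r) (ball w (2 * r)) \<le> rel_cap M p (S \<inter> ball w r) (ball w (2 * r))"
    and W: "\<And>i. i \<in> J \<Longrightarrow> W i = ball (ctr i) (c * rad i)" "\<And>i. i \<notin> J \<Longrightarrow> W i = {}"
  obtains A where "A > 0" "\<And>E. (\<Sum>i. rel_cap M p (E \<inter> W i) (- S)) \<le> ennreal A * rel_cap M p E (- S)"
proof -
  obtain K \<Lambda> where K: "K > 0" and \<Lambda>: "\<Lambda> \<ge> 1"
    and bp: "boundary_poincare S K \<Lambda>"
    by (rule boundary_poincare_of_fat[OF S Cf fat])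
  obtain N where N: "N \<ge> 1" "scale_packing \<Lambda> N"
    by (rule card_scale[OF \<Lambda>])
  obtain C where C: "C > 0" and hardy: "\<forall>f g F. f \<in> borel_measurable \<mu> \<and> (\<forall>y. 0 \<le> f y \<and> f y \<le> 1)
      \<and> (\<forall>y\<in>S. f y = 0) \<and>
      upper_gradient (\<lambda>y. ereal (f y)) g \<and> (\<integral>\<^sup>+y. ennreal (f y powr p) \<partial>\<mu>) < \<infinity> \<and> finite F \<and> F \<subseteq> J
    \<longrightarrow> tent_sum f F \<le> ennreal C * energy g UNIV"
    by (rule hardy[OF bp K \<Lambda> N])
  define A where "A = 2 powr p * (2 powr p * (2 * N) + c powr (- p) * C)"
  have A: "A > 0" unfolding A_def using N(1) C c by (intro mult_pos_pos add_pos_pos) auto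
  have est: "(\<Sum>i. rel_cap M p (E \<inter> W i) (- S)) \<le> ennreal A * energy g UNIV"
    if f[measurable]: "f \<in> borel_measurable \<mu>" and f01: "\<And>x. 0 \<le> f x" "\<And>x. f x \<le> 1"
      and fS: "\<And>x. x \<notin> - S \<Longrightarrow> f x = 0" and fE: "\<And>x. x \<in> E \<Longrightarrow> f x = 1"
      and fin: "(\<integral>\<^sup>+x. ennreal (f x powr p) \<partial>\<mu>) < \<infinity>" and ug: "upper_gradient (\<lambda>x. ereal (f x)) g" for E f g
  proof (rule suminf_le_const[OF summableI])
    fix n :: nat
    define F where "F = {..<n} \<inter> J"
    have F: "finite F" "F \<subseteq> J" by (auto simp: F_def)
    have [measurable]: "g \<in> borel_measurable \<mu>" by (rule upper_gradient_measurable[OF ug])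
    have "(\<Sum>i<n. rel_cap M p (E \<inter> W i) (- S)) = (\<Sum>i\<in>F. rel_cap M p (E \<inter> W i) (- S))"
      unfolding F_def by (rule sum.mono_neutral_right) (auto simp: W(2) rel_cap_empty)
    also have "\<dots> \<le> (\<Sum>i\<in>F. ennreal (2 powr p) * (ennreal (2 powr p) * energy g (tent i)
        + ennreal (c powr (- p)) * (ennreal (rad i powr (- p)) * pmass f (tent i))))"
    proof (rule sum_mono)
      fix i assume "i \<in> F"
      then have i: "i \<in> J" by (simp add: F_def)
      have ri: "rad i > 0" by (rule rad_pos[OF i])
      have cr: "c * rad i \<le> 1 / 8 * rad i" using c ri by (intro mult_right_mono) auto
      have "y \<notin> S" if "y \<in> ball (ctr i) (2 * (c * rad i))" for y
        using that cr ri infdist_le[of y S "ctr i"] by fastforce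
      then have sub: "ball (ctr i) (2 * (c * rad i)) \<subseteq> - S" by blast
      have sub3: "ball (ctr i) (3 * (c * rad i)) \<subseteq> tent i" using cr ri by (intro subset_ball) linarith
      have "rel_cap M p (E \<inter> W i) (- S) \<le> ennreal (2 powr p) * (ennreal (2 powr p)
          * energy g (ball (ctr i) (3 * (c * rad i)))
          + ennreal ((c * rad i) powr (- p)) * pmass f (ball (ctr i) (3 * (c * rad i))))"
        by (rule rel_cap_cutoff_le[OF f f01 ug]) (use c ri fE sub W(1)[OF i] in auto)
      also have "\<dots> \<le> ennreal (2 powr p) * (ennreal (2 powr p) * energy g (tent i)
          + ennreal ((c * rad i) powr (- p)) * pmass f (tent i))"
      proof (intro mult_left_mono add_mono energy_mono sub3)
        show "pmass f (ball (ctr i) (3 * (c * rad i))) \<le> pmass f (tent i)"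
          using sub3 by (intro nn_integral_mono mult_left_mono) (auto simp: indicator_def)
      qed auto
      also have "ennreal ((c * rad i) powr (- p)) = ennreal (c powr (- p)) * ennreal (rad i powr (- p))"
        using c ri by (simp add: powr_mult ennreal_mult)
      finally show "rel_cap M p (E \<inter> W i) (- S)
          \<le> ennreal (2 powr p) * (ennreal (2 powr p) * energy g (tent i)
        + ennreal (c powr (- p)) * (ennreal (rad i powr (- p)) * pmass f (tent i)))"
        by (simp only: mult.assoc)
    qed
    also have "\<dots> = ennreal (2 powr p) * (ennreal (2 powr p) * (\<Sum>i\<in>F. energy g (tent i))
        + ennreal (c powr (- p)) * tent_sum f F)"
      by (simp only: sum_distrib_left[symmetric] sum.distrib)
    also have "\<dots> \<le> ennreal (2 powr p) * (ennreal (2 powr p) * (ennreal (2 * N) * energy g UNIV)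
        + ennreal (c powr (- p)) * (ennreal C * energy g UNIV))"
    proof (intro mult_left_mono add_mono)
      show "(\<Sum>i\<in>F. energy g (tent i)) \<le> ennreal (2 * N) * energy g UNIV"
        unfolding energy_def
      proof (rule sum_nn_integral_overlap)
        show "UNIV \<in> sets \<mu>" by (simp add: borel_sets_\<mu>)
        show "real (card {i \<in> F. y \<in> tent i}) \<le> 2 * N" for y by (rule card_tent[OF N(2) \<Lambda> F])
      qed (use F in auto)
      show "tent_sum f F \<le> ennreal C * energy g UNIV"
        by (rule hardy[rule_format, of f g F], intro conjI allI ballI f ug fin F) (use f01 fS in auto)
    qed auto
    also have "\<dots> = ennreal A * energy g UNIV"
      unfolding A_def using N(1) C by (simp add: ennreal_mult distrib_left distrib_right mult.assoc)
    finally show "(\<Sum>i<n. rel_cap M p (E \<inter> W i) (- S)) \<le> ennreal A * energy g UNIV" .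
  qed
  show thesis
  proof (rule that[OF A])
    fix E
    have "ennreal (1 / A) * (\<Sum>i. rel_cap M p (E \<inter> W i) (- S)) \<le> rel_cap M p E (- S)"
    proof (rule le_rel_cap)
      fix f g
      assume *: "f \<in> borel_measurable \<mu>" "\<And>x. 0 \<le> f x" "\<And>x. f x \<le> 1" "\<And>x. x \<notin> - S \<Longrightarrow> f x = 0" "\<And>x. x \<in> E
          \<Longrightarrow> f x = 1"
        "(\<integral>\<^sup>+x. ennreal (f x powr p) \<partial>\<mu>) < \<infinity>" "upper_gradient (\<lambda>x. ereal (f x)) g"
      have "ennreal (1 / A) * (\<Sum>i. rel_cap M p (E \<inter> W i) (- S))
          \<le> ennreal (1 / A) * (ennreal A * energy g UNIV)"
        by (intro mult_left_mono est[OF *]) auto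
      also have "\<dots> = energy g UNIV" using A by (simp flip: mult.assoc ennreal_mult)
      finally show "ennreal (1 / A) * (\<Sum>i. rel_cap M p (E \<inter> W i) (- S)) \<le> (\<integral>\<^sup>+x. ennreal_pow (g x) p \<partial>\<mu>)"
        unfolding energy_UNIV .
    qed
    then have "ennreal A * (ennreal (1 / A) * (\<Sum>i. rel_cap M p (E \<inter> W i) (- S)))
        \<le> ennreal A * rel_cap M p E (- S)"
      by (rule mult_left_mono) simp
    then show "(\<Sum>i. rel_cap M p (E \<inter> W i) (- S)) \<le> ennreal A * rel_cap M p E (- S)"
      using A by (simp flip: mult.assoc ennreal_mult)
  qed
qed

end

section \<open>Quasiadditivity\<close>

text \<open>
  If \<open>b = a\<^sup>1\<^sup>/\<^sup>p\<close> exceeds \<open>\<tau>\<close>, then \<open>\<tau>\<^sup>1\<^sup>-\<^sup>p a = (b / \<tau>)\<^sup>p\<^sup>-\<^sup>1 b \<ge> b\<close>.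
\<close>

lemma powr_inverse_le_linear:
  fixes a \<tau> p :: real
  assumes "a \<ge> 0" "\<tau> > 0" "p > 1"
  shows "a powr (1 / p) \<le> \<tau> + \<tau> powr (1 - p) * a"
proof (cases "a powr (1 / p) \<le> \<tau>")
  case False
  define b where "b = a powr (1 / p)"
  have b: "b > \<tau>" using False by (simp add: b_def)
  have a: "a = b powr (p - 1) * b"
    using assms b unfolding b_def by (cases "a = 0") (auto simp: powr_powr powr_diff field_simps)
  have "1 * b \<le> \<tau> powr (1 - p) * b powr (p - 1) * b"
  proof (rule mult_right_mono)
    have "\<tau> powr (1 - p) * \<tau> powr (p - 1) \<le> \<tau> powr (1 - p) * b powr (p - 1)"
      using assms b by (intro mult_left_mono powr_mono2) auto
    then show "1 \<le> \<tau> powr (1 - p) * b powr (p - 1)" using assms by (simp flip: powr_add)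
  qed (use b assms in auto)
  then have "b \<le> \<tau> powr (1 - p) * a" using a by (simp add: mult.assoc)
  then show ?thesis using assms unfolding b_def by simp
qed (use assms in \<open>simp add: add_increasing2\<close>)

lemma ennreal_mult_div:
  fixes X Y :: ennreal
  assumes "X / ennreal v \<le> Y" "v > 0"
  shows "X \<le> Y * ennreal v"
proof -
  have "X = X / ennreal v * ennreal v"
    using assms(2) by (simp add: ennreal_divide_times ennreal_times_divide mult_divide_eq_ennreal)
  also have "\<dots> \<le> Y * ennreal v" by (rule mult_right_mono[OF assms(1)]) simp
  finally show ?thesis .
qed

lemma (in doubling_space) poincare_space_of_poincare_inequality:
  assumes p: "1 < p" and pi: "poincare_inequality M p"
  obtains CP L where "poincare_space M CD p CP L"
proof -
  obtain CP L :: real where CP: "CP > 0" and L: "L \<ge> 1"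
    and P: "\<And>x r f g. \<lbrakk>r > 0; f \<in> borel_measurable \<mu>; upper_gradient f g;
        (\<integral>\<^sup>+y\<in>ball x r. e2ennreal \<bar>f y\<bar> \<partial>\<mu>) < \<infinity>\<rbrakk> \<Longrightarrow>
        (\<integral>\<^sup>+y\<in>ball x r. e2ennreal \<bar>f y - ereal (ball_average M f x r)\<bar> \<partial>\<mu>) / emeasure M (ball x r)
          \<le> ennreal (CP * r) *
            ennreal_pow ((\<integral>\<^sup>+y\<in>ball x (L * r). ennreal_pow (g y) p \<partial>M) / emeasure M (ball x (L
                * r))) (1 / p)"
    using pi unfolding poincare_inequality_def by blast
  have "poincare_space_axioms M p CP L"
  proof
    show "1 < p" "1 \<le> L" "0 < CP" by fact+
    fix f g F x r
    assume f[measurable]: "f \<in> borel_measurable (completion M)" and ug: "upper_gradient (\<lambda>y. ereal (f y)) g"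
      and F: "\<And>y. \<bar>f y\<bar> \<le> F" and r: "(r::real) > 0"
    define a where "a = ball_average M (\<lambda>y. ereal (f y)) x r"
    define e' where "e' = (\<integral>\<^sup>+y\<in>ball x (L * r). ennreal_pow (g y) p \<partial>\<mu>)"
    have Lr: "r \<le> L * r" "L * r > 0" using mult_right_mono[OF L, of r] r by auto
    have F0: "F \<ge> 0" using F[of x] by linarith
    have "(\<integral>\<^sup>+y\<in>ball x r. e2ennreal \<bar>ereal (f y)\<bar> \<partial>\<mu>) \<le> (\<integral>\<^sup>+y\<in>ball x r. ennreal F \<partial>\<mu>)"
      by (intro nn_integral_mono mult_right_mono) (auto intro: ennreal_leI F)
    also have "\<dots> = ennreal F * emeasure \<mu> (ball x r)" by (rule nn_integral_cmult_indicator) measurable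
    also have "\<dots> < \<infinity>" using r by (simp add: emeasure_ball ennreal_mult_less_top del: emeasure_completion)
    finally have fin: "(\<integral>\<^sup>+y\<in>ball x r. e2ennreal \<bar>ereal (f y)\<bar> \<partial>\<mu>) < \<infinity>" .
    have em: "emeasure M (ball x s) = ennreal (vol x s)" if "s > 0" for s
      using emeasure_ball[OF that, of x] by (simp add: borel_sets)
    have fe: "(\<lambda>y. ereal (f y)) \<in> borel_measurable \<mu>" by measurable
    have "(\<integral>\<^sup>+y\<in>ball x r. ennreal \<bar>f y - a\<bar> \<partial>\<mu>) / ennreal (vol x r)
        \<le> ennreal (CP * r) * ennreal_pow (e' / ennreal (vol x (L * r))) (1 / p)"
      using P[OF r fe ug fin] unfolding a_def[symmetric] em[OF r] em[OF Lr(2)] e'_def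
          nn_integral_completion by simp
    then have main: "(\<integral>\<^sup>+y\<in>ball x r. ennreal \<bar>f y - a\<bar> \<partial>\<mu>)
        \<le> ennreal (CP * r) * ennreal_pow (e' / ennreal (vol x (L * r))) (1 / p) * ennreal (vol x r)"
      by (rule ennreal_mult_div) (rule vol_pos[OF r])
    have "(\<integral>\<^sup>+y\<in>ball x r. ennreal \<bar>f y - a\<bar> \<partial>\<mu>)
        \<le> ennreal (CP * r) * (ennreal (\<tau> * vol x r) + ennreal (\<tau> powr (1 - p)) * e')"
      if \<tau>: "\<tau> > 0" for \<tau>
    proof (cases e')
      case (real e)
      have v: "vol x r > 0" "vol x (L * r) > 0" "vol x r \<le> vol x (L * r)"
        using vol_pos[OF r] vol_pos[OF Lr(2)] Lr by (auto intro!: vol_mono subset_ball)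
      have q: "e' / ennreal (vol x (L * r)) = ennreal (e / vol x (L * r))" using real v
          by (simp add: divide_ennreal)
      have "(e / vol x (L * r)) powr (1 / p) * vol x r
          \<le> (\<tau> + \<tau> powr (1 - p) * (e / vol x (L * r))) * vol x r"
        using powr_inverse_le_linear[of "e / vol x (L * r)" \<tau> p] real v \<tau> p by (intro mult_right_mono) auto
      also have "\<dots> = \<tau> * vol x r + \<tau> powr (1 - p) * (e * (vol x r / vol x (L * r)))"
          by (simp add: algebra_simps)
      also have "\<dots> \<le> \<tau> * vol x r + \<tau> powr (1 - p) * (e * 1)"
        using v real by (intro add_left_mono mult_left_mono) auto
      finally have "CP * r * ((e / vol x (L * r)) powr (1 / p) * vol x r)
          \<le> CP * r * (\<tau> * vol x r + \<tau> powr (1 - p) * e)"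
        using CP r by (intro mult_left_mono) auto
      then have "ennreal (CP * r) * ennreal_pow (e' / ennreal (vol x (L * r))) (1 / p) * ennreal (vol x r)
          \<le> ennreal (CP * r * (\<tau> * vol x r + \<tau> powr (1 - p) * e))"
        unfolding q using real v CP r by (simp add: ennreal_pow_ennreal ennreal_leI mult.assoc flip:
            ennreal_mult)
      also have "\<dots> = ennreal (CP * r) * (ennreal (\<tau> * vol x r) + ennreal (\<tau> powr (1 - p)) * e')"
        unfolding real(2) using real(1) v CP r \<tau> by (simp add: ennreal_mult)
      finally show ?thesis using main by (rule order_trans[rotated])
    next
      case top
      then show ?thesis using CP r \<tau> by (simp add: ennreal_mult_top)
    qed
    then show "\<exists>a. \<forall>\<tau>>0. (\<integral>\<^sup>+y\<in>ball x r. ennreal \<bar>f y - a\<bar> \<partial>completion M)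
        \<le> ennreal (CP * r) * (ennreal (\<tau> * measure M (ball x r)) +
            ennreal (\<tau> powr (1 - p)) * (\<integral>\<^sup>+y\<in>ball x (L * r). ennreal_pow (g y) p \<partial>completion M))"
      unfolding e'_def by blast
  qed
  then have "poincare_space M CD p CP L"
    unfolding poincare_space_def using doubling_space_axioms by blast
  then show thesis by (rule that)
qed

lemma whitney_cover_overlap:
  assumes "\<And>y. (\<Sum>i. indicator (W i) y) \<le> ennreal C" "finite F" "C \<ge> 0"
  shows "real (card {i \<in> F. y \<in> W i}) \<le> C"
proof -
  have "ennreal (real (card {i \<in> F. y \<in> W i})) = (\<Sum>i\<in>F. indicator (W i) y)"
    using assms(2) by (simp add: indicator_def sum.If_cases Int_def ennreal_of_nat_eq_real_of_nat)
  also have "\<dots> \<le> (\<Sum>i. indicator (W i) y)" by (rule sum_le_suminf[OF summableI assms(2)]) auto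
  also have "\<dots> \<le> ennreal C" by (rule assms(1))
  finally show ?thesis using assms(3) by (simp add: ennreal_le_iff)
qed

theorem corollary3p6:
  fixes M :: "'a::complete_space measure" and p :: real
  assumes "sets M = sets borel"
    and "\<forall>x r. r > 0 \<longrightarrow> 0 < emeasure M (ball x r) \<and> emeasure M (ball x r) < \<infinity>"
    and "doubling M"
    and "1 < p"
    and "poincare_inequality M p"
  shows "\<exists>c0::real. 0 < c0 \<and> c0 \<le> 1 / 2 \<and>
           (\<forall>\<Omega> c W. open \<Omega> \<and> \<Omega> \<noteq> UNIV \<and> 0 < c \<and> c \<le> c0 \<and> whitney_cover \<Omega> c W \<and>
                    uniformly_fat M p (- \<Omega>) \<longrightarrow> quasiadditive M p \<Omega> W)"
proof -
  obtain C where C: "C > 0" "\<And>x r. r > 0 \<Longrightarrow> emeasure M (ball x (2 * r)) \<le> ennreal C * emeasure M (ball x r)"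
    using assms(3) unfolding doubling_def by blast
  have em: "emeasure M (ball x r) = ennreal (measure M (ball x r))" if "r > 0" for x r
    using assms(2) that by (intro emeasure_eq_ennreal_measure) (auto simp: less_top)
  interpret doubling_space M "max 1 C"
  proof
    fix x and r :: real assume r: "r > 0"
    show "0 < emeasure M (ball x r)" "emeasure M (ball x r) < \<infinity>" using assms(2) r by auto
    have "ennreal (measure M (ball x (2 * r))) \<le> ennreal (C * measure M (ball x r))"
      using C(2)[OF r, of x] C(1) r by (simp add: em ennreal_mult)
    then have "measure M (ball x (2 * r)) \<le> C * measure M (ball x r)"
      using C(1) by (subst (asm) ennreal_le_iff) auto
    also have "\<dots> \<le> max 1 C * measure M (ball x r)" by (intro mult_right_mono) auto
    finally show "measure M (ball x (2 * r)) \<le> max 1 C * measure M (ball x r)" .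
  qed (use assms(1) in auto)
  obtain CP L where PS: "poincare_space M (max 1 C) p CP L"
    by (rule poincare_space_of_poincare_inequality[OF assms(4,5)])
  show ?thesis
  proof (intro exI[of _ "1 / 8"] conjI allI impI, simp, simp, elim conjE)
    fix \<Omega> :: "'a set" and c :: real and W
    assume \<Omega>: "open \<Omega>" "\<Omega> \<noteq> UNIV" and c: "0 < c" "c \<le> 1 / 8" and wc: "whitney_cover \<Omega> c W"
        and fat: "uniformly_fat M p (- \<Omega>)"
    define J where "J = {i. W i \<noteq> {}}"
    have "\<forall>i. \<exists>x. i \<in> J \<longrightarrow> x \<in> \<Omega> \<and> W i = ball x (c * infdist x (- \<Omega>))"
      using wc unfolding whitney_cover_def J_def by blast
    then obtain z where z: "\<And>i. i \<in> J \<Longrightarrow> z i \<in> \<Omega>" "\<And>i. i \<in> J \<Longrightarrow> W i = ball (z i) (c * infdist (z i) (- \<Omega>))"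
      by metis
    obtain C' where C': "\<And>y. (\<Sum>i. indicator (W i) y) \<le> ennreal C'" using wc unfolding whitney_cover_def
        by blast
    have "(\<Sum>i. indicator (W i) y) \<le> ennreal (max 0 C')" for y
      by (rule order_trans[OF C' ennreal_leI]) simp
    note ov = whitney_cover_overlap[OF this]
    interpret whitney_family M "max 1 C" p CP L "- \<Omega>" J z c "max 0 C'"
    proof (intro whitney_family.intro PS whitney_family_axioms.intro)
      show "closed (- \<Omega>)" "- \<Omega> \<noteq> {}" using \<Omega> by auto
      show "0 < c" "c \<le> 1 / 8" by fact+
      show "z i \<notin> - \<Omega>" if "i \<in> J" for i using z that by simp
      show "\<exists>i\<in>J. x \<in> ball (z i) (c * infdist (z i) (- \<Omega>))" if "x \<notin> - \<Omega>" for x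
      proof -
        obtain i where i: "x \<in> W i" using wc \<open>x \<notin> - \<Omega>\<close> unfolding whitney_cover_def by auto
        then have "i \<in> J" by (auto simp: J_def)
        then show ?thesis using i z(2) by blast
      qed
      fix F y assume F: "finite F" "F \<subseteq> J"
      have "{i \<in> F. y \<in> ball (z i) (c * infdist (z i) (- \<Omega>))} = {i \<in> F. y \<in> W i}"
        using z(2) F(2) by blast
      then show "real (card {i \<in> F. y \<in> ball (z i) (c * infdist (z i) (- \<Omega>))}) \<le> max 0 C'"
        using ov[OF F(1), of y] by simp
    qed
    obtain Cf where Cf: "Cf > 0" and fat': "\<And>w r. \<lbrakk>w \<in> - \<Omega>; r > 0\<rbrakk> \<Longrightarrow>
        ennreal Cf * rel_cap M p (ball w r) (ball w (2 * r))
            \<le> rel_cap M p (- \<Omega> \<inter> ball w r) (ball w (2 * r))"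
      using fat unfolding uniformly_fat_def by blast
    show "quasiadditive M p \<Omega> W"
    proof (rule quasiadditive_of_fat_complement[of Cf W])
      show "Cf > 0" by (rule Cf)
      show "ennreal Cf * rel_cap M p (ball w r) (ball w (2 * r))
          \<le> rel_cap M p (- \<Omega> \<inter> ball w r) (ball w (2 * r))"
        if "w \<in> - \<Omega>" "r > 0" for w r using that by (rule fat')
      show "W i = ball (z i) (c * infdist (z i) (- \<Omega>))" if "i \<in> J" for i using that by (rule z(2))
      show "W i = {}" if "i \<notin> J" for i using that by (simp add: J_def)
      fix A assume "A > 0" "\<And>E. (\<Sum>i. rel_cap M p (E \<inter> W i) (- (- \<Omega>))) \<le> ennreal A * rel_cap M p E (- (- \<Omega>))"
      then show ?thesis unfolding quasiadditive_def double_complement by blast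
    qed
  qed
qed

end
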